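(* Let $G=G_1\star\cdots\star G_n$ ($n\ge2$) be a free product of nontrivial finite groups, not isomorphic to $\mathbb Z/2\mathbb Z\star\mathbb Z/2\mathbb Z$. Set $\Sigma_i=G_i\setminus\{1_{G_i}\}$, $k_i=|\Sigma_i|$, $\Sigma=\bigsqcup_i\Sigma_i$. Let $\rho$ be the unique positive solution of $\sum_{i=1}^n k_i/(x+k_i)=1$. Consider the probability measure $\mu=\sum_i\frac{k_i}{\rho+k_i}U_{\Sigma_i}$ on $\Sigma$, where $U_{\Sigma_i}$ is the uniform distribution on $\Sigma_i$. Then: (i) For $(G,\mu)$ one has $h/(\gamma v)=1$, where $h$, $\gamma$, $v$ are the entropy, drift and volume. The set of generators $\Sigma$ is extremal. (ii) The harmonic measure $\mu^\infty$ of $(G,\mu)$ is given by: for all nonempty $u_1\cdots u_k\in L$ with $u_k\in\Sigma_j$, $$\mu^\infty(u_1\cdots u_k\Sigma^{\mathbb N})=\frac{1}{\rho^{k-1}}\,\frac{1}{\rho+k_j}.$$ (iii) Let $\tau:\Sigma^{\mathbb N}\to\Sigma^{\mathbb N}$, $(x_n)_n\mapsto(x_{n+1})_n$. The symbolic dynamical system $(L^\infty,\tau)$ is a subshift of finite type whose measure of maximal entropy $\nu_{\max}$ is defined by: for all nonempty $u_1\cdots u_k\in L$ with $u_1\in\Sigma_i$, $u_k\in\Sigma_j$, $$\nu_{\max}(u_1\cdots u_k\Sigma^{\mathbb N})=\frac{1}{\rho+k_i}\,\frac{1}{\rho^{k-2}}\,\frac{1}{\rho+k_j}.$$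
   Context: Elements of $G$ are identified with the set $L$ of finite words over $\Sigma$ with consecutive letters in different $\Sigma_i$'s (empty word $=1$); $|g|$ is the number of letters, i.e. the word length of $g$ with respect to $\Sigma$. $L^\infty\subset\Sigma^{\mathbb N}$ is the set of infinite words all of whose finite prefixes lie in $L$; $u\Sigma^{\mathbb N}$ is the cylinder of words with prefix $u$. For a probability measure $\mu$ on $\Sigma$ with $\bigcup_{m\ge1}\mathrm{supp}\,\mu^{*m}=G$, the random walk $(G,\mu)$ is $X_0=1$, $X_{m+1}=X_m\ast x_m$ with $(x_m)$ i.i.d. of law $\mu$. Drift: the a.s. constant limit $\gamma=\gamma(\Sigma,\mu)=\lim_m|X_m|/m$. Entropy: $h=h(\mu)=\lim_m H(\mu^{*m})/m$ where $H(\lambda)=-\sum_x\lambda(x)\log\lambda(x)$. Volume: $v=v(\Sigma)=\lim_m\frac1m\log\#\{g\in G:|g|=m\}$. The inequality $h\le\gamma v$ always holds. Harmonic measure $\mu^\infty$: the law of the a.s. limit $X_\infty\in L^\infty$ of $X_m$ (the common prefix length of $X_m$ and $X_\infty$ tends to infinity). $\Sigma$ is called extremal if $Q(\Sigma)=1$, where $Q(\Sigma)=\sup_{\mu}\frac{h(\mu)}{\gamma(\Sigma,\mu)v(\Sigma)}$, the supremum being over probability measures $\mu$ on $\Sigma$ with $\mu(a)=\mu(a^{-1})$ for all $a\in\Sigma$ and $\bigcup_{m\ge1}\mathrm{supp}\,\mu^{*m}=G$. The measure of maximal entropy is the $\tau$-invariant probability measure on $L^\infty$ maximizing the Kolmogorov–Sinai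 entropy.
   Formalization: In (iii) the displayed values are divided by their total mass over one-letter words, since as displayed they sum to 1 − Σ(k_i/(ρ+k_i))² < 1 (for example 2/3 for three groups of order two, where ρ = 2) and so cannot define a probability measure. *)

theory Defs
  imports "HOL-Probability.Probability" "HOL-Algebra.Elementary_Groups"
begin

section \<open>Free products of groups in normal form\<close>

text \<open>
  A family of groups is a function \<open>G\<close> on indices \<open>i < n\<close>. Tagging the elements with their index
  makes the alphabets disjoint.
\<close>

definition letters_at :: "(nat \<Rightarrow> ('a, 'b) monoid_scheme) \<Rightarrow> nat \<Rightarrow> (nat \<times> 'a) set" where
  "letters_at G i = {i} \<times> (carrier (G i) - {\<one>\<^bsub>G i\<^esub>})"

definition letters :: "nat \<Rightarrow> (nat \<Rightarrow> ('a, 'b) monoid_scheme) \<Rightarrow> (nat \<times> 'a) set" where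
  "letters n G = (\<Union>i<n. letters_at G i)"

definition reduced_words :: "nat \<Rightarrow> (nat \<Rightarrow> ('a, 'b) monoid_scheme) \<Rightarrow> (nat \<times> 'a) list set" where
  "reduced_words n G =
     {w. set w \<subseteq> letters n G \<and> successively (\<lambda>a b. fst a \<noteq> fst b) w}"

definition letter_inv :: "(nat \<Rightarrow> ('a, 'b) monoid_scheme) \<Rightarrow> nat \<times> 'a \<Rightarrow> nat \<times> 'a" where
  "letter_inv G a = (fst a, inv\<^bsub>G (fst a)\<^esub> (snd a))"

text \<open>Left multiplication of a reduced word by a single letter.\<close>

fun letter_mult :: "(nat \<Rightarrow> ('a, 'b) monoid_scheme) \<Rightarrow> nat \<times> 'a \<Rightarrow> (nat \<times> 'a) list \<Rightarrow> (nat \<times> 'a) list" where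
  "letter_mult G (i, g) [] = [(i, g)]"
| "letter_mult G (i, g) ((j, h) # w) =
     (if i \<noteq> j then (i, g) # (j, h) # w
      else if g \<otimes>\<^bsub>G i\<^esub> h = \<one>\<^bsub>G i\<^esub> then w
      else (i, g \<otimes>\<^bsub>G i\<^esub> h) # w)"

definition free_product :: "nat \<Rightarrow> (nat \<Rightarrow> ('a, 'b) monoid_scheme) \<Rightarrow> (nat \<times> 'a) list monoid" where
  "free_product n G =
     \<lparr>carrier = reduced_words n G, monoid.mult = (\<lambda>u v. foldr (letter_mult G) u v), one = []\<rparr>"


section \<open>Random walks: entropy, drift, volume\<close>

definition convolution :: "('g, 'b) monoid_scheme \<Rightarrow> 'g pmf \<Rightarrow> 'g pmf \<Rightarrow> 'g pmf" where
  "convolution H p q = map_pmf (\<lambda>(x, y). x \<otimes>\<^bsub>H\<^esub> y) (pair_pmf p q)"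

primrec conv_pow :: "('g, 'b) monoid_scheme \<Rightarrow> 'g pmf \<Rightarrow> nat \<Rightarrow> 'g pmf" where
  "conv_pow H p 0 = return_pmf \<one>\<^bsub>H\<^esub>"
| "conv_pow H p (Suc m) = convolution H (conv_pow H p m) p"

text \<open>\<open>walk_law n G \<mu> m\<close> is the convolution power \<open>\<mu>\<^sup>*\<^sup>m\<close>, a law on the free product.\<close>

definition walk_law :: "nat \<Rightarrow> (nat \<Rightarrow> ('a, 'b) monoid_scheme) \<Rightarrow> (nat \<times> 'a) pmf \<Rightarrow> nat \<Rightarrow> (nat \<times> 'a) list pmf" where
  "walk_law n G \<mu> m = conv_pow (free_product n G) (map_pmf (\<lambda>a. [a]) \<mu>) m"

definition generating :: "nat \<Rightarrow> (nat \<Rightarrow> ('a, 'b) monoid_scheme) \<Rightarrow> (nat \<times> 'a) pmf \<Rightarrow> bool" where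
  "generating n G \<mu> \<longleftrightarrow> (\<Union>m\<in>{1..}. set_pmf (walk_law n G \<mu> m)) = carrier (free_product n G)"

text \<open>The sum below is meant for finite supports, the only ones that occur for walks on a finite
  alphabet.\<close>

definition pmf_entropy :: "'x pmf \<Rightarrow> real" where
  "pmf_entropy p = - (\<Sum>x\<in>set_pmf p. pmf p x * ln (pmf p x))"

definition walk_entropy :: "nat \<Rightarrow> (nat \<Rightarrow> ('a, 'b) monoid_scheme) \<Rightarrow> (nat \<times> 'a) pmf \<Rightarrow> real" where
  "walk_entropy n G \<mu> = lim (\<lambda>m. pmf_entropy (walk_law n G \<mu> m) / real m)"

text \<open>The walk is realised on the canonical space of i.i.d. increments,
  \<^term>\<open>stream_space (measure_pmf \<mu>)\<close>.\<close>

primrec walk :: "nat \<Rightarrow> (nat \<Rightarrow> ('a, 'b) monoid_scheme) \<Rightarrow> (nat \<times> 'a) stream \<Rightarrow> nat \<Rightarrow> (nat \<times> 'a) list" where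
  "walk n G \<omega> 0 = \<one>\<^bsub>free_product n G\<^esub>"
| "walk n G \<omega> (Suc m) = walk n G \<omega> m \<otimes>\<^bsub>free_product n G\<^esub> [\<omega> !! m]"

definition drift :: "nat \<Rightarrow> (nat \<Rightarrow> ('a, 'b) monoid_scheme) \<Rightarrow> (nat \<times> 'a) pmf \<Rightarrow> real" where
  "drift n G \<mu> = (THE \<gamma>. AE \<omega> in stream_space (measure_pmf \<mu>).
     (\<lambda>m. real (length (walk n G \<omega> m)) / real m) \<longlonglongrightarrow> \<gamma>)"

definition volume :: "nat \<Rightarrow> (nat \<Rightarrow> ('a, 'b) monoid_scheme) \<Rightarrow> real" where
  "volume n G = lim (\<lambda>m. ln (real (card {g \<in> carrier (free_product n G). length g = m})) / real m)"

text \<open>The supremum is taken in the extended reals, where it is meaningful without a prior bound.\<close>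

definition extremality_quotient :: "nat \<Rightarrow> (nat \<Rightarrow> ('a, 'b) monoid_scheme) \<Rightarrow> ereal" where
  "extremality_quotient n G =
     (SUP \<mu> \<in> {\<mu>. set_pmf \<mu> \<subseteq> letters n G
                  \<and> (\<forall>a\<in>letters n G. pmf \<mu> a = pmf \<mu> (letter_inv G a))
                  \<and> generating n G \<mu>}.
        ereal (walk_entropy n G \<mu> / (drift n G \<mu> * volume n G)))"

definition extremal :: "nat \<Rightarrow> (nat \<Rightarrow> ('a, 'b) monoid_scheme) \<Rightarrow> bool" where
  "extremal n G \<longleftrightarrow> extremality_quotient n G = 1"


section \<open>Infinite words and the harmonic measure\<close>

definition infinite_words :: "nat \<Rightarrow> (nat \<Rightarrow> ('a, 'b) monoid_scheme) \<Rightarrow> (nat \<times> 'a) stream set" where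
  "infinite_words n G = {s \<in> streams (letters n G). \<forall>m. stake m s \<in> reduced_words n G}"

definition infinite_words_space :: "nat \<Rightarrow> (nat \<Rightarrow> ('a, 'b) monoid_scheme) \<Rightarrow> (nat \<times> 'a) stream measure" where
  "infinite_words_space n G =
     restrict_space (stream_space (count_space (letters n G))) (infinite_words n G)"

definition cylinder :: "'x set \<Rightarrow> 'x list \<Rightarrow> 'x stream set" where
  "cylinder A u = {s \<in> streams A. stake (length u) s = u}"

definition common_prefix_length :: "'x list \<Rightarrow> 'x stream \<Rightarrow> nat" where
  "common_prefix_length u s = Max {k. k \<le> length u \<and> take k u = stake k s}"

definition is_harmonic_measure ::
  "nat \<Rightarrow> (nat \<Rightarrow> ('a, 'b) monoid_scheme) \<Rightarrow> (nat \<times> 'a) pmf \<Rightarrow> (nat \<times> 'a) stream measure \<Rightarrow> bool" where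
  "is_harmonic_measure n G \<mu> \<nu> \<longleftrightarrow>
     (\<exists>X \<in> stream_space (measure_pmf \<mu>) \<rightarrow>\<^sub>M infinite_words_space n G.
        (AE \<omega> in stream_space (measure_pmf \<mu>).
           filterlim (\<lambda>m. common_prefix_length (walk n G \<omega> m) (X \<omega>)) at_top sequentially)
        \<and> \<nu> = distr (stream_space (measure_pmf \<mu>)) (infinite_words_space n G) X)"


section \<open>Subshifts of finite type and measures of maximal entropy\<close>

text \<open>One-sided subshifts with shift map \<^const>\<open>stl\<close>, given by a finite set \<open>F\<close> of forbidden factors.\<close>

definition subshift_of_finite_type :: "'x set \<Rightarrow> 'x stream set \<Rightarrow> bool" where
  "subshift_of_finite_type A S \<longleftrightarrow> finite A \<and>
     (\<exists>F. finite F \<and> F \<subseteq> lists A \<and>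
        S = {s \<in> streams A. \<forall>m. \<forall>w\<in>F. stake (length w) (sdrop m s) \<noteq> w})"

text \<open>A finite measurable partition is encoded by the function \<open>f\<close> labelling its blocks, so the join
  of the pullbacks of \<open>f\<close> under \<open>T\<^sup>i\<close>, \<open>i < m\<close>, is labelled by the itinerary of length \<open>m\<close>.\<close>

definition partition_entropy :: "'x measure \<Rightarrow> ('x \<Rightarrow> 'y) \<Rightarrow> real" where
  "partition_entropy M f =
     - (\<Sum>y\<in>f ` space M. measure M {x \<in> space M. f x = y} * ln (measure M {x \<in> space M. f x = y}))"

definition ks_entropy :: "'x measure \<Rightarrow> ('x \<Rightarrow> 'x) \<Rightarrow> ereal" where
  "ks_entropy M T =
     (SUP f \<in> {f :: 'x \<Rightarrow> nat. simple_function M f}.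
        ereal (lim (\<lambda>m. partition_entropy M (\<lambda>x. map (\<lambda>i. f ((T ^^ i) x)) [0..<m]) / real m)))"

definition shift_invariant_prob ::
  "nat \<Rightarrow> (nat \<Rightarrow> ('a, 'b) monoid_scheme) \<Rightarrow> (nat \<times> 'a) stream measure \<Rightarrow> bool" where
  "shift_invariant_prob n G \<nu> \<longleftrightarrow>
     prob_space \<nu> \<and> sets \<nu> = sets (infinite_words_space n G) \<and>
     stl \<in> \<nu> \<rightarrow>\<^sub>M \<nu> \<and> distr \<nu> \<nu> stl = \<nu>"

definition is_max_entropy_measure ::
  "nat \<Rightarrow> (nat \<Rightarrow> ('a, 'b) monoid_scheme) \<Rightarrow> (nat \<times> 'a) stream measure \<Rightarrow> bool" where
  "is_max_entropy_measure n G \<nu> \<longleftrightarrow> shift_invariant_prob n G \<nu> \<and>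
     (\<forall>\<nu>'. shift_invariant_prob n G \<nu>' \<longrightarrow> ks_entropy \<nu>' stl \<le> ks_entropy \<nu> stl)"


section \<open>The distinguished measure\<close>

definition rho :: "nat \<Rightarrow> (nat \<Rightarrow> ('a, 'b) monoid_scheme) \<Rightarrow> real" where
  "rho n G = (THE x. x > 0 \<and>
     (\<Sum>i<n. real (card (letters_at G i)) / (x + real (card (letters_at G i)))) = 1)"

definition extremal_pmf :: "nat \<Rightarrow> (nat \<Rightarrow> ('a, 'b) monoid_scheme) \<Rightarrow> (nat \<times> 'a) pmf" where
  "extremal_pmf n G = embed_pmf (\<lambda>a. \<Sum>i<n.
     real (card (letters_at G i)) / (rho n G + real (card (letters_at G i)))
       * pmf (pmf_of_set (letters_at G i)) a)"

text \<open>For a word of length \<open>k\<close> from \<open>\<Sigma>\<^sub>i\<close> to \<open>\<Sigma>\<^sub>j\<close>. The exponent \<open>k - 2\<close> is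
  an integer, equal to \<open>-1\<close> for one-letter words.\<close>

definition cylinder_weight :: "nat \<Rightarrow> (nat \<Rightarrow> ('a, 'b) monoid_scheme) \<Rightarrow> nat \<Rightarrow> nat \<Rightarrow> nat \<Rightarrow> real" where
  "cylinder_weight n G i k j =
     1 / (rho n G + real (card (letters_at G i))) * (1 / (rho n G powi (int k - 2)))
       * (1 / (rho n G + real (card (letters_at G j))))"

text \<open>
  The weights are additive under extension of words, but they are not normalised: their sum over
  the one-letter words is \<open>\<Sum>\<^sub>i k\<^sub>i \<rho> / (\<rho> + k\<^sub>i)\<^sup>2 = 1 - \<Sum>\<^sub>i (k\<^sub>i / (\<rho> + k\<^sub>i))\<^sup>2 < 1\<close>.
  For instance it is \<open>2/3\<close> for three groups of order two, where \<open>\<rho> = 2\<close>. They define a finite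
  measure, which has to be divided by this total mass to become a probability measure.
\<close>

definition total_weight :: "nat \<Rightarrow> (nat \<Rightarrow> ('a, 'b) monoid_scheme) \<Rightarrow> real" where
  "total_weight n G = (\<Sum>a\<in>letters n G. cylinder_weight n G (fst a) 1 (fst a))"

end

theory Submission
  imports Defs "HOL-Library.Sublist" "HOL-Real_Asymp.Real_Asymp"
begin

text \<open>
  For a nearest neighbour walk on the free product, products of weights \<open>z i < 1\<close> over the letters of a
  word can be made superharmonic. As the Cayley graph is tree-like, this bounds the probability that
  the walk ever enters a given cone by a geometric quantity, so that a long increment cancels only
  boundedly many letters of the current position on average. Exponential moments over long blocks
  then give a drift as an almost sure limit, equal to the rate of the mean length.

  The weights \<open>\<kappa>(u) = 1 / (\<rho> ^ (|u| - 1) * (\<rho> + k\<^sub>j))\<close> add up to one over every sphere; hence \<open>v = ln \<rho>\<close>, and Gibbs'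
  inequality against \<open>\<kappa>\<close> gives \<open>h \<le> \<gamma> ln \<rho>\<close> for every walk. For the distinguished measure the constant
  weight \<open>z = 1 / \<rho>\<close> is harmonic off the identity, so that \<open>P(X\<^sub>m = g) \<le> 1 / \<rho> ^ |g|\<close>,
  which is the reverse inequality. The hitting probabilities of cylinders are explicit in terms of
  the same weight and yield the harmonic measure.

  On the shift, Gibbs' inequality bounds the conditional entropy of a letter given a past block by
  \<open>ln \<rho>\<close>, with equality only for Parry's Markov measure.
\<close>

text \<open>All explicit constants come from one identity, \<open>sum_rho_diff\<close>: over the
  letters outside factor j, the values 1 / (\<rho> + k) of their factors add up to \<rho> / (\<rho>
  + k j). So 1 / (\<rho> + k) is a positive eigenvector, with eigenvalue \<rho>, of the symmetric
  matrix that records which letters may be adjacent. Hence the weights \<kappa> are consistent under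
  extension, the weight 1 / \<rho> is harmonic, and Parry's transitions come with an explicit
  stationary law. The obstacle is the supremum in the definition of extremality.
  \<open>drift\<close> is a definite description, so h \<le> \<gamma> v can be proved for a
  competing walk only once its drift is known to exist almost surely. Subadditivity of the mean
  lengths yields only the rate of the means, and for a general symmetric generating measure no
  explicit formula is at hand. This is why transience is drawn from an abstract superharmonic
  weight. The exclusion of the infinite dihedral group enters twice: through \<rho> > 1 and through
  the existence of that weight.\<close>

text \<open>Fekete's lemma with the limit identified as the infimum of the rates; the bound from
  below is what controls lower deviations of the length in
  \<open>summable_length_deviation\<close>.\<close>

lemma fekete:
  fixes a :: "nat \<Rightarrow> real"
  assumes sub: "\<And>m n. a (m + n) \<le> a m + a n" and nonneg: "\<And>m. 0 \<le> a m"
  obtains l where "(\<lambda>m. a m / real m) \<longlonglongrightarrow> l" "0 \<le> l" "\<And>m. 1 \<le> m \<Longrightarrow> l \<le> a m / real m"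
proof -
  define l where "l = (INF m\<in>{1..}. a m / real m)"
  have bdd: "bdd_below ((\<lambda>m. a m / real m) ` {1..})"
    by (rule bdd_belowI2[of _ 0]) (simp add: nonneg)
  have lower: "l \<le> a m / real m" if "1 \<le> m" for m
    unfolding l_def using that by (intro cINF_lower[OF bdd]) auto
  have l0: "0 \<le> l"
    unfolding l_def by (rule cINF_greatest) (auto simp: nonneg)
  \<comment> \<open>Subadditivity does not force a 0 = 0, so the case q = 0 costs an extra a 0,
    which \<open>M\<close> absorbs together with the remainder of the division.\<close>
  have mult: "a (q * k) \<le> real q * a k + a 0" for q k
  proof (induction q)
    case (Suc q)
    have "a (Suc q * k) \<le> a k + a (q * k)" using sub[of k "q * k"] by simp
    with Suc show ?case by (simp add: algebra_simps)
  qed (simp)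
  have "(\<lambda>m. a m / real m) \<longlonglongrightarrow> l"
  proof (rule LIMSEQ_I)
    fix e :: real assume e: "0 < e"
    have "\<exists>k\<in>{1..}. a k / real k < l + e / 2"
      using cINF_less_iff[OF _ bdd, of "l + e / 2"] e by (force simp: l_def)
    then obtain k where k: "1 \<le> k" "a k / real k < l + e / 2" by auto
    define M where "M = a 0 + (\<Sum>r<k. a r)"
    have M: "a 0 + a r \<le> M" if "r < k" for r
      unfolding M_def using that member_le_sum[of r "{..<k}" a] by (simp add: nonneg)
    obtain N where N: "M / (e / 2) < real N" using reals_Archimedean2 by blast
    have "norm (a m / real m - l) < e" if m: "m \<ge> max N 1" for m
    proof -
      have mpos: "0 < real m" using m by simp
      have "a m \<le> a (m div k * k) + a (m mod k)"
        using sub[of "m div k * k" "m mod k"] by simp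
      also have "\<dots> \<le> real (m div k) * a k + (a 0 + a (m mod k))"
        using mult[of "m div k" k] by simp
      also have "\<dots> \<le> real (m div k) * a k + M"
        using M[of "m mod k"] k by simp
      also have "real (m div k) * a k = real (m div k * k) * (a k / real k)"
        using k by simp
      also have "\<dots> \<le> real m * (a k / real k)"
        using nonneg[of k] by (intro mult_right_mono of_nat_mono) simp_all
      also have "\<dots> \<le> real m * (l + e / 2)"
        using k by (intro mult_left_mono) auto
      finally have 1: "a m \<le> real m * (l + e / 2) + M" by simp
      have "M < e / 2 * real N" using N e by (simp add: field_simps)
      also have "\<dots> \<le> e / 2 * real m" using m e by simp
      finally have "a m < real m * (l + e)" using 1 by (simp add: algebra_simps)
      then have "a m / real m < l + e" using mpos by (simp add: field_simps)
      with lower[of m] m show ?thesis by (simp add: abs_if)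
    qed
    then show "\<exists>no. \<forall>m\<ge>no. norm (a m / real m - l) < e" by blast
  qed
  with l0 lower show ?thesis using that by blast
qed

section \<open>Entropy of finitely supported distributions\<close>

abbreviation expect :: "'a pmf \<Rightarrow> ('a \<Rightarrow> real) \<Rightarrow> real" where
  "expect p f \<equiv> measure_pmf.expectation p f"

lemma expect_sum:
  assumes "finite (set_pmf p)"
  shows "expect p f = (\<Sum>x\<in>set_pmf p. pmf p x * f x)"
  using assms by (subst integral_measure_pmf_real[of "set_pmf p"]) (auto simp: mult.commute)

lemma expect_mono:
  assumes "finite (set_pmf p)" "\<And>x. x \<in> set_pmf p \<Longrightarrow> f x \<le> g x"
  shows "expect p f \<le> expect p g"
  unfolding expect_sum[OF assms(1)] by (intro sum_mono mult_left_mono assms(2)) auto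

lemma expect_cong:
  assumes "\<And>x. x \<in> set_pmf p \<Longrightarrow> f x = g x"
  shows "expect p f = expect p g"
  using assms by (intro integral_cong_AE) (auto simp: AE_measure_pmf_iff)

lemma expect_add:
  assumes "finite (set_pmf p)"
  shows "expect p (\<lambda>x. f x + g x) = expect p f + expect p g"
  by (intro Bochner_Integration.integral_add integrable_measure_pmf_finite assms)

lemma expect_diff:
  assumes "finite (set_pmf p)"
  shows "expect p (\<lambda>x. f x - g x) = expect p f - expect p g"
  by (intro Bochner_Integration.integral_diff integrable_measure_pmf_finite assms)

lemma expect_indicator:
  shows "expect p (\<lambda>x. if P x then 1 else 0) = measure_pmf.prob p {x. P x}"
proof -
  have "expect p (\<lambda>x. if P x then 1 else 0) = expect p (indicator {x. P x})"
    by (intro expect_cong) (auto simp: indicator_def)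
  then show ?thesis by simp
qed

lemma expect_bind:
  assumes "finite (set_pmf p)" "\<And>x. x \<in> set_pmf p \<Longrightarrow> finite (set_pmf (f x))"
  shows "expect (bind_pmf p f) h = expect p (\<lambda>x. expect (f x) h)"
  using assms by (subst pmf_expectation_bind[of "set_pmf p"]) (auto simp: expect_sum)

lemma sum_pmf_set_pmf:
  assumes "finite (set_pmf p)" shows "(\<Sum>x\<in>set_pmf p. pmf p x) = 1"
  using assms by (intro sum_pmf_eq_1) auto

lemma sum_pmf_le_1:
  assumes "finite A" shows "(\<Sum>x\<in>A. pmf p x) \<le> 1"
  using assms by (simp add: measure_measure_pmf_finite[symmetric])

lemma pmf_entropy_expect:
  assumes "finite (set_pmf p)"
  shows "pmf_entropy p = expect p (\<lambda>x. - ln (pmf p x))"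
  by (simp add: pmf_entropy_def expect_sum[OF assms] sum_negf)

lemma pmf_entropy_nonneg: "0 \<le> pmf_entropy p"
  unfolding pmf_entropy_def sum_negf[symmetric]
  by (intro sum_nonneg) (auto intro!: mult_nonneg_nonpos simp: pmf_le_1 set_pmf_iff pmf_positive)

text \<open>The gap is the sum of p * (t - 1 - ln t) with t = q / p, plus the mass missing from q,
  and both parts are nonnegative. If the gap vanishes, every t is a zero of t - 1 - ln t, hence 1.
  Admitting subprobabilities q lets each application compare with weights that live on a larger set
  than the support of p.\<close>

lemma gibbs_inequality:
  assumes fin: "finite (set_pmf p)"
    and q: "\<And>x. x \<in> set_pmf p \<Longrightarrow> 0 < q x" "(\<Sum>x\<in>set_pmf p. q x) \<le> 1"
  shows "pmf_entropy p \<le> expect p (\<lambda>x. - ln (q x))"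
    and "pmf_entropy p = expect p (\<lambda>x. - ln (q x)) \<Longrightarrow> x \<in> set_pmf p \<Longrightarrow> q x = pmf p x"
proof -
  define d where "d x = pmf p x * (- ln (q x)) + pmf p x * ln (pmf p x) - (pmf p x - q x)" for x
  have d_eq: "d x = pmf p x * (q x / pmf p x - 1 - ln (q x / pmf p x))" if "x \<in> set_pmf p" for x
    using that q(1)[OF that] pmf_positive[OF that]
    by (simp add: d_def ln_div field_simps)
  have d0: "0 \<le> d x" if "x \<in> set_pmf p" for x
    using d_eq[OF that] q(1)[OF that] pmf_positive[OF that] ln_le_minus_one[of "q x / pmf p x"] by simp
  have eq: "expect p (\<lambda>x. - ln (q x)) - pmf_entropy p = (\<Sum>x\<in>set_pmf p. d x) + (1 - (\<Sum>x\<in>set_pmf p. q x))"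
    by (simp add: d_def expect_sum[OF fin] pmf_entropy_def sum.distrib sum_subtractf sum_pmf_set_pmf[OF fin])
  then show "pmf_entropy p \<le> expect p (\<lambda>x. - ln (q x))"
    using sum_nonneg[of "set_pmf p" d] d0 q(2) by simp
  assume "pmf_entropy p = expect p (\<lambda>x. - ln (q x))" and x: "x \<in> set_pmf p"
  then have "(\<Sum>x\<in>set_pmf p. d x) = 0"
    using eq sum_nonneg[of "set_pmf p" d] d0 q(2) by simp
  then have "d x = 0" using sum_nonneg_eq_0_iff[OF fin, of d] d0 x by blast
  then have "ln (q x / pmf p x) = q x / pmf p x - 1"
    using d_eq[OF x] pmf_positive[OF x] by simp
  then have "q x / pmf p x = 1"
    using q(1)[OF x] pmf_positive[OF x] by (intro ln_eq_minus_one) auto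
  then show "q x = pmf p x" using pmf_positive[OF x] by simp
qed

lemma pmf_le_pmf_map: "pmf p x \<le> pmf (map_pmf f p) (f x)"
proof -
  have "pmf p x = measure_pmf.prob p {x}" by (simp add: measure_pmf_single)
  also have "\<dots> \<le> measure_pmf.prob p (f -` {f x})"
    by (intro measure_pmf.finite_measure_mono) auto
  finally show ?thesis by (simp add: pmf_map)
qed

text \<open>An image point carries at least the mass of each of its preimages, so - ln of the mass
  decreases pointwise.\<close>

lemma pmf_entropy_map_le:
  assumes "finite (set_pmf p)"
  shows "pmf_entropy (map_pmf f p) \<le> pmf_entropy p"
proof -
  have "pmf_entropy (map_pmf f p) = expect p (\<lambda>x. - ln (pmf (map_pmf f p) (f x)))"
    using assms by (simp add: pmf_entropy_expect)
  also have "\<dots> \<le> expect p (\<lambda>x. - ln (pmf p x))"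
    by (intro expect_mono assms) (simp add: pmf_le_pmf_map pmf_positive)
  finally show ?thesis using assms by (simp add: pmf_entropy_expect)
qed

lemma pmf_entropy_map_inj:
  assumes "finite (set_pmf p)" "inj_on f (set_pmf p)"
  shows "pmf_entropy (map_pmf f p) = pmf_entropy p"
proof (rule antisym[OF pmf_entropy_map_le[OF assms(1)]])
  have "map_pmf (inv_into (set_pmf p) f) (map_pmf f p) = map_pmf id p"
    unfolding map_pmf_comp using assms(2) by (intro map_pmf_cong) (auto simp: inv_into_f_f)
  then have "p = map_pmf (inv_into (set_pmf p) f) (map_pmf f p)" by (simp add: pmf.map_id)
  then show "pmf_entropy p \<le> pmf_entropy (map_pmf f p)"
    using pmf_entropy_map_le[of "map_pmf f p" "inv_into (set_pmf p) f"] assms(1) by simp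
qed

text \<open>Gibbs' inequality against the product of the marginals.\<close>

lemma pmf_entropy_pair_le:
  assumes fin: "finite (set_pmf p)"
  shows "pmf_entropy p \<le> pmf_entropy (map_pmf fst p) + pmf_entropy (map_pmf snd p)"
proof -
  let ?q = "\<lambda>z. pmf (map_pmf fst p) (fst z) * pmf (map_pmf snd p) (snd z)"
  have "(\<Sum>z\<in>set_pmf p. ?q z) \<le> (\<Sum>z\<in>(fst ` set_pmf p) \<times> (snd ` set_pmf p). ?q z)"
    using fin by (intro sum_mono2) (auto intro: rev_image_eqI)
  also have "\<dots> = (\<Sum>x\<in>fst ` set_pmf p. pmf (map_pmf fst p) x) * (\<Sum>y\<in>snd ` set_pmf p. pmf (map_pmf snd p) y)"
    by (simp add: sum_product sum.cartesian_product case_prod_beta)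
  also have "\<dots> \<le> 1 * 1"
    using fin by (intro mult_mono sum_pmf_le_1) (auto intro: sum_nonneg)
  finally have s: "(\<Sum>z\<in>set_pmf p. ?q z) \<le> 1" by simp
  have pos: "0 < pmf (map_pmf fst p) (fst z)" "0 < pmf (map_pmf snd p) (snd z)" if "z \<in> set_pmf p" for z
    using that by (auto intro!: pmf_positive)
  have "pmf_entropy p \<le> expect p (\<lambda>z. - ln (?q z))"
    by (rule gibbs_inequality(1)[OF fin _ s]) (auto intro!: mult_pos_pos pos)
  also have "\<dots> = expect p (\<lambda>z. - ln (pmf (map_pmf fst p) (fst z)) + - ln (pmf (map_pmf snd p) (snd z)))"
    using pos by (intro expect_cong) (simp add: ln_mult_pos)
  also have "\<dots> = pmf_entropy (map_pmf fst p) + pmf_entropy (map_pmf snd p)"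
    using fin by (subst expect_add) (auto simp: pmf_entropy_expect)
  finally show ?thesis .
qed

text \<open>Gibbs' inequality against the law with the same two-coordinate marginals under which x
  and z are independent given y; in other words, conditional mutual information is nonnegative.
  Applied to the first letter, the middle block and the last letter of a word, it makes entropy
  increments decrease.\<close>

lemma pmf_entropy_submodular:
  assumes fin: "finite (set_pmf p)"
  shows "pmf_entropy p + pmf_entropy (map_pmf (\<lambda>(x, y, z). y) p)
    \<le> pmf_entropy (map_pmf (\<lambda>(x, y, z). (x, y)) p) + pmf_entropy (map_pmf (\<lambda>(x, y, z). (y, z)) p)"
proof -
  define p1 where "p1 = map_pmf (\<lambda>(x, y, z). (x, y)) p"
  define p2 where "p2 = map_pmf (\<lambda>(x, y, z). (y, z)) p"
  define p0 where "p0 = map_pmf (\<lambda>(x, y, z). y) p"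
  let ?q = "\<lambda>(x, y, z). pmf p1 (x, y) * pmf p2 (y, z) / pmf p0 y"
  let ?X = "fst ` set_pmf p" and ?Y = "set_pmf p0" and ?Z = "(snd \<circ> snd) ` set_pmf p"
  have finY: "finite ?Y" using fin by (simp add: p0_def)
  have p01: "p0 = map_pmf snd p1" and p02: "p0 = map_pmf fst p2"
    by (simp_all add: p0_def p1_def p2_def map_pmf_comp case_prod_beta')
  have fin1: "finite (set_pmf p1)" "finite (set_pmf p2)" using fin by (simp_all add: p1_def p2_def)
  have s1: "(\<Sum>x\<in>?X. pmf p1 (x, y)) \<le> pmf p0 y" for y
  proof -
    have "(\<Sum>x\<in>?X. pmf p1 (x, y)) = measure_pmf.prob p1 ((\<lambda>x. (x, y)) ` ?X)"
      using fin by (subst measure_measure_pmf_finite) (auto simp: sum.reindex inj_on_def)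
    also have "\<dots> \<le> measure_pmf.prob p1 (snd -` {y})"
      by (intro measure_pmf.finite_measure_mono) auto
    finally show ?thesis by (simp add: p01 pmf_map)
  qed
  have s2: "(\<Sum>z\<in>?Z. pmf p2 (y, z)) \<le> pmf p0 y" for y
  proof -
    have "(\<Sum>z\<in>?Z. pmf p2 (y, z)) = measure_pmf.prob p2 ((\<lambda>z. (y, z)) ` ?Z)"
      using fin by (subst measure_measure_pmf_finite) (auto simp: sum.reindex inj_on_def)
    also have "\<dots> \<le> measure_pmf.prob p2 (fst -` {y})"
      by (intro measure_pmf.finite_measure_mono) auto
    finally show ?thesis by (simp add: p02 pmf_map)
  qed
  have "(\<Sum>w\<in>set_pmf p. ?q w) \<le> (\<Sum>w\<in>?X \<times> ?Y \<times> ?Z. ?q w)"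
  proof (rule sum_mono2)
    show "set_pmf p \<subseteq> ?X \<times> ?Y \<times> ?Z"
      by (force simp: p0_def)
  qed (use fin finY in \<open>auto simp: case_prod_beta\<close>)
  also have "\<dots> = (\<Sum>x\<in>?X. \<Sum>y\<in>?Y. \<Sum>z\<in>?Z. pmf p1 (x, y) * pmf p2 (y, z) / pmf p0 y)"
    by (simp add: sum.cartesian_product case_prod_beta')
  also have "\<dots> = (\<Sum>y\<in>?Y. (\<Sum>x\<in>?X. pmf p1 (x, y)) * (\<Sum>z\<in>?Z. pmf p2 (y, z)) / pmf p0 y)"
    by (subst sum.swap) (simp add: sum_product sum_divide_distrib)
  also have "\<dots> \<le> (\<Sum>y\<in>?Y. pmf p0 y * pmf p0 y / pmf p0 y)"
    by (intro sum_mono divide_right_mono mult_mono s1 s2) (auto intro: sum_nonneg)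
  also have "\<dots> = 1"
    using sum_pmf_set_pmf[OF finY] by (simp add: set_pmf_iff)
  finally have s: "(\<Sum>w\<in>set_pmf p. ?q w) \<le> 1" .
  have pos: "0 < pmf p1 (fst w, fst (snd w))" "0 < pmf p2 (snd w)" "0 < pmf p0 (fst (snd w))" if "w \<in> set_pmf p" for w
    using that apply -
    subgoal by (rule pmf_positive) (auto simp: p1_def case_prod_beta' intro!: image_eqI[of _ _ w])
    subgoal by (rule pmf_positive) (auto simp: p2_def case_prod_beta' intro!: image_eqI[of _ _ w])
    subgoal by (rule pmf_positive) (auto simp: p0_def case_prod_beta' intro!: image_eqI[of _ _ w])
    done
  have "pmf_entropy p \<le> expect p (\<lambda>w. - ln (?q w))"
    by (rule gibbs_inequality(1)[OF fin _ s])
      (use pos in \<open>auto intro!: mult_pos_pos divide_pos_pos simp: case_prod_beta\<close>)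
  also have "\<dots> = expect p (\<lambda>w. (- ln (pmf p1 (fst w, fst (snd w))) + - ln (pmf p2 (snd w))) - (- ln (pmf p0 (fst (snd w)))))"
  proof (rule expect_cong)
    fix w assume "w \<in> set_pmf p"
    from pos[OF this] show "- ln (?q w) =
        - ln (pmf p1 (fst w, fst (snd w))) + - ln (pmf p2 (snd w)) - - ln (pmf p0 (fst (snd w)))"
      by (simp add: case_prod_beta ln_mult_pos ln_div)
  qed
  also have "\<dots> = pmf_entropy p1 + pmf_entropy p2 - pmf_entropy p0"
    using fin unfolding expect_diff[OF fin] expect_add[OF fin]
    by (simp add: pmf_entropy_expect p1_def p2_def p0_def case_prod_beta')
  finally show ?thesis by (simp add: p1_def p2_def p0_def)
qed

section \<open>The free product\<close>

locale finite_free_product =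
  fixes n :: nat and G :: "nat \<Rightarrow> ('a, 'b) monoid_scheme"
  assumes two_le: "2 \<le> n"
    and group_G: "i < n \<Longrightarrow> group (G i)"
    and finite_G: "i < n \<Longrightarrow> finite (carrier (G i))"
    and nontrivial_G: "i < n \<Longrightarrow> carrier (G i) \<noteq> {\<one>\<^bsub>G i\<^esub>}"
begin

abbreviation A :: "(nat \<times> 'a) set" where "A \<equiv> letters n G"
abbreviation L :: "(nat \<times> 'a) list set" where "L \<equiv> reduced_words n G"
abbreviation mul :: "(nat \<times> 'a) list \<Rightarrow> (nat \<times> 'a) list \<Rightarrow> (nat \<times> 'a) list" (infixl "\<cdot>" 70)
  where "u \<cdot> v \<equiv> foldr (letter_mult G) u v"
abbreviation linv :: "nat \<times> 'a \<Rightarrow> nat \<times> 'a" where "linv \<equiv> letter_inv G"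
definition winv :: "(nat \<times> 'a) list \<Rightarrow> (nat \<times> 'a) list" where "winv u = rev (map linv u)"
abbreviation k :: "nat \<Rightarrow> real" where "k i \<equiv> real (card (letters_at G i))"

lemma carrier_free_product [simp]: "carrier (free_product n G) = L"
  and mult_free_product [simp]: "monoid.mult (free_product n G) u v = u \<cdot> v"
  and one_free_product [simp]: "\<one>\<^bsub>free_product n G\<^esub> = []"
  by (simp_all add: free_product_def)

lemma letters_at_iff: "a \<in> letters_at G i \<longleftrightarrow> fst a = i \<and> snd a \<in> carrier (G i) \<and> snd a \<noteq> \<one>\<^bsub>G i\<^esub>"
  by (cases a) (auto simp: letters_at_def)

lemma letters_iff: "a \<in> A \<longleftrightarrow> fst a < n \<and> a \<in> letters_at G (fst a)"
  by (auto simp: letters_def letters_at_iff)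

lemma letters_at_subset: "i < n \<Longrightarrow> letters_at G i \<subseteq> A"
  by (auto simp: letters_def)

lemma letters_at_disjoint: "i \<noteq> j \<Longrightarrow> letters_at G i \<inter> letters_at G j = {}"
  by (auto simp: letters_at_def)

lemma finite_letters_at: "i < n \<Longrightarrow> finite (letters_at G i)"
  by (simp add: letters_at_def finite_G)

lemma finite_letters [simp]: "finite A"
  by (simp add: letters_def finite_letters_at)

lemma letters_at_nonempty: assumes "i < n" shows "letters_at G i \<noteq> {}"
proof -
  interpret group "G i" by (rule group_G[OF assms])
  show ?thesis using nontrivial_G[OF assms] one_closed by (auto simp: letters_at_def)
qed

lemma k_ge_1: "i < n \<Longrightarrow> 1 \<le> k i"
  using letters_at_nonempty finite_letters_at by (simp add: Suc_le_eq card_gt_0_iff)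

lemma sum_letters: "(\<Sum>a\<in>A. F a) = (\<Sum>i<n. \<Sum>a\<in>letters_at G i. F a)"
  unfolding letters_def
  by (rule sum.UNION_disjoint) (use letters_at_disjoint finite_letters_at in auto)

lemma sum_letters_fst: "(\<Sum>a\<in>A. F (fst a)) = (\<Sum>i<n. k i * F i)"
proof -
  have "(\<Sum>a\<in>letters_at G i. F (fst a)) = (\<Sum>a\<in>letters_at G i. F i)" for i
    by (rule sum.cong) (auto simp: letters_at_iff)
  then show ?thesis by (simp add: sum_letters)
qed

lemma Nil_in_L [simp]: "[] \<in> L"
  by (simp add: reduced_words_def)

lemma Cons_in_L: "a # w \<in> L \<longleftrightarrow> a \<in> A \<and> w \<in> L \<and> (w \<noteq> [] \<longrightarrow> fst a \<noteq> fst (hd w))"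
  by (auto simp: reduced_words_def successively_Cons)

lemma append_in_L:
  "u @ v \<in> L \<longleftrightarrow> u \<in> L \<and> v \<in> L \<and> (u \<noteq> [] \<longrightarrow> v \<noteq> [] \<longrightarrow> fst (last u) \<noteq> fst (hd v))"
  by (auto simp: reduced_words_def successively_append_iff)

lemma snoc_in_L: "u @ [a] \<in> L \<longleftrightarrow> u \<in> L \<and> a \<in> A \<and> (u \<noteq> [] \<longrightarrow> fst (last u) \<noteq> fst a)"
  by (auto simp: append_in_L Cons_in_L)

lemma L_letters: "u \<in> L \<Longrightarrow> a \<in> set u \<Longrightarrow> a \<in> A"
  by (auto simp: reduced_words_def)

lemma L_lists: "L \<subseteq> lists A"
  by (auto simp: reduced_words_def)

lemma countable_L: "countable L"
  by (rule countable_subset[OF L_lists]) (simp add: countable_finite)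

lemma finite_L_length: "finite {u \<in> L. length u = m}"
  by (rule finite_subset[OF _ finite_lists_length_eq[OF finite_letters, of m]])
    (auto simp: reduced_words_def)

lemma take_in_L: "u \<in> L \<Longrightarrow> take m u \<in> L"
  by (metis append_in_L append_take_drop_id)

lemma letter_mult_in_L:
  assumes "a \<in> A" "w \<in> L" shows "letter_mult G a w \<in> L"
proof -
  obtain i g where a: "a = (i, g)" by force
  with assms have i: "i < n" "g \<in> carrier (G i)" by (auto simp: letters_iff letters_at_iff)
  interpret group "G i" by (rule group_G[OF i(1)])
  show ?thesis
  proof (cases w)
    case (Cons b w')
    then show ?thesis using assms i a
      by (cases b) (auto simp: Cons_in_L letters_iff letters_at_iff)
  qed (use assms a in \<open>simp add: Cons_in_L\<close>)
qed

text \<open>Associativity of the factors enters the associativity of the product of reduced words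
  only here.\<close>

lemma letter_mult_letter_mult:
  assumes "(i, g) \<in> A" "(i, h) \<in> A" "w \<in> L"
  shows "letter_mult G (i, g) (letter_mult G (i, h) w) =
    (if g \<otimes>\<^bsub>G i\<^esub> h = \<one>\<^bsub>G i\<^esub> then w else letter_mult G (i, g \<otimes>\<^bsub>G i\<^esub> h) w)"
proof -
  from assms have i: "i < n" and g: "g \<in> carrier (G i)" "g \<noteq> \<one>\<^bsub>G i\<^esub>"
    and h: "h \<in> carrier (G i)" "h \<noteq> \<one>\<^bsub>G i\<^esub>"
    by (auto simp: letters_iff letters_at_iff)
  interpret group "G i" by (rule group_G[OF i])
  show ?thesis
  proof (cases w)
    case (Cons b w')
    obtain j x where b: "b = (j, x)" by force
    show ?thesis
    proof (cases "i = j")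
      case True
      with assms(3) Cons b have x: "x \<in> carrier (G i)" "x \<noteq> \<one>\<^bsub>G i\<^esub>"
        and w': "w' \<noteq> [] \<longrightarrow> fst (hd w') \<noteq> i"
        by (auto simp: Cons_in_L letters_iff letters_at_iff)
      have b': "b = (i, x)" using b True by simp
      have lw': "letter_mult G (i, y) w' = (i, y) # w'" for y
        using w' by (cases w') auto
      have assoc: "g \<otimes>\<^bsub>G i\<^esub> (h \<otimes>\<^bsub>G i\<^esub> x) = g \<otimes>\<^bsub>G i\<^esub> h \<otimes>\<^bsub>G i\<^esub> x"
        using g h x by (simp add: m_assoc)
      show ?thesis
      proof (cases "h \<otimes>\<^bsub>G i\<^esub> x = \<one>\<^bsub>G i\<^esub>")
        \<comment> \<open>On the left \<open>h\<close> cancels \<open>x\<close> and \<open>g\<close>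
          is put in front of \<open>w'\<close>. On the right g h x = g, and g h = 1 happens only for
          g = x, so both words agree.\<close>
        case hx: True
        have gh: "g \<otimes>\<^bsub>G i\<^esub> h \<otimes>\<^bsub>G i\<^esub> x = g" using assoc hx g by simp
        then have "g \<otimes>\<^bsub>G i\<^esub> h = \<one>\<^bsub>G i\<^esub> \<Longrightarrow> g = x" using x by simp
        then show ?thesis using Cons b' hx g gh by (simp add: lw')
      next
        case False
        then show ?thesis using Cons b' assoc x by (simp add: lw')
      qed
    qed (use Cons b in auto)
  qed auto
qed

lemma mul_in_L: "u \<in> L \<Longrightarrow> v \<in> L \<Longrightarrow> u \<cdot> v \<in> L"
  by (induction u) (auto simp: Cons_in_L intro: letter_mult_in_L)

lemma letter_mult_mul:
  assumes "a \<in> A" "u \<in> L" "v \<in> L"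
  shows "letter_mult G a u \<cdot> v = letter_mult G a (u \<cdot> v)"
proof (cases u)
  case (Cons b u')
  obtain i g j h where a: "a = (i, g)" and b: "b = (j, h)" by (cases a, cases b) force
  show ?thesis
  proof (cases "i = j")
    case True
    have "letter_mult G (i, g) (letter_mult G (i, h) (u' \<cdot> v)) =
      (if g \<otimes>\<^bsub>G i\<^esub> h = \<one>\<^bsub>G i\<^esub> then u' \<cdot> v else letter_mult G (i, g \<otimes>\<^bsub>G i\<^esub> h) (u' \<cdot> v))"
      using assms Cons a b True by (intro letter_mult_letter_mult) (auto simp: Cons_in_L mul_in_L)
    then show ?thesis using Cons a b True by simp
  qed (use Cons a b in auto)
qed (cases a, simp)

lemma mul_assoc: "u \<in> L \<Longrightarrow> v \<in> L \<Longrightarrow> w \<in> L \<Longrightarrow> u \<cdot> v \<cdot> w = u \<cdot> (v \<cdot> w)"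
  by (induction u) (auto simp: Cons_in_L letter_mult_mul mul_in_L)

lemma letter_mult_append: "a # w \<in> L \<Longrightarrow> letter_mult G a w = a # w"
  by (cases a; cases w) (auto simp: Cons_in_L)

lemma mul_append: "u @ v \<in> L \<Longrightarrow> u \<cdot> v = u @ v"
  by (induction u) (auto simp: Cons_in_L letter_mult_append)

lemma mul_Nil [simp]: "u \<in> L \<Longrightarrow> u \<cdot> [] = u"
  using mul_append[of u "[]"] by simp

lemma linv_props:
  assumes "a \<in> A"
  shows "linv a \<in> A" "linv (linv a) = a" "snd (linv a) \<otimes>\<^bsub>G (fst a)\<^esub> snd a = \<one>\<^bsub>G (fst a)\<^esub>"
    "snd a \<otimes>\<^bsub>G (fst a)\<^esub> snd (linv a) = \<one>\<^bsub>G (fst a)\<^esub>"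
proof -
  have i: "fst a < n" "snd a \<in> carrier (G (fst a))" "snd a \<noteq> \<one>\<^bsub>G (fst a)\<^esub>"
    using assms by (auto simp: letters_iff letters_at_iff)
  interpret group "G (fst a)" by (rule group_G[OF i(1)])
  show "linv a \<in> A" "linv (linv a) = a" "snd (linv a) \<otimes>\<^bsub>G (fst a)\<^esub> snd a = \<one>\<^bsub>G (fst a)\<^esub>"
    "snd a \<otimes>\<^bsub>G (fst a)\<^esub> snd (linv a) = \<one>\<^bsub>G (fst a)\<^esub>"
    using i by (auto simp: letter_inv_def letters_iff letters_at_iff)
qed

lemma fst_linv [simp]: "fst (linv a) = fst a"
  by (simp add: letter_inv_def)

lemma linv_unique:
  assumes "a \<in> A" "b \<in> A" "fst a = fst b"
  shows "snd b \<otimes>\<^bsub>G (fst b)\<^esub> snd a = \<one>\<^bsub>G (fst b)\<^esub> \<longleftrightarrow> a = linv b"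
proof -
  have i: "fst b < n" "snd a \<in> carrier (G (fst b))" "snd b \<in> carrier (G (fst b))"
    using assms by (auto simp: letters_iff letters_at_iff)
  interpret group "G (fst b)" by (rule group_G[OF i(1)])
  show ?thesis
  proof
    assume "snd b \<otimes>\<^bsub>G (fst b)\<^esub> snd a = \<one>\<^bsub>G (fst b)\<^esub>"
    then have "inv\<^bsub>G (fst b)\<^esub> (snd a) = snd b" by (intro inv_equality i)
    then have "inv\<^bsub>G (fst b)\<^esub> (snd b) = snd a" using i(2) inv_inv by metis
    then show "a = linv b" using assms(3) by (simp add: letter_inv_def prod_eq_iff)
  next
    assume "a = linv b"
    then show "snd b \<otimes>\<^bsub>G (fst b)\<^esub> snd a = \<one>\<^bsub>G (fst b)\<^esub>" using linv_props(4)[OF assms(2)] by simp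
  qed
qed

lemma winv_Nil [simp]: "winv [] = []"
  and winv_Cons: "winv (a # u) = winv u @ [linv a]"
  and winv_snoc: "winv (u @ [a]) = linv a # winv u"
  and length_winv [simp]: "length (winv u) = length u"
  and winv_eq_Nil [simp]: "winv u = [] \<longleftrightarrow> u = []"
  by (simp_all add: winv_def)

lemma fst_last_winv: "u \<noteq> [] \<Longrightarrow> fst (last (winv u)) = fst (hd u)"
  by (cases u) (simp_all add: winv_Cons)

lemma winv_in_L: "u \<in> L \<Longrightarrow> winv u \<in> L"
proof (induction u)
  case (Cons a u)
  then show ?case
    by (auto simp: winv_Cons snoc_in_L Cons_in_L linv_props fst_last_winv)
qed simp

lemma winv_winv: "u \<in> L \<Longrightarrow> winv (winv u) = u"
  by (induction u) (auto simp: winv_Cons winv_snoc Cons_in_L linv_props)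

lemma letter_mult_linv:
  assumes "a # w \<in> L" shows "letter_mult G (linv a) (a # w) = w"
  using assms linv_props(3)[of a] by (cases a) (auto simp: letter_inv_def Cons_in_L)

lemma winv_mul_append: "u @ v \<in> L \<Longrightarrow> winv u \<cdot> (u @ v) = v"
proof (induction u)
  case (Cons a u)
  then have "winv (a # u) \<cdot> ((a # u) @ v) = winv u \<cdot> (u @ v)"
    using letter_mult_linv[of a "u @ v"] by (simp add: winv_Cons)
  with Cons show ?case by (simp add: Cons_in_L)
qed simp

lemma winv_mul: "u \<in> L \<Longrightarrow> winv u \<cdot> u = []"
  using winv_mul_append[of u "[]"] by simp

lemma mul_winv: "u \<in> L \<Longrightarrow> u \<cdot> winv u = []"
  using winv_mul[of "winv u"] by (simp add: winv_winv winv_in_L)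

lemma winv_mul_mul: "u \<in> L \<Longrightarrow> v \<in> L \<Longrightarrow> winv u \<cdot> (u \<cdot> v) = v"
  by (simp add: mul_assoc[symmetric] winv_in_L winv_mul)

lemma mul_winv_mul: "u \<in> L \<Longrightarrow> v \<in> L \<Longrightarrow> u \<cdot> (winv u \<cdot> v) = v"
  by (simp add: mul_assoc[symmetric] winv_in_L mul_winv)

definition merge :: "nat \<times> 'a \<Rightarrow> nat \<times> 'a \<Rightarrow> nat \<times> 'a" where
  "merge b a = (fst b, snd b \<otimes>\<^bsub>G (fst b)\<^esub> snd a)"

lemma fst_merge [simp]: "fst (merge b a) = fst b"
  by (simp add: merge_def)

lemma merge_in_letters:
  assumes "a \<in> A" "b \<in> A" "fst a = fst b" "a \<noteq> linv b" shows "merge b a \<in> A"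
proof -
  have i: "fst b < n" using assms by (auto simp: letters_iff)
  interpret group "G (fst b)" by (rule group_G[OF i])
  show ?thesis using assms linv_unique[of a b] by (auto simp: merge_def letters_iff letters_at_iff)
qed

lemma mul_letter_same:
  assumes "v @ [b] \<in> L" "a \<in> A" "fst a = fst b"
  shows "(v @ [b]) \<cdot> [a] = (if a = linv b then v else v @ [merge b a])"
proof (cases "a = linv b")
  case True
  have "letter_mult G b [a] = []"
    using assms linv_props(4)[of b] True by (cases b; cases a) (auto simp: letter_inv_def snoc_in_L)
  then show ?thesis using True assms by (simp add: snoc_in_L)
next
  case False
  have b: "b \<in> A" using assms by (simp add: snoc_in_L)
  have "letter_mult G b [a] = [merge b a]"
    using False linv_unique[OF assms(2) b assms(3)] assms(3) by (cases b; cases a) (auto simp: merge_def)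
  moreover have "v @ [merge b a] \<in> L"
    using assms merge_in_letters[OF assms(2) b assms(3) False] by (auto simp: snoc_in_L)
  ultimately show ?thesis using False by (simp add: mul_append)
qed

text \<open>The product folds letters in from the left, but the walk steps on the right. That a step
  affects only the end of the word is the tree-like geometry behind all later arguments.\<close>

lemma mul_letter_cases:
  assumes "u \<in> L" "a \<in> A"
  obtains (append) "u @ [a] \<in> L" "u \<cdot> [a] = u @ [a]"
  | (delete) v where "u = v @ [linv a]" "u \<cdot> [a] = v"
  | (merge) v b c where "u = v @ [b]" "c \<in> A" "fst c = fst b" "u \<cdot> [a] = v @ [c]"
proof (cases "u \<noteq> [] \<and> fst (last u) = fst a")
  case True
  then obtain v b where u: "u = v @ [b]" by (metis rev_exhaust)
  have b: "b \<in> A" "fst a = fst b" using u True assms by (auto simp: snoc_in_L)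
  show ?thesis
  proof (cases "a = linv b")
    case True
    then show ?thesis using delete[of v] u assms b mul_letter_same[of v b a] linv_props(2)[OF b(1)] by simp
  next
    case False
    then show ?thesis
      using merge[of v b "merge b a"] u assms b mul_letter_same[of v b a] merge_in_letters by simp
  qed
next
  case False
  then have "u @ [a] \<in> L" using assms by (auto simp: snoc_in_L)
  with append show ?thesis by (simp add: mul_append)
qed

lemma length_mul_letter:
  assumes "u \<in> L" "a \<in> A"
  shows "length (u \<cdot> [a]) \<le> Suc (length u)" "length u \<le> Suc (length (u \<cdot> [a]))"
  using assms by (cases rule: mul_letter_cases; simp)+

lemma length_mul_le: "u \<in> L \<Longrightarrow> v \<in> L \<Longrightarrow> length (u \<cdot> v) \<le> length u + length v"
proof (induction v rule: rev_induct)
  case (snoc a v)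
  then have v: "v \<in> L" "[a] \<in> L" "a \<in> A" by (auto simp: snoc_in_L Cons_in_L)
  have "u \<cdot> (v @ [a]) = u \<cdot> v \<cdot> [a]"
    using snoc.prems v by (simp add: mul_append mul_assoc)
  then show ?case using snoc v length_mul_letter(1)[of "u \<cdot> v" a] by (auto simp: mul_in_L)
qed simp

text \<open>From a word ending in \<open>b\<close>, letters of other factors move forward,
  \<open>linv b\<close> moves back, and the rest of the last factor moves sideways. The computations
  of harmonicity and of the mean increment start from this split.\<close>

lemma sum_step:
  fixes m F :: "_ \<Rightarrow> real"
  assumes "v @ [b] \<in> L"
  shows "(\<Sum>a\<in>A. m a * F ((v @ [b]) \<cdot> [a])) =
    (\<Sum>a\<in>A - letters_at G (fst b). m a * F (v @ [b, a])) + m (linv b) * F v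
    + (\<Sum>a\<in>letters_at G (fst b) - {linv b}. m a * F (v @ [merge b a]))"
proof -
  have b: "b \<in> A" "fst b < n" using assms by (auto simp: snoc_in_L letters_iff)
  have lb: "linv b \<in> letters_at G (fst b)" using linv_props(1)[OF b(1)] by (simp add: letters_iff)
  have sub: "letters_at G (fst b) \<subseteq> A" by (rule letters_at_subset[OF b(2)])
  have "(\<Sum>a\<in>A. m a * F ((v @ [b]) \<cdot> [a])) =
    (\<Sum>a\<in>A - letters_at G (fst b). m a * F ((v @ [b]) \<cdot> [a]))
    + (\<Sum>a\<in>letters_at G (fst b). m a * F ((v @ [b]) \<cdot> [a]))"
    by (rule sum.subset_diff[OF sub finite_letters])
  also have "(\<Sum>a\<in>A - letters_at G (fst b). m a * F ((v @ [b]) \<cdot> [a]))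
    = (\<Sum>a\<in>A - letters_at G (fst b). m a * F (v @ [b, a]))"
  proof (rule sum.cong)
    fix a assume a: "a \<in> A - letters_at G (fst b)"
    then have "(v @ [b]) @ [a] \<in> L"
      unfolding snoc_in_L[of "v @ [b]" a] using assms by (auto simp: letters_iff letters_at_iff)
    then show "m a * F ((v @ [b]) \<cdot> [a]) = m a * F (v @ [b, a])"
      by (subst mul_append) auto
  qed simp
  also have "(\<Sum>a\<in>letters_at G (fst b). m a * F ((v @ [b]) \<cdot> [a])) =
    m (linv b) * F ((v @ [b]) \<cdot> [linv b]) + (\<Sum>a\<in>letters_at G (fst b) - {linv b}. m a * F ((v @ [b]) \<cdot> [a]))"
    using lb b by (subst sum.remove[of _ "linv b"]) (auto simp: finite_letters_at)
  also have "(v @ [b]) \<cdot> [linv b] = v"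
    using mul_letter_same[OF assms linv_props(1)[OF b(1)]] by simp
  also have "(\<Sum>a\<in>letters_at G (fst b) - {linv b}. m a * F ((v @ [b]) \<cdot> [a]))
    = (\<Sum>a\<in>letters_at G (fst b) - {linv b}. m a * F (v @ [merge b a]))"
  proof (rule sum.cong)
    fix a assume a: "a \<in> letters_at G (fst b) - {linv b}"
    then have "a \<in> A" "fst a = fst b" using sub by (auto simp: letters_at_iff)
    then show "m a * F ((v @ [b]) \<cdot> [a]) = m a * F (v @ [merge b a])"
      using mul_letter_same[OF assms, of a] a by simp
  qed simp
  finally show ?thesis by simp
qed

end

text \<open>In a one-letter factor the index determines the letter, so in both groups the reduced
  words are the alternating index sequences. The contrapositive turns the hypothesis on isomorphism
  into the condition on cardinalities that the rest of the proof works with.\<close>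

lemma (in finite_free_product) iso_infinite_dihedral:
  assumes n: "n = 2" and card: "\<And>i. i < 2 \<Longrightarrow> card (letters_at G i) = 1"
  shows "free_product n G \<cong> free_product 2 (\<lambda>_. integer_mod_group 2)"
proof -
  let ?Z = "\<lambda>_::nat. integer_mod_group 2"
  have Zc: "carrier (integer_mod_group 2) = {0, 1}"
    unfolding carrier_integer_mod_group by auto
  have Z1: "\<one>\<^bsub>integer_mod_group 2\<^esub> = 0" by simp
  interpret Z: finite_free_product 2 ?Z
    by (rule finite_free_product.intro) (simp_all only: Zc Z1 group_integer_mod_group, simp_all)
  have "\<exists>a. letters_at G i = {a}" if "i < 2" for i
    using card[OF that] card_1_singletonE by metis
  then obtain c where c: "\<And>i. i < 2 \<Longrightarrow> letters_at G i = {c i}" by metis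
  have fc: "fst (c i) = i" if "i < 2" for i
    using c[OF that] letters_at_iff[of "c i" i] by auto
  have A: "a \<in> A \<longleftrightarrow> fst a < 2 \<and> c (fst a) = a" for a
    using c letters_iff[of a] n by (metis insertI1 singletonD)
  have ZA: "a \<in> letters 2 ?Z \<longleftrightarrow> fst a < 2 \<and> snd a = 1" for a
    by (auto simp: Z.letters_iff Z.letters_at_iff Zc)
  define \<phi> :: "nat \<times> 'a \<Rightarrow> nat \<times> int" where "\<phi> a = (fst a, 1)" for a
  define \<psi> :: "nat \<times> int \<Rightarrow> nat \<times> 'a" where "\<psi> a = c (fst a)" for a
  have [simp]: "fst (\<phi> a) = fst a" for a by (simp add: \<phi>_def)
  have \<phi>A: "\<phi> a \<in> letters 2 ?Z \<longleftrightarrow> fst a < 2" for a by (simp add: \<phi>_def ZA)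
  have \<phi>L: "map \<phi> w \<in> reduced_words 2 ?Z" if "w \<in> L" for w
    using that
    by (induction w) (auto simp: Z.Cons_in_L Cons_in_L \<phi>A A hd_map)
  have hdA: "fst (hd w) < 2" if "w \<in> reduced_words 2 ?Z" "w \<noteq> []" for w
    using that by (cases w) (auto simp: Z.Cons_in_L ZA)
  have \<psi>L: "map \<psi> w \<in> L" if "w \<in> reduced_words 2 ?Z" for w
    using that
    by (induction w) (auto simp: Z.Cons_in_L Cons_in_L ZA A hd_map \<psi>_def fc hdA)
  have inv1: "map \<psi> (map \<phi> w) = w" if "w \<in> L" for w
    unfolding map_map by (rule map_idI) (auto simp: \<psi>_def \<phi>_def A dest!: L_letters[OF that])
  have inv2: "map \<phi> (map \<psi> w) = w" if "w \<in> reduced_words 2 ?Z" for w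
    unfolding map_map by (rule map_idI) (auto simp: \<psi>_def \<phi>_def ZA fc prod_eq_iff dest!: Z.L_letters[OF that])
  have bij: "bij_betw (map \<phi>) L (reduced_words 2 ?Z)"
    by (rule bij_betw_byWitness[where f' = "map \<psi>"]) (use inv1 inv2 \<phi>L \<psi>L in auto)
  have lm: "map \<phi> (letter_mult G a w) = letter_mult ?Z (\<phi> a) (map \<phi> w)" if a: "a \<in> A" and w: "w \<in> L" for a w
  proof (cases w)
    case (Cons b w')
    have b: "b \<in> A" using w Cons by (simp add: Cons_in_L)
    show ?thesis
    proof (cases "fst a = fst b")
      case True
      then have ab: "a = b" using a b A by metis
      \<comment> \<open>The only letter of its factor is its own inverse, like 1 in the group of
        order two.\<close>
      have "linv a = a" using A linv_props(1)[OF a] a by (metis fst_linv)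
      then have "snd a \<otimes>\<^bsub>G (fst a)\<^esub> snd a = \<one>\<^bsub>G (fst a)\<^esub>"
        using linv_props(4)[OF a] by simp
      then show ?thesis using Cons ab
        by (cases b) (simp add: \<phi>_def mult_integer_mod_group one_integer_mod_group)
    next
      case False
      then show ?thesis using Cons by (cases a; cases b) (simp add: \<phi>_def)
    qed
  qed (cases a, simp add: \<phi>_def)
  have hom: "map \<phi> (u \<cdot> v) = foldr (letter_mult ?Z) (map \<phi> u) (map \<phi> v)" if "u \<in> L" "v \<in> L" for u v
    using that by (induction u) (auto simp: Cons_in_L lm mul_in_L)
  have "map \<phi> \<in> iso (free_product n G) (free_product 2 ?Z)"
    using bij hom \<phi>L by (auto simp: iso_def hom_def)
  then show ?thesis by (auto simp: is_iso_def)
qed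

section \<open>Superharmonic weights and concentration of the length\<close>

lemma exp_le_quadratic:
  fixes y :: real assumes "\<bar>y\<bar> \<le> 1" shows "exp y \<le> 1 + y + y\<^sup>2"
proof (cases "0 \<le> y")
  case True
  then show ?thesis using exp_bound[of y] assms by simp
next
  case False
  then have "1 - y \<le> exp (- y)" using exp_ge_add_one_self[of "- y"] by simp
  then have "exp y \<le> 1 / (1 - y)" using False by (simp add: exp_minus field_simps)
  also have "\<dots> \<le> 1 + y + y\<^sup>2"
  proof -
    have "y ^ 3 \<le> 0" using False by (simp add: power_le_zero_eq)
    then have "1 \<le> (1 + y + y\<^sup>2) * (1 - y)" by (simp add: algebra_simps power2_eq_square power3_eq_cube)
    then show ?thesis using False by (simp add: field_simps)
  qed
  finally show ?thesis .
qed

locale free_product_walk = finite_free_product n G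
  for n and G :: "nat \<Rightarrow> ('a, 'b) monoid_scheme" +
  fixes \<mu> :: "(nat \<times> 'a) pmf"
  assumes set_mu: "set_pmf \<mu> \<subseteq> letters n G"
begin

abbreviation W :: "nat \<Rightarrow> (nat \<times> 'a) list pmf" where "W m \<equiv> walk_law n G \<mu> m"

lemma finite_set_mu [simp]: "finite (set_pmf \<mu>)"
  using finite_subset[OF set_mu] by simp

lemma expect_mu: "expect \<mu> F = (\<Sum>a\<in>A. pmf \<mu> a * F a)"
  by (subst integral_measure_pmf_real[of A]) (use set_mu in \<open>auto simp: mult.commute\<close>)

lemma sum_mu: "(\<Sum>a\<in>A. pmf \<mu> a) = 1"
  using set_mu by (intro sum_pmf_eq_1) auto

lemma walk_law_0 [simp]: "W 0 = return_pmf []"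
  by (simp add: walk_law_def)

lemma walk_law_Suc: "W (Suc m) = bind_pmf (W m) (\<lambda>g. map_pmf (\<lambda>a. g \<cdot> [a]) \<mu>)"
  by (simp add: walk_law_def convolution_def pair_pmf_def map_bind_pmf map_pmf_def bind_assoc_pmf
      bind_return_pmf)

lemma set_walk_law: "x \<in> set_pmf (W m) \<Longrightarrow> x \<in> L \<and> length x \<le> m"
proof (induction m arbitrary: x)
  case (Suc m)
  then obtain g a where g: "g \<in> set_pmf (W m)" and a: "a \<in> A" and x: "x = g \<cdot> [a]"
    using set_mu by (auto simp: walk_law_Suc)
  from Suc.IH[OF g] show ?case
    using a x length_mul_letter(1)[of g a] mul_in_L[of g "[a]"] by (auto simp: Cons_in_L)
qed simp

lemma finite_set_walk_law [simp]: "finite (set_pmf (W m))"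
  by (induction m) (simp_all add: walk_law_Suc)

lemma walk_law_add: "W (m + l) = bind_pmf (W m) (\<lambda>g. map_pmf (\<lambda>x. g \<cdot> x) (W l))"
proof (induction l)
  case 0
  have "bind_pmf (W m) (\<lambda>g. map_pmf (\<lambda>x. g \<cdot> x) (W 0)) = bind_pmf (W m) return_pmf"
    by (intro bind_pmf_cong) (auto dest: set_walk_law)
  then show ?case by (simp add: bind_return_pmf')
next
  case (Suc l)
  have "W (m + Suc l) = bind_pmf (W m) (\<lambda>g. bind_pmf (W l) (\<lambda>x. map_pmf (\<lambda>a. g \<cdot> x \<cdot> [a]) \<mu>))"
    by (simp add: walk_law_Suc Suc bind_assoc_pmf bind_map_pmf)
  also have "\<dots> = bind_pmf (W m) (\<lambda>g. bind_pmf (W l) (\<lambda>x. map_pmf (\<lambda>a. g \<cdot> (x \<cdot> [a])) \<mu>))"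
    using set_mu by (intro bind_pmf_cong refl map_pmf_cong mul_assoc) (auto dest: set_walk_law simp: Cons_in_L)
  also have "\<dots> = bind_pmf (W m) (\<lambda>g. map_pmf (\<lambda>x. g \<cdot> x) (W (Suc l)))"
    by (simp add: walk_law_Suc map_bind_pmf map_pmf_comp)
  finally show ?case .
qed

lemma expect_walk_law_add: "expect (W (m + l)) F = expect (W m) (\<lambda>g. expect (W l) (\<lambda>x. F (g \<cdot> x)))"
  by (simp add: walk_law_add expect_bind)

lemma expect_walk_law_Suc: "expect (W (Suc m)) F = expect (W m) (\<lambda>g. expect \<mu> (\<lambda>a. F (g \<cdot> [a])))"
  by (simp add: walk_law_Suc expect_bind)

lemma superharmonic_le:
  assumes "\<And>g. g \<in> L \<Longrightarrow> expect \<mu> (\<lambda>a. F (g \<cdot> [a])) \<le> F g" "g \<in> L"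
  shows "expect (W m) (\<lambda>x. F (g \<cdot> x)) \<le> F g"
proof (induction m)
  case 0 then show ?case using assms by simp
next
  case (Suc m)
  have "expect (W (Suc m)) (\<lambda>x. F (g \<cdot> x)) = expect (W m) (\<lambda>x. expect \<mu> (\<lambda>a. F (g \<cdot> x \<cdot> [a])))"
    unfolding expect_walk_law_Suc using assms(2) set_mu
    by (intro expect_cong) (auto dest!: set_walk_law simp: mul_assoc Cons_in_L)
  also have "\<dots> \<le> expect (W m) (\<lambda>x. F (g \<cdot> x))"
    using assms by (intro expect_mono) (auto dest!: set_walk_law simp: mul_in_L)
  finally show ?case using Suc by simp
qed

lemma harmonic_eq:
  assumes "\<And>g. g \<in> L \<Longrightarrow> expect \<mu> (\<lambda>a. F (g \<cdot> [a])) = F g" "g \<in> L"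
  shows "expect (W m) (\<lambda>x. F (g \<cdot> x)) = F g"
  using superharmonic_le[of F g m] superharmonic_le[of "\<lambda>x. - F x" g m] assms by simp

definition mean_length :: "nat \<Rightarrow> real" where "mean_length m = expect (W m) length"

lemma mean_length_nonneg: "0 \<le> mean_length m"
  by (simp add: mean_length_def)

lemma mean_length_add: "mean_length (m + l) \<le> mean_length m + mean_length l"
proof -
  have "mean_length (m + l) \<le> expect (W m) (\<lambda>g. expect (W l) (\<lambda>x. real (length g) + real (length x)))"
    unfolding mean_length_def expect_walk_law_add
    by (intro expect_mono) (auto dest!: set_walk_law simp flip: of_nat_add intro: length_mul_le)
  then show ?thesis by (simp add: mean_length_def expect_add)
qed

definition weight :: "(nat \<Rightarrow> real) \<Rightarrow> (nat \<times> 'a) list \<Rightarrow> real" where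
  "weight z g = (\<Prod>b\<leftarrow>g. z (fst b))"

lemma weight_simps [simp]: "weight z [] = 1" "weight z (a # u) = z (fst a) * weight z u" "weight z (u @ v) = weight z u * weight z v"
  by (simp_all add: weight_def)

lemma weight_winv [simp]: "weight z (winv u) = weight z u"
  by (induction u) (simp_all add: winv_Cons)

lemma weight_const: "weight (\<lambda>_. c) u = c ^ length u"
  by (induction u) simp_all

lemma weight_bounds:
  assumes "\<And>i. i < n \<Longrightarrow> 0 \<le> z i \<and> z i \<le> \<zeta>" "u \<in> L"
  shows "0 \<le> weight z u" "weight z u \<le> \<zeta> ^ length u"
proof -
  have "0 \<le> weight z u \<and> weight z u \<le> \<zeta> ^ length u" using assms(2)
  proof (induction u)
    case (Cons a u)
    then have "0 \<le> z (fst a)" "z (fst a) \<le> \<zeta>" using assms(1)[of "fst a"] by (auto simp: Cons_in_L letters_iff)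
    with Cons show ?case by (auto simp: Cons_in_L intro!: mult_mono)
  qed simp
  then show "0 \<le> weight z u" "weight z u \<le> \<zeta> ^ length u" by auto
qed

text \<open>Sideways moves keep the weight, since \<open>z\<close> depends on the factor only. The
  bracket is the gain from the backward move minus the loss from the forward moves, that is, the
  defect from harmonicity.\<close>

lemma expect_weight:
  assumes "v @ [b] \<in> L"
  shows "expect \<mu> (\<lambda>a. weight z ((v @ [b]) \<cdot> [a])) = weight z (v @ [b])
    + weight z v * (pmf \<mu> (linv b) * (1 - z (fst b))
      - z (fst b) * (\<Sum>a\<in>A - letters_at G (fst b). pmf \<mu> a * (1 - z (fst a))))"
proof -
  have b: "b \<in> A" "fst b < n" using assms by (auto simp: snoc_in_L letters_iff)
  have lb: "linv b \<in> letters_at G (fst b)" using linv_props(1)[OF b(1)] by (simp add: letters_iff)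
  let ?i = "fst b"
  define S where "S = (\<Sum>a\<in>A - letters_at G ?i. pmf \<mu> a)"
  define T where "T = (\<Sum>a\<in>A - letters_at G ?i. pmf \<mu> a * z (fst a))"
  define R where "R = (\<Sum>a\<in>letters_at G ?i - {linv b}. pmf \<mu> a)"
  have "1 = S + (\<Sum>a\<in>letters_at G ?i. pmf \<mu> a)"
    unfolding S_def sum_mu[symmetric] by (rule sum.subset_diff) (simp_all add: b letters_at_subset)
  also have "(\<Sum>a\<in>letters_at G ?i. pmf \<mu> a) = pmf \<mu> (linv b) + R"
    unfolding R_def using lb b by (subst sum.remove[of _ "linv b"]) (auto simp: finite_letters_at)
  finally have one: "R = 1 - S - pmf \<mu> (linv b)" by simp
  have "expect \<mu> (\<lambda>a. weight z ((v @ [b]) \<cdot> [a])) =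
    weight z v * z ?i * T + pmf \<mu> (linv b) * weight z v + R * (weight z v * z ?i)"
    unfolding expect_mu sum_step[OF assms] T_def R_def
    by (simp add: sum_distrib_left sum_distrib_right mult_ac)
  moreover have sum: "(\<Sum>a\<in>A - letters_at G ?i. pmf \<mu> a * (1 - z (fst a))) = S - T"
    by (simp add: S_def T_def right_diff_distrib sum_subtractf)
  ultimately show ?thesis unfolding one sum by (simp add: algebra_simps)
qed

end

text \<open>The last assumption says that the bracket in \<open>expect_weight\<close> is
  nonpositive; \<zeta> < 1 turns the weight into geometric decay in the word length.\<close>

locale transient_walk = free_product_walk +
  fixes z :: "nat \<Rightarrow> real" and \<zeta> :: real
  assumes z_bounds: "i < n \<Longrightarrow> 0 < z i \<and> z i \<le> \<zeta>" and zeta: "\<zeta> < 1"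
    and superharmonic_z: "b \<in> letters n G \<Longrightarrow> pmf \<mu> (letter_inv G b) * (1 - z (fst b))
      \<le> z (fst b) * (\<Sum>a\<in>letters n G - letters_at G (fst b). pmf \<mu> a * (1 - z (fst a)))"
begin

lemma zeta_pos: "0 < \<zeta>"
  using z_bounds[of 0] two_le by force

lemma weight_nonneg: "u \<in> L \<Longrightarrow> 0 \<le> weight z u"
  and weight_le_power: "u \<in> L \<Longrightarrow> weight z u \<le> \<zeta> ^ length u"
  using weight_bounds[of z \<zeta> u] z_bounds by (auto simp: less_imp_le)

lemma weight_le_1: "u \<in> L \<Longrightarrow> weight z u \<le> 1"
  using weight_le_power[of u] power_le_one[of \<zeta> "length u"] zeta zeta_pos by simp

lemma weight_superharmonic:
  assumes "g \<in> L" shows "expect \<mu> (\<lambda>a. weight z (g \<cdot> [a])) \<le> weight z g"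
proof (cases g rule: rev_cases)
  \<comment> \<open>At the identity superharmonicity is automatic, because 1 is the largest value of
    the weight.\<close>
  case Nil
  have "expect \<mu> (\<lambda>a. weight z ([] \<cdot> [a])) \<le> expect \<mu> (\<lambda>a. 1)"
    using set_mu weight_le_1[of "[_]"] by (intro expect_mono) (auto simp: Cons_in_L)
  then show ?thesis using Nil by simp
next
  case (snoc v b)
  then have "b \<in> A" "v \<in> L" using assms by (auto simp: snoc_in_L)
  then show ?thesis
    using expect_weight[of v b z] assms snoc superharmonic_z[of b] weight_nonneg[of v]
    by (auto intro!: mult_nonneg_nonpos)
qed

text \<open>A step alters at most the last letter of a word, so a cone is entered only by completing
  its apex.\<close>

lemma prefix_entry:
  assumes "h \<in> L" "a \<in> A" "\<not> prefix w h" "prefix w (h \<cdot> [a])"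
  shows "h \<cdot> [a] = w"
  using assms(1,2)
proof (cases rule: mul_letter_cases)
  case append
  then show ?thesis using assms by simp
next
  case (delete v)
  then show ?thesis using assms by (auto dest: prefix_order.trans[of w v h])
next
  case (merge v b c)
  then show ?thesis using assms by (auto dest: prefix_order.trans[of w v h])
qed

text \<open>The walk enters the cone of words with prefix \<open>w\<close> only at \<open>w\<close>. Hence the translate by \<open>w\<close> of the
  superharmonic weight stays superharmonic when it is replaced by \<open>1\<close> on that cone.\<close>

lemma prob_prefix_le:
  assumes w: "w \<in> L"
  shows "measure_pmf.prob (W m) {x. prefix w x} \<le> \<zeta> ^ length w"
proof -
  define F where "F h = (if prefix w h then 1 else weight z (winv w \<cdot> h))" for h
  have le1: "F h \<le> 1" if "h \<in> L" for h
    using weight_le_1[of "winv w \<cdot> h"] that w by (simp add: F_def mul_in_L winv_in_L)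
  have "expect \<mu> (\<lambda>a. F (g \<cdot> [a])) \<le> F g" if g: "g \<in> L" for g
  proof (cases "prefix w g")
    case True
    have "expect \<mu> (\<lambda>a. F (g \<cdot> [a])) \<le> expect \<mu> (\<lambda>a. 1)"
      using set_mu g by (intro expect_mono le1) (auto simp: mul_in_L Cons_in_L)
    then show ?thesis using True by (simp add: F_def)
  next
    case False
    have "F (g \<cdot> [a]) = weight z (winv w \<cdot> g \<cdot> [a])" if "a \<in> set_pmf \<mu>" for a
    proof -
      have a: "a \<in> A" using that set_mu by auto
      have "F (g \<cdot> [a]) = weight z (winv w \<cdot> (g \<cdot> [a]))"
        using prefix_entry[OF g a False] winv_mul[OF w] by (auto simp: F_def)
      then show ?thesis using a g w by (simp add: mul_assoc winv_in_L Cons_in_L)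
    qed
    then have "expect \<mu> (\<lambda>a. F (g \<cdot> [a])) = expect \<mu> (\<lambda>a. weight z (winv w \<cdot> g \<cdot> [a]))"
      by (intro expect_cong)
    also have "\<dots> \<le> weight z (winv w \<cdot> g)" by (intro weight_superharmonic mul_in_L winv_in_L w g)
    finally show ?thesis using False by (simp add: F_def)
  qed
  then have "expect (W m) (\<lambda>x. F ([] \<cdot> x)) \<le> F []" by (intro superharmonic_le) auto
  also have "F [] \<le> \<zeta> ^ length w"
    using weight_le_power[OF w] w by (auto simp: F_def winv_in_L)
  finally have 1: "expect (W m) F \<le> \<zeta> ^ length w" by simp
  have "measure_pmf.prob (W m) {x. prefix w x} = expect (W m) (\<lambda>x. if prefix w x then 1 else 0)"
    by (simp add: expect_indicator)
  also have "\<dots> \<le> expect (W m) F"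
    by (intro expect_mono) (auto simp: F_def dest!: set_walk_law intro!: weight_nonneg mul_in_L winv_in_L w)
  finally show ?thesis using 1 by simp
qed

text \<open>The common prefix cancels from both words. The first letters that differ fuse into one
  when they lie in the same factor, which accounts for the extra 1.\<close>

lemma length_winv_mul_ge:
  assumes "w \<in> L" "x \<in> L"
  shows "length w + length x \<le> length (winv w \<cdot> x) + 1 + 2 * length (longest_common_prefix w x)"
  using assms
proof (induction w x rule: list_induct2')
  case (4 a w b x)
  show ?case
  proof (cases "a = b")
    case True
    have "winv (a # w) \<cdot> (b # x) = winv w \<cdot> x"
      using letter_mult_linv[of a x] 4 True by (simp add: winv_Cons)
    then show ?thesis using 4 True by (simp add: Cons_in_L)
  next
    case False
    have a: "linv a \<in> A" "b \<in> A" "w \<in> L" "a \<in> A" using 4 by (auto simp: Cons_in_L linv_props)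
    have wL: "winv w @ [linv a] \<in> L" using winv_in_L[OF 4(2)] by (simp add: winv_Cons)
    show ?thesis
    proof (cases "fst a = fst b")
      case True
      have "b \<noteq> linv (linv a)" using False linv_props(2)[OF a(4)] by simp
      then have m: "merge (linv a) b \<in> A" using merge_in_letters[of b "linv a"] a True by simp
      have "letter_mult G (linv a) (b # x) = merge (linv a) b # x"
        using linv_unique[OF a(2,1)] True \<open>b \<noteq> linv (linv a)\<close>
        by (cases b) (auto simp: merge_def letter_inv_def)
      moreover have "winv w @ (merge (linv a) b # x) \<in> L"
        using wL 4(3) m True by (auto simp: append_in_L Cons_in_L)
      ultimately show ?thesis using False by (simp add: winv_Cons mul_append)
    next
      case other: False
      have "(winv w @ [linv a]) @ (b # x) \<in> L"
        using wL 4(3) other by (subst append_in_L) simp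
      then show ?thesis using False by (simp add: winv_Cons mul_append del: foldr_append append_assoc)
    qed
  qed
qed (auto simp: winv_in_L)

text \<open>The common prefix is as long as the number of nonempty prefixes of \<open>w\<close> that
  \<open>x\<close> shares, and a prefix of length c is shared with probability at most \<zeta>^c.
  The bound depends neither on \<open>w\<close> nor on \<open>m\<close>; this makes the mean length
  superadditive up to a constant.\<close>

lemma expect_lcp_le:
  assumes w: "w \<in> L"
  shows "expect (W m) (\<lambda>x. real (length (longest_common_prefix w x))) \<le> 1 / (1 - \<zeta>)"
proof -
  have "real (length (longest_common_prefix w x)) \<le> (\<Sum>c\<in>{1..length w}. if prefix (take c w) x then 1 else 0)" for x
  proof -
    let ?l = "longest_common_prefix w x"
    have 1: "prefix ?l w" "prefix ?l x" by (auto simp: longest_common_prefix_prefix1 longest_common_prefix_prefix2)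
    have "{1..length ?l} \<subseteq> {c\<in>{1..length w}. prefix (take c w) x}"
    proof
      fix c assume c: "c \<in> {1..length ?l}"
      obtain zs where "w = ?l @ zs" using 1(1) by (auto simp: prefix_def)
      from arg_cong[OF this, of "take c"] c have "take c w = take c ?l" by simp
      then have "prefix (take c w) x" using 1(2) by (metis prefix_order.trans take_is_prefix)
      then show "c \<in> {c\<in>{1..length w}. prefix (take c w) x}" using c prefix_length_le[OF 1(1)] by auto
    qed
    then have "card {1..length ?l} \<le> card {c\<in>{1..length w}. prefix (take c w) x}"
      by (intro card_mono) auto
    then show ?thesis by (simp add: sum.If_cases Int_def)
  qed
  then have "expect (W m) (\<lambda>x. real (length (longest_common_prefix w x)))
    \<le> expect (W m) (\<lambda>x. \<Sum>c\<in>{1..length w}. if prefix (take c w) x then 1 else 0)"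
    by (intro expect_mono) auto
  also have "\<dots> = (\<Sum>c\<in>{1..length w}. measure_pmf.prob (W m) {x. prefix (take c w) x})"
    by (subst Bochner_Integration.integral_sum) (auto intro!: integrable_measure_pmf_finite simp: expect_indicator)
  also have "\<dots> \<le> (\<Sum>c\<in>{1..length w}. \<zeta> ^ c)"
    using prob_prefix_le[OF take_in_L[OF w]] by (intro sum_mono) (metis atLeastAtMost_iff length_take min.absorb2)
  also have "\<dots> \<le> (\<Sum>c. \<zeta> ^ c)"
    using zeta zeta_pos by (intro sum_le_suminf) (auto intro!: summable_geometric)
  also have "\<dots> = 1 / (1 - \<zeta>)"
    using zeta zeta_pos by (intro suminf_geometric) auto
  finally show ?thesis .
qed

lemma expect_length_mul_ge:
  assumes g: "g \<in> L"
  shows "real (length g) + mean_length m - 1 - 2 / (1 - \<zeta>) \<le> expect (W m) (\<lambda>x. real (length (g \<cdot> x)))"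
proof -
  let ?l = "\<lambda>x. real (length (longest_common_prefix (winv g) x))"
  have "expect (W m) (\<lambda>x. (real (length g) + real (length x)) - (1 + (?l x + ?l x))) \<le> expect (W m) (\<lambda>x. real (length (g \<cdot> x)))"
    using length_winv_mul_ge[OF winv_in_L[OF g]]
    by (intro expect_mono) (force dest!: set_walk_law simp: winv_winv g)+
  then have "real (length g) + mean_length m - (1 + (expect (W m) ?l + expect (W m) ?l))
    \<le> expect (W m) (\<lambda>x. real (length (g \<cdot> x)))"
    by (simp add: expect_add expect_diff mean_length_def)
  then show ?thesis using expect_lcp_le[OF winv_in_L[OF g], of m] by simp
qed

end

context free_product_walk
begin

lemma lipschitz_mul:
  fixes F :: "(nat \<times> 'a) list \<Rightarrow> real"
  assumes lip: "\<And>g a. g \<in> L \<Longrightarrow> a \<in> A \<Longrightarrow> \<bar>F (g \<cdot> [a]) - F g\<bar> \<le> 1" and g: "g \<in> L" and x: "x \<in> set_pmf (W m)"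
  shows "\<bar>F (g \<cdot> x) - F g\<bar> \<le> real m"
  using x
proof (induction m arbitrary: x)
  case (Suc m)
  then obtain y a where y: "y \<in> set_pmf (W m)" and a: "a \<in> A" and x: "x = y \<cdot> [a]"
    using set_mu by (auto simp: walk_law_Suc)
  have "y \<in> L" using set_walk_law[OF y] by simp
  then have "\<bar>F (g \<cdot> x) - F (g \<cdot> y)\<bar> \<le> 1"
    using lip[of "g \<cdot> y" a] g a x by (simp add: mul_assoc[symmetric] mul_in_L Cons_in_L)
  with Suc.IH[OF y] show ?case by simp
qed (use g in simp)

text \<open>Exponential moments, estimated along blocks of \<open>l\<close> steps.\<close>

lemma concentration:
  fixes F :: "(nat \<times> 'a) list \<Rightarrow> real"
  assumes F0: "F [] = 0" and lip: "\<And>g a. g \<in> L \<Longrightarrow> a \<in> A \<Longrightarrow> \<bar>F (g \<cdot> [a]) - F g\<bar> \<le> 1"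
    and l: "1 \<le> l" and d: "\<And>g. g \<in> L \<Longrightarrow> expect (W l) (\<lambda>x. F (g \<cdot> x)) \<le> F g + d" and e: "0 < e"
  shows "summable (\<lambda>m. measure_pmf.prob (W m) {x. real m * (d / real l + e) \<le> F x})"
proof -
  \<comment> \<open>\<open>F\<close> changes by at most \<open>l\<close> along a block, so the first
    term makes the quadratic bound on exp applicable; the second keeps the quadratic contribution
    below half of \<open>e\<close> per step.\<close>
  define t where "t = min (1 / real l) (e / (2 * real l))"
  have t: "0 < t" "t * real l \<le> 1" "t * real l \<le> e / 2"
    using l e by (auto simp: t_def min_def field_simps)
  define c where "c = exp (t * d + t\<^sup>2 * (real l)\<^sup>2)"
  define M where "M m = expect (W m) (\<lambda>x. exp (t * F x))" for m
  have lipW: "\<bar>F (g \<cdot> x) - F g\<bar> \<le> real m" if "g \<in> L" "x \<in> set_pmf (W m)" for g x m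
    using that by (intro lipschitz_mul lip) auto
  have step: "expect (W l) (\<lambda>x. exp (t * F (g \<cdot> x))) \<le> c * exp (t * F g)" if g: "g \<in> L" for g
  proof -
    have "exp (t * F (g \<cdot> x)) \<le> exp (t * F g) * (1 + t * (F (g \<cdot> x) - F g) + t\<^sup>2 * (real l)\<^sup>2)"
      if x: "x \<in> set_pmf (W l)" for x
    proof -
      let ?y = "t * (F (g \<cdot> x) - F g)"
      have yl: "\<bar>?y\<bar> \<le> t * real l" using lipW[OF g x] t(1) by (simp add: abs_mult)
      then have y: "\<bar>?y\<bar> \<le> 1" "?y\<^sup>2 \<le> (t * real l)\<^sup>2"
        using t(2) power_mono[OF yl abs_ge_zero, of 2] unfolding power2_abs by linarith+
      have "exp (t * F (g \<cdot> x)) = exp (t * F g) * exp ?y"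
        by (simp add: exp_add[symmetric] algebra_simps)
      also have "\<dots> \<le> exp (t * F g) * (1 + ?y + (t * real l)\<^sup>2)"
        using exp_le_quadratic[OF y(1)] y(2) by (intro mult_left_mono) auto
      finally show ?thesis by (simp add: power_mult_distrib)
    qed
    then have "expect (W l) (\<lambda>x. exp (t * F (g \<cdot> x)))
      \<le> expect (W l) (\<lambda>x. exp (t * F g) * (1 + t * (F (g \<cdot> x) - F g) + t\<^sup>2 * (real l)\<^sup>2))"
      by (intro expect_mono) auto
    also have "\<dots> = exp (t * F g) * (1 + t * (expect (W l) (\<lambda>x. F (g \<cdot> x)) - F g) + t\<^sup>2 * (real l)\<^sup>2)"
      by (simp add: expect_add expect_diff)
    also have "\<dots> \<le> exp (t * F g) * (1 + t * d + t\<^sup>2 * (real l)\<^sup>2)"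
      using d[OF g] t by (intro mult_left_mono add_mono) auto
    also have "\<dots> \<le> exp (t * F g) * c"
      unfolding c_def using exp_ge_add_one_self[of "t * d + t\<^sup>2 * (real l)\<^sup>2"]
      by (intro mult_left_mono) (simp_all only: add.assoc exp_ge_zero)
    finally show ?thesis by (simp add: mult.commute)
  qed
  have c0: "0 < c" by (simp add: c_def)
  have Mstep: "M (m + l) \<le> c * M m" for m
  proof -
    have "M (m + l) \<le> expect (W m) (\<lambda>g. c * exp (t * F g))"
      unfolding M_def expect_walk_law_add using step by (intro expect_mono) (auto dest: set_walk_law)
    then show ?thesis by (simp add: M_def)
  qed
  have Mq: "M (r + q * l) \<le> c ^ q * M r" for q r
  proof (induction q)
    case (Suc q)
    have "M (r + Suc q * l) \<le> c * M (r + q * l)" using Mstep[of "r + q * l"] by (simp add: algebra_simps)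
    also have "\<dots> \<le> c * (c ^ q * M r)" using Suc c0 by (intro mult_left_mono) auto
    finally show ?case by (simp add: mult_ac)
  qed simp
  have Mr: "M r \<le> exp 1" if "r < l" for r
  proof -
    have "M r \<le> expect (W r) (\<lambda>x. exp 1)" unfolding M_def
    proof (intro expect_mono)
      fix x assume x: "x \<in> set_pmf (W r)"
      then have "\<bar>F x\<bar> \<le> real r" using lipW[of "[]" x r] F0 by simp
      then have "t * F x \<le> t * real l" using that t by (intro mult_left_mono) auto
      with t(2) have "t * F x \<le> 1" by linarith
      then show "exp (t * F x) \<le> exp 1" by simp
    qed simp
    then show ?thesis by simp
  qed
  \<comment> \<open>The summand 1 bounds the moment over the incomplete block, and t * \<bar>d\<bar>
    pays for rounding m / l down to the number q of full blocks.\<close>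
  define C where "C = exp (1 + t * \<bar>d\<bar>)"
  have bound: "measure_pmf.prob (W m) {x. real m * (d / real l + e) \<le> F x} \<le> C * exp (- (t * e / 2)) ^ m" for m
  proof -
    define q where "q = m div l"
    define r where "r = m mod l"
    have r: "r < l" and m: "m = r + q * l" using l by (auto simp: r_def q_def)
    define s where "s = real m * (d / real l + e)"
    have "measure_pmf.prob (W m) {x. s \<le> F x} = expect (W m) (\<lambda>x. if s \<le> F x then 1 else 0)"
      by (simp add: expect_indicator)
    also have "\<dots> \<le> expect (W m) (\<lambda>x. exp (- (t * s)) * exp (t * F x))"
      using t by (intro expect_mono) (auto simp: exp_add[symmetric])
    also have "\<dots> = exp (- (t * s)) * M m" by (simp add: M_def)
    also have "\<dots> \<le> exp (- (t * s)) * (c ^ q * exp 1)"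
      using Mq[of r q] Mr[OF r] c0 unfolding m by (intro mult_left_mono order_trans[OF Mq]) auto
    also have "\<dots> = exp (1 + (real q * (t * d + t\<^sup>2 * (real l)\<^sup>2) - t * s))"
      by (simp add: c_def exp_of_nat_mult[symmetric] exp_add[symmetric])
    also have "\<dots> \<le> exp (1 + t * \<bar>d\<bar> + real m * (- (t * e / 2)))"
    proof -
      have "real m * (d / real l) = real r * (d / real l) + real q * d"
        using l by (simp add: m field_simps)
      moreover have "- (real r * (d / real l)) \<le> \<bar>d\<bar>"
      proof -
        have "- (real r * (d / real l)) \<le> \<bar>real r * (d / real l)\<bar>" by (rule abs_ge_minus_self)
        also have "\<dots> = (real r / real l) * \<bar>d\<bar>" by (simp add: abs_mult)
        also have "\<dots> \<le> 1 * \<bar>d\<bar>" using r by (intro mult_right_mono) auto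
        finally show ?thesis by simp
      qed
      ultimately have 1: "real q * d - real m * (d / real l) \<le> \<bar>d\<bar>" by simp
      have "real q * (t * (real l)\<^sup>2) = (real (q * l)) * (t * real l)" by (simp add: power2_eq_square)
      also have "\<dots> \<le> real m * (e / 2)" using t l by (intro mult_mono) (auto simp: m)
      finally have 2: "real q * (t * (real l)\<^sup>2) \<le> real m * (e / 2)" .
      have "real q * (t * d + t\<^sup>2 * (real l)\<^sup>2) - t * s
        = t * ((real q * d - real m * (d / real l)) + (real q * (t * (real l)\<^sup>2) - real m * e))"
        by (simp add: s_def algebra_simps power2_eq_square)
      also have "\<dots> \<le> t * (\<bar>d\<bar> + (real m * (e / 2) - real m * e))"
        using t(1) by (intro mult_left_mono add_mono diff_right_mono 1 2) simp
      finally show ?thesis by (simp add: algebra_simps)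
    qed
    also have "\<dots> = C * exp (- (t * e / 2)) ^ m"
      by (simp add: C_def exp_of_nat_mult[symmetric] exp_add[symmetric])
    finally show ?thesis by (simp add: s_def)
  qed
  have "summable (\<lambda>m. C * exp (- (t * e / 2)) ^ m)"
    using t e by (intro summable_mult summable_geometric) auto
  then show ?thesis by (rule summable_comparison_test'[where N = 0]) (use bound in auto)
qed

end

context transient_walk
begin

text \<open>\<open>concentration\<close> for the length and for its negative, with one block length
  \<open>l\<close>. Upper deviations rest on subadditivity, lower ones on bounded cancellation. The
  block is so long that its rate exceeds \<gamma> by less than e / 2 and the cancellation constant
  costs less than e / 2 per step; that its rate is not below \<gamma> is the infimum
  property.\<close>

lemma summable_length_deviation:
  assumes lim: "(\<lambda>m. mean_length m / real m) \<longlonglongrightarrow> \<gamma>" and inf: "\<And>m. 1 \<le> m \<Longrightarrow> \<gamma> \<le> mean_length m / real m"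
    and e: "0 < e"
  shows "summable (\<lambda>m. measure_pmf.prob (W m) {x. real m * e \<le> \<bar>real (length x) - real m * \<gamma>\<bar>})"
proof -
  define c where "c = 1 + 2 / (1 - \<zeta>)"
  have "\<forall>\<^sub>F m in sequentially. mean_length m / real m < \<gamma> + e / 2"
    using lim e by (intro order_tendstoD) auto
  moreover have "\<forall>\<^sub>F m in sequentially. c / real m < e / 2"
    using e by (intro order_tendstoD[OF lim_const_over_n]) auto
  ultimately have "\<forall>\<^sub>F m in sequentially. mean_length m / real m < \<gamma> + e / 2 \<and> c / real m < e / 2 \<and> 1 \<le> m"
    using eventually_ge_at_top[of 1] by eventually_elim auto
  then obtain l where l: "mean_length l / real l < \<gamma> + e / 2" "c / real l < e / 2" "1 \<le> l"
    by (auto simp: eventually_sequentially)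
  have lip: "\<bar>real (length (g \<cdot> [a])) - real (length g)\<bar> \<le> 1" if "g \<in> L" "a \<in> A" for g a
    using length_mul_letter[OF that] by linarith
  have up: "expect (W l) (\<lambda>x. real (length (g \<cdot> x))) \<le> real (length g) + mean_length l" if "g \<in> L" for g
  proof -
    have "expect (W l) (\<lambda>x. real (length (g \<cdot> x))) \<le> expect (W l) (\<lambda>x. real (length g) + real (length x))"
      using that by (intro expect_mono) (auto dest!: set_walk_law simp flip: of_nat_add intro: length_mul_le)
    then show ?thesis by (simp add: mean_length_def expect_add)
  qed
  have low: "expect (W l) (\<lambda>x. - real (length (g \<cdot> x))) \<le> - real (length g) + (c - mean_length l)" if "g \<in> L" for g
    using expect_length_mul_ge[OF that, of l] by (simp add: c_def)
  have s1: "summable (\<lambda>m. measure_pmf.prob (W m) {x. real m * (mean_length l / real l + e / 2) \<le> real (length x)})"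
    by (rule concentration[OF _ lip l(3) up]) (use e in auto)
  have s2: "summable (\<lambda>m. measure_pmf.prob (W m) {x. real m * ((c - mean_length l) / real l + e / 2) \<le> - real (length x)})"
    by (rule concentration[OF _ _ l(3) low]) (use e lip in \<open>auto simp: abs_minus_commute\<close>)
  have "measure_pmf.prob (W m) {x. real m * e \<le> \<bar>real (length x) - real m * \<gamma>\<bar>} \<le>
    measure_pmf.prob (W m) {x. real m * (mean_length l / real l + e / 2) \<le> real (length x)} +
    measure_pmf.prob (W m) {x. real m * ((c - mean_length l) / real l + e / 2) \<le> - real (length x)}" for m
  proof -
    have 1: "real m * (mean_length l / real l + e / 2) \<le> real m * (\<gamma> + e)"
      using l by (intro mult_left_mono) auto
    have "(c - mean_length l) / real l = c / real l - mean_length l / real l"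
      by (rule diff_divide_distrib)
    then have "(c - mean_length l) / real l + e / 2 \<le> e - \<gamma>"
      using l(2) inf[OF l(3)] by linarith
    then have 2: "real m * ((c - mean_length l) / real l + e / 2) \<le> real m * (e - \<gamma>)"
      by (intro mult_left_mono) simp_all
    have "measure_pmf.prob (W m) {x. real m * e \<le> \<bar>real (length x) - real m * \<gamma>\<bar>} \<le>
      measure_pmf.prob (W m) ({x. real m * (mean_length l / real l + e / 2) \<le> real (length x)}
        \<union> {x. real m * ((c - mean_length l) / real l + e / 2) \<le> - real (length x)})"
    proof (intro measure_pmf.finite_measure_mono subsetI)
      fix x assume "x \<in> {x::(nat \<times> 'a) list. real m * e \<le> \<bar>real (length x) - real m * \<gamma>\<bar>}"
      then consider "real m * (\<gamma> + e) \<le> real (length x)" | "real m * (e - \<gamma>) \<le> - real (length x)"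
        by (auto simp: algebra_simps abs_le_iff abs_if split: if_splits)
      then show "x \<in> {x. real m * (mean_length l / real l + e / 2) \<le> real (length x)}
        \<union> {x. real m * ((c - mean_length l) / real l + e / 2) \<le> - real (length x)}"
        using 1 2 by cases auto
    qed simp
    also have "\<dots> \<le> measure_pmf.prob (W m) {x. real m * (mean_length l / real l + e / 2) \<le> real (length x)} +
      measure_pmf.prob (W m) {x. real m * ((c - mean_length l) / real l + e / 2) \<le> - real (length x)}"
      by (intro measure_subadditive) (auto simp: measure_pmf.emeasure_eq_measure)
    finally show ?thesis .
  qed
  then show ?thesis
    by (intro summable_comparison_test'[OF summable_add[OF s1 s2], of 0]) auto
qed

end

section \<open>Superharmonic weights for symmetric generating walks\<close>

context free_product_walk
begin

text \<open>A walk with steps in \<open>B\<close> writes only letters of \<open>B\<close> as long as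
  \<open>B\<close> is closed under products within each factor. Since it reaches every one-letter
  word, \<open>B\<close> must be the whole alphabet.\<close>

lemma generating_letters:
  assumes gen: "generating n G \<mu>" and B: "set_pmf \<mu> \<subseteq> B" "B \<subseteq> A"
    and merge: "\<And>a b. a \<in> B \<Longrightarrow> b \<in> B \<Longrightarrow> fst a = fst b \<Longrightarrow> a \<noteq> linv b \<Longrightarrow> merge b a \<in> B"
  shows "A \<subseteq> B"
proof
  have *: "set x \<subseteq> B" if "x \<in> set_pmf (W m)" for m x
    using that
  proof (induction m arbitrary: x)
    case (Suc m)
    then obtain g a where g: "g \<in> set_pmf (W m)" and a: "a \<in> set_pmf \<mu>" and x: "x = g \<cdot> [a]"
      by (auto simp: walk_law_Suc)
    have gL: "g \<in> L" and gB: "set g \<subseteq> B" and aA: "a \<in> A" "a \<in> B"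
      using g a Suc.IH B set_walk_law[OF g] by auto
    show ?case
    proof (cases "g \<noteq> [] \<and> fst (last g) = fst a")
      case True
      then obtain v b where vb: "g = v @ [b]" by (metis rev_exhaust)
      then show ?thesis
        using mul_letter_same[of v b a] gL aA True gB merge[of a b] x by auto
    next
      case False
      then have "g @ [a] \<in> L" using gL aA by (auto simp: snoc_in_L)
      then show ?thesis using x gB aA by (simp add: mul_append)
    qed
  qed simp
  fix a assume "a \<in> A"
  then have "[a] \<in> (\<Union>m\<in>{1..}. set_pmf (W m))"
    using gen by (simp add: generating_def Cons_in_L)
  then obtain m where "[a] \<in> set_pmf (W m)" by blast
  from *[OF this] show "a \<in> B" by simp
qed

definition mass :: "nat \<Rightarrow> real" where "mass i = (\<Sum>a\<in>letters_at G i. pmf \<mu> a)"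

lemma mass_pos:
  assumes gen: "generating n G \<mu>" and i: "i < n" shows "0 < mass i"
proof (rule ccontr)
  assume "\<not> 0 < mass i"
  then have "mass i = 0" by (simp add: mass_def sum_nonneg antisym not_less)
  then have "pmf \<mu> a = 0" if "a \<in> letters_at G i" for a
    using that finite_letters_at[OF i] by (simp add: mass_def sum_nonneg_eq_0_iff)
  then have "set_pmf \<mu> \<subseteq> A - letters_at G i"
    using set_mu by (auto simp: set_pmf_iff)
  then have "A \<subseteq> A - letters_at G i"
  proof (rule generating_letters[OF gen])
    fix a b assume ab: "a \<in> A - letters_at G i" "b \<in> A - letters_at G i" "fst a = fst b" "a \<noteq> linv b"
    then have "merge b a \<in> A" using merge_in_letters by blast
    moreover have "fst b \<noteq> i" using ab(2) letters_iff by blast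
    ultimately show "merge b a \<in> A - letters_at G i" by (simp add: letters_at_iff)
  qed auto
  then show False using letters_at_nonempty[OF i] letters_at_subset[OF i] by auto
qed

text \<open>If \<open>c\<close> carried all the mass of its factor, symmetry would make it its own
  inverse. Then no product of letters leads from \<open>c\<close> to another letter of that factor,
  so the walk could never write one.\<close>

lemma pmf_less_mass:
  assumes gen: "generating n G \<mu>" and sym: "\<And>a. a \<in> A \<Longrightarrow> pmf \<mu> a = pmf \<mu> (linv a)"
    and i: "i < n" and card: "card (letters_at G i) \<noteq> 1" and c: "c \<in> letters_at G i"
  shows "pmf \<mu> c < mass i"
proof (rule ccontr)
  assume nl: "\<not> pmf \<mu> c < mass i"
  have fin: "finite (letters_at G i)" by (rule finite_letters_at[OF i])
  have "mass i = pmf \<mu> c + (\<Sum>a\<in>letters_at G i - {c}. pmf \<mu> a)"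
    unfolding mass_def by (rule sum.remove[OF fin c])
  then have "(\<Sum>a\<in>letters_at G i - {c}. pmf \<mu> a) = 0"
    using nl sum_nonneg[of "letters_at G i - {c}" "pmf \<mu>"] by simp
  then have zero: "pmf \<mu> a = 0" if "a \<in> letters_at G i" "a \<noteq> c" for a
    using that fin by (subst (asm) sum_nonneg_eq_0_iff) auto
  have cA: "c \<in> A" "fst c = i" using c letters_at_subset[OF i] by (auto simp: letters_at_iff)
  have "pmf \<mu> c > 0" using nl mass_pos[OF gen i] by linarith
  then have "pmf \<mu> (linv c) > 0" using sym[OF cA(1)] by simp
  moreover have "linv c \<in> letters_at G i" using linv_props(1)[OF cA(1)] cA(2) by (simp add: letters_iff)
  ultimately have lc: "linv c = c" using zero[of "linv c"] by force
  have "A \<subseteq> (A - letters_at G i) \<union> {c}"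
  proof (rule generating_letters[OF gen])
    show "set_pmf \<mu> \<subseteq> (A - letters_at G i) \<union> {c}"
      using set_mu zero by (auto simp: set_pmf_iff)
    fix a b assume ab: "a \<in> (A - letters_at G i) \<union> {c}" "b \<in> (A - letters_at G i) \<union> {c}" "fst a = fst b" "a \<noteq> linv b"
    then have A: "a \<in> A" "b \<in> A" using cA by auto
    have "fst b \<noteq> i"
    proof
      assume "fst b = i"
      then have "a = c" "b = c" using ab A letters_iff[of a] letters_iff[of b] by auto
      then show False using lc ab by simp
    qed
    then show "merge b a \<in> (A - letters_at G i) \<union> {c}"
      using merge_in_letters[OF A ab(3,4)] by (auto simp: letters_at_iff)
  qed (use cA in auto)
  then have "letters_at G i = {c}" using letters_at_subset[OF i] c by auto
  with card show False by simp
qed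

text \<open>With \<open>y i = mass i * (1 - z i)\<close>, the superharmonicity condition becomes
  \<open>\<theta> i * y i \<le> z i * (\<Sum>j \<noteq> i. y j)\<close>, where \<open>\<theta> i\<close> is the largest share of a single letter in \<open>mass i\<close>. It suffices
  to solve the strict inequality for \<open>z = 1\<close> and to scale \<open>y\<close> down. For two factors this needs
  \<open>\<theta> 0 * \<theta> 1 < 1\<close>, which is where the infinite dihedral group is excluded.\<close>

lemma exists_superharmonic_weights:
  assumes gen: "generating n G \<mu>" and sym: "\<And>a. a \<in> A \<Longrightarrow> pmf \<mu> a = pmf \<mu> (linv a)"
    and nontriv: "\<not> (n = 2 \<and> (\<forall>i<2. card (letters_at G i) = 1))"
  obtains z \<zeta> where "transient_walk n G \<mu> z \<zeta>"
proof -
  define \<theta> where "\<theta> i = Max (pmf \<mu> ` letters_at G i) / mass i" for i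
  have \<theta>: "pmf \<mu> a \<le> \<theta> i * mass i" if "i < n" "a \<in> letters_at G i" for i a
    using that mass_pos[OF gen that(1)] finite_letters_at[OF that(1)] by (simp add: \<theta>_def)
  have \<theta>0: "0 \<le> \<theta> i" "\<theta> i \<le> 1" "card (letters_at G i) \<noteq> 1 \<Longrightarrow> \<theta> i < 1" if i: "i < n" for i
  proof -
    obtain c where c: "c \<in> letters_at G i" "Max (pmf \<mu> ` letters_at G i) = pmf \<mu> c"
      using Max_in[of "pmf \<mu> ` letters_at G i"] letters_at_nonempty[OF i] finite_letters_at[OF i]
      unfolding image_iff by blast
    have "pmf \<mu> c \<le> mass i"
      unfolding mass_def using c finite_letters_at[OF that] by (intro member_le_sum) auto
    then show "0 \<le> \<theta> i" "\<theta> i \<le> 1" using mass_pos[OF gen that] c by (auto simp: \<theta>_def)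
    show "\<theta> i < 1" if "card (letters_at G i) \<noteq> 1"
      using pmf_less_mass[OF gen sym \<open>i < n\<close> that c(1)] mass_pos[OF gen \<open>i < n\<close>] c by (simp add: \<theta>_def)
  qed
  have "\<exists>y. \<forall>i<n. 0 < y i \<and> \<theta> i * y i < (\<Sum>j\<in>{..<n} - {i}. y j)"
  proof (cases "n = 2")
    \<comment> \<open>With at least three factors equal values suffice, since \<theta> i \<le> 1 < n
      - 1.\<close>
    case False
    show ?thesis
    proof (intro exI[of _ "\<lambda>_. 1"] allI impI conjI)
      fix i assume i: "i < n"
      have "(\<Sum>j\<in>{..<n} - {i}. 1 :: real) = real n - 1"
        using i two_le by (simp add: card_Diff_subset of_nat_diff)
      then show "\<theta> i * 1 < (\<Sum>j\<in>{..<n} - {i}. 1)" using \<theta>0(2)[OF i] False two_le by simp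
    qed simp
  next
    case True
    \<comment> \<open>These are the two conditions for y = (1, c). If \<theta> 1 < 1, then 2 / (1 +
      \<theta> 1) exceeds 1 while its product with \<theta> 1 stays below 1; if \<theta> 0 < 1, the
      midpoint of \<theta> 0 and 1 works.\<close>
    obtain c where c: "0 < c" "\<theta> 0 < c" "\<theta> 1 * c < 1"
    proof (cases "card (letters_at G 0) = 1")
      case True
      then have "card (letters_at G 1) \<noteq> 1" using nontriv \<open>n = 2\<close> by (auto simp: less_2_cases_iff)
      then have "\<theta> 1 < 1" "0 \<le> \<theta> 1" using \<theta>0[of 1] \<open>n = 2\<close> by auto
      moreover have "\<theta> 0 * (1 + \<theta> 1) \<le> 1 * (1 + \<theta> 1)"
        using calculation \<theta>0(2)[of 0] \<open>n = 2\<close> by (intro mult_right_mono) auto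
      ultimately show ?thesis using that[of "2 / (1 + \<theta> 1)"] by (simp add: field_simps)
    next
      case False
      then have 1: "\<theta> 0 < 1" "0 \<le> \<theta> 0" "\<theta> 1 \<le> 1" "0 \<le> \<theta> 1" using \<theta>0[of 0] \<theta>0[of 1] \<open>n = 2\<close> by auto
      have "\<theta> 1 * ((1 + \<theta> 0) / 2) \<le> 1 * ((1 + \<theta> 0) / 2)" using 1 by (intro mult_right_mono) auto
      also have "\<dots> < 1" using 1 by simp
      finally have "\<theta> 1 * ((1 + \<theta> 0) / 2) < 1" .
      with 1 show ?thesis by (intro that[of "(1 + \<theta> 0) / 2"]) simp_all
    qed
    have e: "{..<2} - {0} = {1::nat}" "{..<2} - {1} = {0::nat}" by auto
    show ?thesis
      using c True
      by (intro exI[of _ "\<lambda>i. if i = 0 then 1 else c"]) (auto simp: less_2_cases_iff e e[unfolded One_nat_def])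
  qed
  then obtain y where y: "\<And>i. i < n \<Longrightarrow> 0 < y i" "\<And>i. i < n \<Longrightarrow> \<theta> i * y i < (\<Sum>j\<in>{..<n} - {i}. y j)"
    by blast
  \<comment> \<open>Solves mass i * (1 - z s i) = s * y i. As \<open>s\<close> decreases to 0, all
    values tend to 1 from below and the strict inequalities survive for small
    \<open>s\<close>.\<close>
  define z where "z s i = 1 - s * y i / mass i" for s i
  let ?P = "\<lambda>s i. 0 < z s i \<and> z s i < 1 \<and> \<theta> i * y i < z s i * (\<Sum>j\<in>{..<n} - {i}. y j)"
  have "\<forall>\<^sub>F s in at_right 0. ?P s i" if i: "i < n" for i
  proof -
    have lim: "((\<lambda>s. z s i) \<longlongrightarrow> 1 - 0 * y i / mass i) (at_right 0)"
      unfolding z_def by (intro tendsto_intros) (use mass_pos[OF gen i] in auto)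
    then have "\<forall>\<^sub>F s in at_right 0. 0 < z s i" by (intro order_tendstoD) auto
    moreover have "((\<lambda>s. z s i * (\<Sum>j\<in>{..<n} - {i}. y j)) \<longlongrightarrow> 1 * (\<Sum>j\<in>{..<n} - {i}. y j)) (at_right 0)"
      by (intro tendsto_mult_right) (use lim in simp)
    then have "\<forall>\<^sub>F s in at_right 0. \<theta> i * y i < z s i * (\<Sum>j\<in>{..<n} - {i}. y j)"
      by (rule order_tendstoD) (use y(2)[OF i] in simp)
    moreover have "\<forall>\<^sub>F s in at_right 0. (0::real) < s" by (rule eventually_at_right_less)
    ultimately show ?thesis
      by eventually_elim (use y(1)[OF i] mass_pos[OF gen i] in \<open>simp add: z_def\<close>)
  qed
  then have "\<forall>\<^sub>F s in at_right 0. \<forall>i\<in>{..<n}. ?P s i"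
    by (intro eventually_ball_finite) auto
  then have "\<forall>\<^sub>F s in at_right 0. (\<forall>i\<in>{..<n}. ?P s i) \<and> 0 < s"
    using eventually_at_right_less[of 0] by eventually_elim auto
  then obtain s where s: "\<And>i. i < n \<Longrightarrow> ?P s i" "0 < s"
    using eventually_happens'[OF trivial_limit_at_right_real] by (metis (mono_tags, lifting) lessThan_iff)
  have "transient_walk n G \<mu> (z s) (Max (z s ` {..<n}))"
  proof
    show "0 < z s i \<and> z s i \<le> Max (z s ` {..<n})" if "i < n" for i
      using s that by auto
    have "{..<n} \<noteq> {}" using two_le by (auto simp: lessThan_empty_iff)
    then show "Max (z s ` {..<n}) < 1" using s by (subst Max_less_iff) auto
    fix b assume b: "b \<in> A"
    define i where "i = fst b"
    have i: "i < n" "linv b \<in> letters_at G i" using b linv_props(1)[OF b] by (auto simp: letters_iff i_def)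
    have one: "mass j * (1 - z s j) = s * y j" if "j < n" for j
      using mass_pos[OF gen that] by (simp add: z_def)
    have A: "A - letters_at G i = (\<Union>j\<in>{..<n} - {i}. letters_at G j)"
      using letters_at_disjoint by (auto simp: letters_def)
    have "(\<Sum>a\<in>A - letters_at G i. pmf \<mu> a * (1 - z s (fst a)))
      = (\<Sum>j\<in>{..<n} - {i}. \<Sum>a\<in>letters_at G j. pmf \<mu> a * (1 - z s (fst a)))"
      unfolding A by (rule sum.UNION_disjoint) (use letters_at_disjoint finite_letters_at in auto)
    also have "\<dots> = (\<Sum>j\<in>{..<n} - {i}. \<Sum>a\<in>letters_at G j. pmf \<mu> a * (1 - z s j))"
      by (intro sum.cong) (auto simp: letters_at_iff)
    also have "\<dots> = s * (\<Sum>j\<in>{..<n} - {i}. y j)"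
      by (simp add: sum_distrib_right[symmetric] mass_def[symmetric] one sum_distrib_left)
    finally have sum: "(\<Sum>a\<in>A - letters_at G i. pmf \<mu> a * (1 - z s (fst a))) = s * (\<Sum>j\<in>{..<n} - {i}. y j)" .
    have "pmf \<mu> (linv b) * (1 - z s i) \<le> \<theta> i * mass i * (1 - z s i)"
      using \<theta>[OF i] s(1)[OF i(1)] by (intro mult_right_mono) auto
    also have "\<dots> = s * (\<theta> i * y i)" using one[OF i(1)] by simp
    also have "\<dots> \<le> s * (z s i * (\<Sum>j\<in>{..<n} - {i}. y j))"
      using s(1)[OF i(1)] s(2) by (intro mult_left_mono) auto
    finally show "pmf \<mu> (linv b) * (1 - z s (fst b))
      \<le> z s (fst b) * (\<Sum>a\<in>A - letters_at G (fst b). pmf \<mu> a * (1 - z s (fst a)))"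
      unfolding i_def[symmetric] sum by (simp add: mult_ac)
  qed
  then show ?thesis by (rule that)
qed

end

section \<open>The drift\<close>

context free_product_walk
begin

abbreviation \<Omega> :: "(nat \<times> 'a) stream measure" where "\<Omega> \<equiv> stream_space (measure_pmf \<mu>)"

sublocale \<Omega>: prob_space \<Omega>
  by (rule prob_space.prob_space_stream_space[OF prob_space_measure_pmf])

lemma space_Omega [simp]: "space \<Omega> = UNIV"
  by (simp add: space_stream_space)

lemma walk_simps [simp]: "walk n G \<omega> 0 = []" "walk n G \<omega> (Suc m) = walk n G \<omega> m \<cdot> [\<omega> !! m]"
  by simp_all

declare walk.simps [simp del]

text \<open>The letter type need not be countable, so the position of the walk is a measurable function only
  once the increments are forced into the finite alphabet. This changes the walk on a null set.\<close>

definition clip :: "nat \<times> 'a \<Rightarrow> nat \<times> 'a" where "clip a = (if a \<in> A then a else (SOME a. a \<in> A))"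

definition cwalk :: "(nat \<times> 'a) stream \<Rightarrow> nat \<Rightarrow> (nat \<times> 'a) list" where
  "cwalk \<omega> m = walk n G (smap clip \<omega>) m"

lemma letters_nonempty: "A \<noteq> {}"
proof
  assume "A = {}"
  then show False using sum_mu by simp
qed

lemma clip_in [simp]: "clip a \<in> A"
  using letters_nonempty by (auto simp: clip_def some_in_eq)

lemma clip_id: "a \<in> A \<Longrightarrow> clip a = a"
  by (simp add: clip_def)

lemma cwalk_simps [simp]: "cwalk \<omega> 0 = []" "cwalk \<omega> (Suc m) = cwalk \<omega> m \<cdot> [clip (\<omega> !! m)]"
  by (simp_all add: cwalk_def)

lemma cwalk_in_L [simp]: "cwalk \<omega> m \<in> L"
  by (induction m) (auto intro!: mul_in_L simp: Cons_in_L)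

lemma AE_letters: "AE \<omega> in \<Omega>. \<forall>i. \<omega> !! i \<in> A"
proof -
  have "AE \<omega> in \<Omega>. stream_all (\<lambda>a. a \<in> A) \<omega>"
    by (rule prob_space.AE_stream_all[OF prob_space_measure_pmf]) (use set_mu in \<open>auto simp: AE_measure_pmf_iff\<close>)
  then show ?thesis by eventually_elim (auto simp: sset_range)
qed

lemma walk_eq_cwalk: "\<forall>i. \<omega> !! i \<in> A \<Longrightarrow> walk n G \<omega> m = cwalk \<omega> m"
  by (induction m) (simp_all add: clip_id)

lemma AE_walk_eq_cwalk: "AE \<omega> in \<Omega>. walk n G \<omega> = cwalk \<omega>"
  using AE_letters by eventually_elim (auto simp: walk_eq_cwalk)

text \<open>The previous position takes countably many values, so it may be held fixed while the
  next letter varies.\<close>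

lemma measurable_cwalk [measurable]: "(\<lambda>\<omega>. cwalk \<omega> m) \<in> \<Omega> \<rightarrow>\<^sub>M count_space L"
proof (induction m)
  case (Suc m)
  have "(\<lambda>\<omega>. g \<cdot> [clip (\<omega> !! m)]) \<in> \<Omega> \<rightarrow>\<^sub>M count_space L" if "g \<in> L" for g
    by (rule measurable_compose[OF measurable_snth[of m]])
      (use that in \<open>auto intro!: mul_in_L simp: Cons_in_L\<close>)
  from measurable_compose_countable'[OF this Suc countable_L] show ?case by simp
qed simp

lemma letter_mult_Nil [simp]: "letter_mult G a [] = [a]"
  by (cases a) simp

lemma cwalk_Stream: "cwalk (x ## \<omega>) (Suc m) = [clip x] \<cdot> cwalk \<omega> m"
proof (induction m)
  case (Suc m)
  have "cwalk (x ## \<omega>) (Suc (Suc m)) = cwalk (x ## \<omega>) (Suc m) \<cdot> [clip (\<omega> !! m)]"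
    by (subst cwalk_simps(2)) simp
  also have "\<dots> = [clip x] \<cdot> cwalk \<omega> m \<cdot> [clip (\<omega> !! m)]"
    by (simp only: Suc)
  also have "\<dots> = [clip x] \<cdot> cwalk \<omega> (Suc m)"
    by (subst mul_assoc) (simp_all add: Cons_in_L del: foldr_Cons foldr.simps)
  finally show ?case .
qed simp

text \<open>The stream space unfolds at the first increment, whereas \<open>walk_law\<close> grows
  at the last one; \<open>cwalk_Stream\<close> and the splitting of m + 1 as 1 + m reconcile them.
  Nonnegative integrals keep integrability out of the induction.\<close>

lemma nn_integral_cwalk:
  fixes u :: "(nat \<times> 'a) list \<Rightarrow> ennreal"
  shows "(\<integral>\<^sup>+\<omega>. u (cwalk \<omega> m) \<partial>\<Omega>) = (\<integral>\<^sup>+x. u x \<partial>measure_pmf (W m))"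
proof (induction m arbitrary: u)
  case 0
  show ?case by (simp add: \<Omega>.emeasure_space_1[simplified])
next
  case (Suc m)
  have [measurable]: "(\<lambda>\<omega>. u (cwalk \<omega> (Suc m))) \<in> borel_measurable \<Omega>"
    by (rule measurable_compose[OF measurable_cwalk]) simp
  have "W (Suc m) = bind_pmf (map_pmf (\<lambda>a. [a]) \<mu>) (\<lambda>g. map_pmf (\<lambda>x. g \<cdot> x) (W m))"
    using walk_law_add[of 1 m] by (simp add: walk_law_Suc bind_return_pmf)
  then have law: "(\<integral>\<^sup>+x. u x \<partial>measure_pmf (W (Suc m))) = (\<integral>\<^sup>+a. (\<integral>\<^sup>+x. u ([a] \<cdot> x) \<partial>measure_pmf (W m)) \<partial>measure_pmf \<mu>)"
    by simp
  have "(\<integral>\<^sup>+\<omega>. u (cwalk \<omega> (Suc m)) \<partial>\<Omega>) = (\<integral>\<^sup>+a. (\<integral>\<^sup>+\<omega>. u (cwalk (a ## \<omega>) (Suc m)) \<partial>\<Omega>) \<partial>measure_pmf \<mu>)"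
    by (rule prob_space.nn_integral_stream_space[OF prob_space_measure_pmf]) measurable
  also have "\<dots> = (\<integral>\<^sup>+a. (\<integral>\<^sup>+x. u ([clip a] \<cdot> x) \<partial>measure_pmf (W m)) \<partial>measure_pmf \<mu>)"
  proof -
    have "(\<integral>\<^sup>+\<omega>. u (cwalk (a ## \<omega>) (Suc m)) \<partial>\<Omega>) = (\<integral>\<^sup>+x. u ([clip a] \<cdot> x) \<partial>measure_pmf (W m))" for a
      unfolding cwalk_Stream by (rule Suc)
    then show ?thesis by simp
  qed
  also have "\<dots> = (\<integral>\<^sup>+a. (\<integral>\<^sup>+x. u ([a] \<cdot> x) \<partial>measure_pmf (W m)) \<partial>measure_pmf \<mu>)"
    by (rule nn_integral_cong_AE) (use set_mu in \<open>auto simp: AE_measure_pmf_iff clip_id\<close>)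
  finally show ?case using law by simp
qed

lemma sets_cwalk: "{\<omega>. cwalk \<omega> m \<in> B} \<in> sets \<Omega>"
proof -
  have "(\<lambda>\<omega>. cwalk \<omega> m) -` (B \<inter> L) \<inter> space \<Omega> \<in> sets \<Omega>"
    by (rule measurable_sets[OF measurable_cwalk]) auto
  moreover have "(\<lambda>\<omega>. cwalk \<omega> m) -` (B \<inter> L) \<inter> space \<Omega> = {\<omega>. cwalk \<omega> m \<in> B}" by auto
  ultimately show ?thesis by simp
qed

lemma prob_cwalk: "measure \<Omega> {\<omega>. cwalk \<omega> m \<in> B} = measure_pmf.prob (W m) B"
proof -
  have "emeasure \<Omega> {\<omega>. cwalk \<omega> m \<in> B} = (\<integral>\<^sup>+\<omega>. indicator {\<omega>. cwalk \<omega> m \<in> B} \<omega> \<partial>\<Omega>)"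
    using sets_cwalk by simp
  also have "\<dots> = (\<integral>\<^sup>+\<omega>. indicator B (cwalk \<omega> m) \<partial>\<Omega>)"
    by (intro nn_integral_cong) (simp add: indicator_def)
  also have "\<dots> = emeasure (measure_pmf (W m)) B"
    by (simp add: nn_integral_cwalk)
  finally show ?thesis by (simp add: measure_def)
qed

text \<open>Borel-Cantelli for the deviations of size 1 / (k + 1), followed by a countable
  intersection over k.\<close>

lemma AE_cwalk_converges:
  assumes sum: "\<And>e. 0 < e \<Longrightarrow> summable (\<lambda>m. measure_pmf.prob (W m) {x. real m * e \<le> \<bar>real (length x) - real m * \<gamma>\<bar>})"
  shows "AE \<omega> in \<Omega>. (\<lambda>m. real (length (cwalk \<omega> m)) / real m) \<longlonglongrightarrow> \<gamma>"
proof -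
  have "AE \<omega> in \<Omega>. \<forall>\<^sub>F m in sequentially. \<bar>real (length (cwalk \<omega> m)) - real m * \<gamma>\<bar> < real m * e" if e: "0 < e" for e
  proof -
    let ?B = "\<lambda>m. {x::(nat \<times> 'a) list. real m * e \<le> \<bar>real (length x) - real m * \<gamma>\<bar>}"
    have "AE \<omega> in \<Omega>. \<forall>\<^sub>F m in sequentially. \<omega> \<in> space \<Omega> - {\<omega>. cwalk \<omega> m \<in> ?B m}"
    proof (rule borel_cantelli_AE1)
      show "summable (\<lambda>m. measure \<Omega> {\<omega>. cwalk \<omega> m \<in> ?B m})"
        unfolding prob_cwalk by (rule sum[OF e])
      show "{\<omega>. cwalk \<omega> m \<in> ?B m} \<in> sets \<Omega>" for m by (rule sets_cwalk)
    qed (simp add: \<Omega>.emeasure_eq_measure)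
    then show ?thesis by eventually_elim (simp add: not_le)
  qed
  then have "AE \<omega> in \<Omega>. \<forall>k. \<forall>\<^sub>F m in sequentially. \<bar>real (length (cwalk \<omega> m)) - real m * \<gamma>\<bar> < real m * inverse (real (Suc k))"
    by (subst AE_all_countable) simp
  then show ?thesis
  proof eventually_elim
    fix \<omega> assume *: "\<forall>k. \<forall>\<^sub>F m in sequentially. \<bar>real (length (cwalk \<omega> m)) - real m * \<gamma>\<bar> < real m * inverse (real (Suc k))"
    show "(\<lambda>m. real (length (cwalk \<omega> m)) / real m) \<longlonglongrightarrow> \<gamma>"
    proof (rule tendstoI)
      fix e :: real assume "0 < e"
      then obtain k where k: "inverse (real (Suc k)) < e" using reals_Archimedean by blast
      from *[rule_format, of k] eventually_gt_at_top[of 0]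
      show "\<forall>\<^sub>F m in sequentially. dist (real (length (cwalk \<omega> m)) / real m) \<gamma> < e"
      proof eventually_elim
        case (elim m)
        have "dist (real (length (cwalk \<omega> m)) / real m) \<gamma> = \<bar>real (length (cwalk \<omega> m)) - real m * \<gamma>\<bar> / real m"
          using elim(2) by (simp add: dist_real_def abs_if field_simps)
        also have "\<dots> < inverse (real (Suc k))" using elim by (simp add: divide_less_eq mult.commute)
        finally show ?case using k by simp
      qed
    qed
  qed
qed

lemma drift_eqI:
  assumes "AE \<omega> in \<Omega>. (\<lambda>m. real (length (cwalk \<omega> m)) / real m) \<longlonglongrightarrow> \<gamma>"
  shows "drift n G \<mu> = \<gamma>"
  unfolding drift_def
proof (rule the_equality)
  show *: "AE \<omega> in \<Omega>. (\<lambda>m. real (length (walk n G \<omega> m)) / real m) \<longlonglongrightarrow> \<gamma>"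
    using assms AE_walk_eq_cwalk by eventually_elim simp
  fix \<gamma>' assume "AE \<omega> in \<Omega>. (\<lambda>m. real (length (walk n G \<omega> m)) / real m) \<longlonglongrightarrow> \<gamma>'"
  with * have "AE \<omega> in \<Omega>. \<gamma>' = \<gamma>" by eventually_elim (rule LIMSEQ_unique)
  then show "\<gamma>' = \<gamma>" by simp
qed

lemma walk_law_add_pair: "W (m + l) = map_pmf (\<lambda>(g, x). g \<cdot> x) (pair_pmf (W m) (W l))"
  unfolding walk_law_add pair_pmf_def map_pmf_def bind_assoc_pmf bind_return_pmf prod.case ..

text \<open>The position at time m + l is a product of two independent pieces with the laws at times
  m and l, so the entropies are subadditive.\<close>

lemma walk_entropy_lim:
  "(\<lambda>m. pmf_entropy (W m) / real m) \<longlonglongrightarrow> walk_entropy n G \<mu>"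
proof -
  have sub: "pmf_entropy (W (m + l)) \<le> pmf_entropy (W m) + pmf_entropy (W l)" for m l
  proof -
    have fin: "finite (set_pmf (pair_pmf (W m) (W l)))" by simp
    have "pmf_entropy (W (m + l)) \<le> pmf_entropy (pair_pmf (W m) (W l))"
      unfolding walk_law_add_pair by (rule pmf_entropy_map_le[OF fin])
    also have "\<dots> \<le> pmf_entropy (W m) + pmf_entropy (W l)"
      using pmf_entropy_pair_le[OF fin] by (simp add: map_fst_pair_pmf map_snd_pair_pmf)
    finally show ?thesis .
  qed
  obtain h where "(\<lambda>m. pmf_entropy (W m) / real m) \<longlonglongrightarrow> h"
    by (rule fekete[OF sub pmf_entropy_nonneg])
  then show ?thesis by (simp add: walk_entropy_def limI)
qed

end

context transient_walk
begin

lemma drift_props: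
  shows "(\<lambda>m. mean_length m / real m) \<longlonglongrightarrow> drift n G \<mu>" "0 \<le> drift n G \<mu>"
    "AE \<omega> in \<Omega>. (\<lambda>m. real (length (cwalk \<omega> m)) / real m) \<longlonglongrightarrow> drift n G \<mu>"
proof -
  obtain \<gamma> where \<gamma>: "(\<lambda>m. mean_length m / real m) \<longlonglongrightarrow> \<gamma>" "0 \<le> \<gamma>" "\<And>m. 1 \<le> m \<Longrightarrow> \<gamma> \<le> mean_length m / real m"
    by (rule fekete[OF mean_length_add mean_length_nonneg]) (rule that)
  have AE: "AE \<omega> in \<Omega>. (\<lambda>m. real (length (cwalk \<omega> m)) / real m) \<longlonglongrightarrow> \<gamma>"
    by (rule AE_cwalk_converges) (rule summable_length_deviation[OF \<gamma>(1,3)])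
  then have "drift n G \<mu> = \<gamma>" by (rule drift_eqI)
  then show "(\<lambda>m. mean_length m / real m) \<longlonglongrightarrow> drift n G \<mu>" "0 \<le> drift n G \<mu>"
    "AE \<omega> in \<Omega>. (\<lambda>m. real (length (cwalk \<omega> m)) / real m) \<longlonglongrightarrow> drift n G \<mu>"
    using \<gamma> AE by auto
qed

end

section \<open>Volume and entropy\<close>

context finite_free_product
begin

abbreviation \<rho> :: real where "\<rho> \<equiv> rho n G"
abbreviation K :: real where "K \<equiv> \<Sum>i<n. k i"

lemma k_le_K: "i < n \<Longrightarrow> k i \<le> K"
  by (intro member_le_sum) auto

text \<open>The sum equals n > 1 at x = 0, is at most 1 at x = K, and decreases strictly.\<close>

lemma rho_exists: "\<exists>!x. x > 0 \<and> (\<Sum>i<n. k i / (x + k i)) = 1"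
proof (rule ex_ex1I)
  let ?f = "\<lambda>x. \<Sum>i<n. k i / (x + k i)"
  have k0: "0 < k i" if "i < n" for i using k_ge_1[OF that] by linarith
  have K0: "0 < K" using k_le_K[of 0] k0[of 0] two_le by force
  have "?f K \<le> (\<Sum>i<n. k i / K)"
    using K0 k0 by (intro sum_mono frac_le) (auto intro: less_imp_le)
  then have fK: "?f K \<le> 1" using K0 by (simp add: sum_divide_distrib[symmetric])
  have "?f 0 = (\<Sum>i<n. 1)" by (rule sum.cong) (auto dest: k0)
  then have f0: "?f 0 = real n" by simp
  have "continuous_on {0..K} ?f"
    using k0 by (intro continuous_intros) (auto intro!: add_nonneg_pos less_imp_neq[symmetric])
  then obtain x where x: "0 \<le> x" "?f x = 1"
    using IVT2'[of ?f K 1 0] fK f0 K0 two_le by auto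
  moreover have "x \<noteq> 0" using x(2) f0 two_le by (intro notI) simp
  ultimately show "\<exists>x. x > 0 \<and> ?f x = 1" by (intro exI[of _ x]) simp
next
  let ?f = "\<lambda>x. \<Sum>i<n. k i / (x + k i)"
  have k0: "0 < k i" if "i < n" for i using k_ge_1[OF that] by linarith
  have less: "?f y < ?f x" if "0 < x" "x < y" for x y
  proof (rule sum_strict_mono)
    show "{..<n} \<noteq> {}" using two_le by (auto simp: lessThan_empty_iff)
    show "k i / (y + k i) < k i / (x + k i)" if "i \<in> {..<n}" for i
      using that k0[of i] \<open>0 < x\<close> \<open>x < y\<close>
      by (intro divide_strict_left_mono mult_pos_pos add_pos_pos) simp_all
  qed simp
  fix x y assume "x > 0 \<and> ?f x = 1" "y > 0 \<and> ?f y = 1"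
  then have "\<not> x < y" "\<not> y < x" using less[of x y] less[of y x] by linarith+
  then show "x = y" by linarith
qed

lemma rho_pos: "0 < \<rho>" and sum_rho: "(\<Sum>i<n. k i / (\<rho> + k i)) = 1"
  using theI'[OF rho_exists] by (auto simp: rho_def)

lemma rho_k_pos: "0 < \<rho> + k i"
  using rho_pos by (simp add: add_pos_nonneg)

text \<open>If \<rho> \<le> 1, every summand is at least 1 / 2, so there are only two factors; a
  factor with two or more letters then contributes at least 2 / 3, which is too much.\<close>

lemma rho_gt_1:
  assumes "\<not> (n = 2 \<and> (\<forall>i<2. card (letters_at G i) = 1))"
  shows "1 < \<rho>"
proof (rule ccontr)
  assume r: "\<not> 1 < \<rho>"
  have k1: "1 \<le> k i" if "i < n" for i by (rule k_ge_1[OF that])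
  have ge: "c / (1 + c) \<le> k i / (\<rho> + k i)" if "i < n" "0 \<le> c" "c \<le> k i" for i c
  proof -
    have "c * (\<rho> + k i) \<le> c * (1 + k i)" using r that by (intro mult_left_mono) auto
    then have "c * (\<rho> + k i) \<le> k i * (1 + c)" using that by (simp add: algebra_simps)
    then show ?thesis using rho_k_pos[of i] that by (simp add: field_simps)
  qed
  have half: "1 / 2 \<le> k i / (\<rho> + k i)" if "i < n" for i
    using ge[OF that _ k1[OF that]] by simp
  have "real n * (1 / 2) \<le> 1"
    using sum_bounded_below[of "{..<n}" "1 / 2" "\<lambda>i. k i / (\<rho> + k i)"] half sum_rho by simp
  then have n: "n = 2" using two_le by simp
  then obtain i where i: "i < 2" "card (letters_at G i) \<noteq> 1" using assms by auto
  with k1[of i] n have "2 \<le> k i" by auto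
  then have "2 / 3 \<le> k i / (\<rho> + k i)" using ge[of i 2] i n by simp
  moreover have "1 / 2 \<le> k (1 - i) / (\<rho> + k (1 - i))" using half[of "1 - i"] i n by simp
  moreover have "k i / (\<rho> + k i) + k (1 - i) / (\<rho> + k (1 - i)) = 1"
  proof -
    have "{..<2::nat} = {i, 1 - i}" "i \<noteq> 1 - i" using i(1) by (auto simp: less_2_cases_iff)
    then show ?thesis using sum_rho n by simp
  qed
  ultimately show False by simp
qed

definition ext :: "(nat \<times> 'a) list \<Rightarrow> (nat \<times> 'a) set" where
  "ext u = {a \<in> A. u \<noteq> [] \<longrightarrow> fst (last u) \<noteq> fst a}"

lemma finite_ext [simp]: "finite (ext u)"
  by (simp add: ext_def)

lemma ext_Nil: "ext [] = A"
  by (simp add: ext_def)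

lemma ext_snoc: "b \<in> A \<Longrightarrow> ext (v @ [b]) = A - letters_at G (fst b)"
  by (auto simp: ext_def letters_iff letters_at_iff)

lemma sum_words_Suc:
  "(\<Sum>x\<in>{x\<in>L. length x = Suc m}. F x) = (\<Sum>u\<in>{u\<in>L. length u = m}. \<Sum>a\<in>ext u. F (u @ [a]))"
proof -
  have "bij_betw (\<lambda>(u, a). u @ [a]) (Sigma {u\<in>L. length u = m} ext) {x\<in>L. length x = Suc m}"
  proof (rule bij_betw_imageI)
    show "inj_on (\<lambda>(u, a). u @ [a]) (Sigma {u\<in>L. length u = m} ext)" by (auto simp: inj_on_def)
    show "(\<lambda>(u, a). u @ [a]) ` Sigma {u\<in>L. length u = m} ext = {x\<in>L. length x = Suc m}"
    proof (rule equalityI; rule subsetI)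
      fix x assume x: "x \<in> {x\<in>L. length x = Suc m}"
      then obtain u a where ua: "x = u @ [a]" by (cases x rule: rev_cases) auto
      have "(u, a) \<in> Sigma {u\<in>L. length u = m} ext" using x ua by (simp add: snoc_in_L ext_def)
      then show "x \<in> (\<lambda>(u, a). u @ [a]) ` Sigma {u\<in>L. length u = m} ext"
        unfolding ua by (rule rev_image_eqI) simp
    qed (auto simp: snoc_in_L ext_def)
  qed
  from sum.reindex_bij_betw[OF this, of F]
  have "(\<Sum>x\<in>{x\<in>L. length x = Suc m}. F x) = (\<Sum>p\<in>Sigma {u\<in>L. length u = m} ext. F (fst p @ [snd p]))"
    by (simp add: case_prod_beta')
  also have "\<dots> = (\<Sum>u\<in>{u\<in>L. length u = m}. \<Sum>a\<in>ext u. F (u @ [a]))"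
    using finite_L_length[of m] by (simp add: sum.Sigma case_prod_beta')
  finally show ?thesis .
qed

lemma sum_diff_letters_at:
  assumes "j < n"
  shows "(\<Sum>a\<in>A - letters_at G j. F (fst a)) = (\<Sum>i<n. k i * F i) - k j * F j"
proof -
  have "(\<Sum>a\<in>A. F (fst a)) = (\<Sum>a\<in>A - letters_at G j. F (fst a)) + (\<Sum>a\<in>letters_at G j. F (fst a))"
    by (rule sum.subset_diff) (simp_all add: letters_at_subset assms)
  moreover have "(\<Sum>a\<in>letters_at G j. F (fst a)) = (\<Sum>a\<in>letters_at G j. F j)"
    by (rule sum.cong) (auto simp: letters_at_iff)
  ultimately show ?thesis by (simp add: sum_letters_fst)
qed

text \<open>The equation for \<rho> with the terms of one factor taken out, read as an eigenvector
  equation.\<close>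

lemma sum_rho_diff:
  assumes "j < n"
  shows "(\<Sum>a\<in>A - letters_at G j. 1 / (\<rho> + k (fst a))) = \<rho> / (\<rho> + k j)"
proof -
  have "(\<Sum>i<n. k i * (1 / (\<rho> + k i))) = 1" using sum_rho by simp
  then have "(\<Sum>a\<in>A - letters_at G j. 1 / (\<rho> + k (fst a))) = 1 - k j * (1 / (\<rho> + k j))"
    using sum_diff_letters_at[OF assms, of "\<lambda>i. 1 / (\<rho> + k i)"] by simp
  also have "\<dots> = \<rho> / (\<rho> + k j)" using rho_k_pos[of j] by (simp add: field_simps)
  finally show ?thesis .
qed

text \<open>This is \<kappa>, which turns out to be the harmonic measure of the cylinder of
  \<open>u\<close>. The empty word has no last letter, and its cylinder is the whole space.\<close>

definition harmonic_weight :: "(nat \<times> 'a) list \<Rightarrow> real" where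
  "harmonic_weight u = (if u = [] then 1 else 1 / \<rho> ^ (length u - 1) * (1 / (\<rho> + k (fst (last u)))))"

lemma harmonic_weight_snoc: "harmonic_weight (u @ [a]) = 1 / \<rho> ^ length u * (1 / (\<rho> + k (fst a)))"
  by (simp add: harmonic_weight_def)

lemma harmonic_weight_extend:
  assumes "u \<in> L" shows "(\<Sum>a\<in>ext u. harmonic_weight (u @ [a])) = harmonic_weight u"
proof (cases u rule: rev_cases)
  case Nil
  have "(\<Sum>a\<in>A. 1 / (\<rho> + k (fst a))) = 1"
    using sum_letters_fst[of "\<lambda>i. 1 / (\<rho> + k i)"] sum_rho by simp
  then show ?thesis using Nil by (simp add: ext_Nil harmonic_weight_def)
next
  case (snoc v b)
  then have b: "b \<in> A" "fst b < n" using assms by (auto simp: snoc_in_L letters_iff)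
  have "(\<Sum>a\<in>ext u. harmonic_weight (u @ [a])) = 1 / \<rho> ^ length u * (\<Sum>a\<in>A - letters_at G (fst b). 1 / (\<rho> + k (fst a)))"
    unfolding harmonic_weight_snoc sum_distrib_left snoc ext_snoc[OF b(1)] ..
  also have "\<dots> = harmonic_weight u" unfolding sum_rho_diff[OF b(2)]
    using rho_pos by (simp add: snoc harmonic_weight_snoc)
  finally show ?thesis .
qed

lemma sum_harmonic_weight: "(\<Sum>x\<in>{x\<in>L. length x = m}. harmonic_weight x) = 1"
proof (induction m)
  case 0
  have "{x\<in>L. length x = 0} = {[]}" by auto
  then show ?case by (simp add: harmonic_weight_def)
next
  case (Suc m)
  then show ?case unfolding sum_words_Suc by (simp add: harmonic_weight_extend)
qed

lemma harmonic_weight_bounds: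
  assumes "u \<in> L"
  shows "\<rho> / (\<rho> + K) / \<rho> ^ length u \<le> harmonic_weight u" "harmonic_weight u \<le> 1 / \<rho> ^ length u"
proof -
  have K: "0 \<le> K" by (intro sum_nonneg) simp
  have "\<rho> / (\<rho> + K) / \<rho> ^ length u \<le> harmonic_weight u \<and> harmonic_weight u \<le> 1 / \<rho> ^ length u"
  proof (cases u rule: rev_cases)
    case Nil
    then show ?thesis using rho_pos K by (simp add: harmonic_weight_def)
  next
    case (snoc v b)
    then have "fst b < n" using assms by (auto simp: snoc_in_L letters_iff)
    then have "\<rho> \<le> \<rho> + k (fst b)" "\<rho> + k (fst b) \<le> \<rho> + K" using k_le_K by auto
    then have "1 / (\<rho> + K) \<le> 1 / (\<rho> + k (fst b))" "1 / (\<rho> + k (fst b)) \<le> 1 / \<rho>"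
      using rho_pos rho_k_pos[of "fst b"] by (auto intro!: divide_left_mono)
    then have "1 / \<rho> ^ length v * (1 / (\<rho> + K)) \<le> 1 / \<rho> ^ length v * (1 / (\<rho> + k (fst b)))"
      "1 / \<rho> ^ length v * (1 / (\<rho> + k (fst b))) \<le> 1 / \<rho> ^ length v * (1 / \<rho>)"
      using rho_pos by (intro mult_left_mono; simp)+
    then show ?thesis using rho_pos by (simp add: snoc harmonic_weight_snoc mult_ac)
  qed
  then show "\<rho> / (\<rho> + K) / \<rho> ^ length u \<le> harmonic_weight u" "harmonic_weight u \<le> 1 / \<rho> ^ length u" by auto
qed

lemma harmonic_weight_pos: "0 < harmonic_weight u"
  using rho_pos rho_k_pos by (simp add: harmonic_weight_def)

text \<open>Words of length m have weights comparable to \<rho>^(-m) and total weight 1, so their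
  number is \<rho>^m up to a constant factor.\<close>

lemma volume_eq: "volume n G = ln \<rho>"
proof -
  define N where "N m = real (card {g \<in> L. length g = m})" for m
  have K: "0 \<le> K" by (intro sum_nonneg) simp
  define C where "C = (\<rho> + K) / \<rho>"
  have C: "0 < C" using rho_pos K by (simp add: C_def add_pos_nonneg)
  have up: "N m \<le> C * \<rho> ^ m" for m
  proof -
    have "(\<Sum>x\<in>{x\<in>L. length x = m}. \<rho> / (\<rho> + K) / \<rho> ^ m) \<le> 1"
      unfolding sum_harmonic_weight[of m, symmetric] by (intro sum_mono) (use harmonic_weight_bounds(1) in auto)
    then show ?thesis using rho_pos K by (simp add: N_def C_def field_simps add_pos_nonneg)
  qed
  have low: "\<rho> ^ m \<le> N m" for m
  proof -
    have "(\<Sum>x\<in>{x\<in>L. length x = m}. harmonic_weight x) \<le> (\<Sum>x\<in>{x\<in>L. length x = m}. 1 / \<rho> ^ m)"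
      by (intro sum_mono) (use harmonic_weight_bounds(2) in auto)
    then have "1 \<le> (\<Sum>x\<in>{x\<in>L. length x = m}. 1 / \<rho> ^ m)"
      by (simp only: sum_harmonic_weight)
    then show ?thesis using rho_pos by (simp add: N_def field_simps)
  qed
  have "(\<lambda>m. ln (N m) / real m) \<longlonglongrightarrow> ln \<rho>"
  proof (rule tendsto_sandwich)
    show "\<forall>\<^sub>F m in sequentially. ln \<rho> \<le> ln (N m) / real m"
      using eventually_gt_at_top[of 0]
    proof eventually_elim
      case (elim m)
      have "real m * ln \<rho> = ln (\<rho> ^ m)" using rho_pos by (simp add: ln_realpow)
      also have "\<dots> \<le> ln (N m)" using low[of m] rho_pos by (intro ln_mono) (auto intro: less_le_trans)
      finally show ?case using elim by (simp add: field_simps)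
    qed
    show "\<forall>\<^sub>F m in sequentially. ln (N m) / real m \<le> ln C / real m + ln \<rho>"
      using eventually_gt_at_top[of 0]
    proof eventually_elim
      case (elim m)
      have "0 < \<rho> ^ m" using rho_pos by simp
      then have "0 < N m" using low[of m] by linarith
      then have "ln (N m) \<le> ln (C * \<rho> ^ m)" using up[of m] by (intro ln_mono)
      also have "\<dots> = ln C + real m * ln \<rho>" using rho_pos C by (simp add: ln_mult_pos ln_realpow)
      finally show ?case using elim by (simp add: field_simps)
    qed
    have "(\<lambda>m. ln C / real m + ln \<rho>) \<longlonglongrightarrow> 0 + ln \<rho>"
      by (intro tendsto_add lim_const_over_n tendsto_const)
    then show "(\<lambda>m. ln C / real m + ln \<rho>) \<longlonglongrightarrow> ln \<rho>" by simp
  qed simp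
  then show ?thesis by (simp add: volume_def N_def limI)
qed

end

context free_product_walk
begin

text \<open>Gibbs' inequality against the law that is uniform in the length and given by the harmonic
  weights on each sphere.\<close>

lemma pmf_entropy_walk_le:
  assumes "1 \<le> \<rho>"
  shows "pmf_entropy (W m) \<le> ln (real m + 1) + mean_length m * ln \<rho> + ln ((\<rho> + K) / \<rho>)"
proof -
  have K: "0 \<le> K" by (intro sum_nonneg) simp
  let ?q = "\<lambda>x. harmonic_weight x / (real m + 1)"
  have sub: "set_pmf (W m) \<subseteq> (\<Union>j\<in>{..m}. {x\<in>L. length x = j})" by (auto dest: set_walk_law)
  have "(\<Sum>x\<in>set_pmf (W m). ?q x) \<le> (\<Sum>x\<in>(\<Union>j\<in>{..m}. {x\<in>L. length x = j}). ?q x)"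
    using finite_L_length sub by (intro sum_mono2) (auto simp: less_imp_le[OF harmonic_weight_pos])
  also have "\<dots> = (\<Sum>j\<in>{..m}. \<Sum>x\<in>{x\<in>L. length x = j}. ?q x)"
    using finite_L_length by (intro sum.UNION_disjoint) auto
  also have "\<dots> = 1" by (simp add: sum_divide_distrib[symmetric] sum_harmonic_weight)
  finally have "(\<Sum>x\<in>set_pmf (W m). ?q x) \<le> 1" .
  then have "pmf_entropy (W m) \<le> expect (W m) (\<lambda>x. - ln (?q x))"
    using harmonic_weight_pos by (intro gibbs_inequality) auto
  also have "\<dots> \<le> expect (W m) (\<lambda>x. (ln (real m + 1) + ln ((\<rho> + K) / \<rho>)) + real (length x) * ln \<rho>)"
  proof (intro expect_mono)
    fix x assume "x \<in> set_pmf (W m)"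
    then have x: "x \<in> L" by (auto dest: set_walk_law)
    have "ln (\<rho> / (\<rho> + K) / \<rho> ^ length x) \<le> ln (harmonic_weight x)"
      using harmonic_weight_bounds(1)[OF x] rho_pos K by (intro ln_mono) (auto intro!: divide_pos_pos add_pos_nonneg)
    moreover have "ln (\<rho> / (\<rho> + K) / \<rho> ^ length x) = - ln ((\<rho> + K) / \<rho>) - real (length x) * ln \<rho>"
      using rho_pos add_pos_nonneg[OF rho_pos K] by (simp add: ln_div ln_mult_pos ln_realpow)
    moreover have "ln (?q x) = ln (harmonic_weight x) - ln (real m + 1)" using harmonic_weight_pos[of x] by (simp add: ln_div)
    ultimately show "- ln (?q x) \<le> (ln (real m + 1) + ln ((\<rho> + K) / \<rho>)) + real (length x) * ln \<rho>" by simp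
  qed simp
  also have "\<dots> = ln (real m + 1) + mean_length m * ln \<rho> + ln ((\<rho> + K) / \<rho>)"
    by (simp add: expect_add mean_length_def)
  finally show ?thesis .
qed

end

context transient_walk
begin

lemma walk_entropy_le:
  assumes "1 \<le> \<rho>"
  shows "walk_entropy n G \<mu> \<le> drift n G \<mu> * ln \<rho>"
proof -
  \<comment> \<open>The term ln 2 pays for replacing ln (m + 1) by ln m.\<close>
  let ?C = "ln 2 + ln ((\<rho> + K) / \<rho>)"
  have "(\<lambda>m. ln (real m) / real m + (mean_length m / real m) * ln \<rho> + ?C / real m) \<longlonglongrightarrow> 0 + drift n G \<mu> * ln \<rho> + 0"
    by (intro tendsto_add lim_const_over_n lim_ln_over_n tendsto_mult tendsto_const drift_props(1))
  then have lim: "(\<lambda>m. ln (real m) / real m + (mean_length m / real m) * ln \<rho> + ?C / real m) \<longlonglongrightarrow> drift n G \<mu> * ln \<rho>"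
    by simp
  show ?thesis
  proof (rule LIMSEQ_le[OF walk_entropy_lim lim], intro exI[of _ 1] allI impI)
    fix m :: nat assume m: "1 \<le> m"
    then have "ln (real m + 1) \<le> ln (2 * real m)" by (intro ln_mono) auto
    also have "\<dots> = ln 2 + ln (real m)" using m by (simp add: ln_mult_pos)
    finally have "pmf_entropy (W m) \<le> ln (real m) + mean_length m * ln \<rho> + ?C"
      using pmf_entropy_walk_le[OF assms, of m] by simp
    then have "pmf_entropy (W m) / real m \<le> (ln (real m) + mean_length m * ln \<rho> + ?C) / real m"
      by (rule divide_right_mono) simp
    then show "pmf_entropy (W m) / real m \<le> ln (real m) / real m + (mean_length m / real m) * ln \<rho> + ?C / real m"
      by (simp add: add_divide_distrib)
  qed
qed

end

section \<open>The walk driven by the distinguished measure\<close>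

locale extremal_walk = finite_free_product n G
  for n and G :: "nat \<Rightarrow> ('a, 'b) monoid_scheme" +
  assumes not_dihedral: "\<not> (n = 2 \<and> (\<forall>i<2. card (letters_at G i) = 1))"
begin

abbreviation \<mu> where "\<mu> \<equiv> extremal_pmf n G"

lemma rho1: "1 < \<rho>"
  by (rule rho_gt_1[OF not_dihedral])

text \<open>The mass k / (\<rho> + k) of a factor is shared equally by its k letters, so the step
  law is the eigenvector itself.\<close>

lemma pmf_extremal: "pmf \<mu> a = (if a \<in> A then 1 / (\<rho> + k (fst a)) else 0)"
proof -
  define f where "f a = (\<Sum>i<n. k i / (\<rho> + k i) * pmf (pmf_of_set (letters_at G i)) a)" for a
  have c0: "0 \<le> k i / (\<rho> + k i)" for i using rho_k_pos[of i] by simp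
  have f0: "0 \<le> f a" for a unfolding f_def by (intro sum_nonneg mult_nonneg_nonneg c0) simp
  have "(\<integral>\<^sup>+a. ennreal (f a) \<partial>count_space UNIV)
    = (\<integral>\<^sup>+a. (\<Sum>i<n. ennreal (k i / (\<rho> + k i)) * ennreal (pmf (pmf_of_set (letters_at G i)) a)) \<partial>count_space UNIV)"
  proof (rule nn_integral_cong)
    fix a
    have "ennreal (f a) = (\<Sum>i<n. ennreal (k i / (\<rho> + k i) * pmf (pmf_of_set (letters_at G i)) a))"
      unfolding f_def by (rule sum_ennreal[symmetric]) (rule mult_nonneg_nonneg[OF c0 pmf_nonneg])
    then show "ennreal (f a) = (\<Sum>i<n. ennreal (k i / (\<rho> + k i)) * ennreal (pmf (pmf_of_set (letters_at G i)) a))"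
      by (simp only: ennreal_mult[OF c0 pmf_nonneg])
  qed
  also have "\<dots> = (\<Sum>i<n. ennreal (k i / (\<rho> + k i)))"
    by (subst nn_integral_sum) (simp_all add: nn_integral_cmult nn_integral_pmf_eq_1)
  also have "\<dots> = 1" using c0 sum_rho by (simp add: sum_ennreal)
  finally have "(\<integral>\<^sup>+a. ennreal (f a) \<partial>count_space UNIV) = 1" .
  then have pmf: "pmf \<mu> a = f a" for a
    unfolding extremal_pmf_def f_def[symmetric] using f0 by (subst pmf_embed_pmf) auto
  have p: "pmf (pmf_of_set (letters_at G i)) a = (if a \<in> letters_at G i then 1 / k i else 0)" if "i < n" for i a
    using letters_at_nonempty[OF that] finite_letters_at[OF that] by (simp add: indicator_def)
  have "f a = (\<Sum>i<n. if i = fst a then if a \<in> letters_at G i then 1 / (\<rho> + k i) else 0 else 0)"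
    unfolding f_def using k_ge_1 by (intro sum.cong) (force simp: p letters_at_iff)+
  also have "\<dots> = (if a \<in> A then 1 / (\<rho> + k (fst a)) else 0)"
    by (auto simp: sum.delta letters_iff)
  finally show ?thesis by (simp add: pmf)
qed

text \<open>By \<open>sum_rho_diff\<close> the condition of the locale holds with equality: both
  sides are (1 - 1 / \<rho>) / (\<rho> + k).\<close>

sublocale transient_walk n G \<mu> "\<lambda>_. 1 / \<rho>" "1 / \<rho>"
proof
  show "set_pmf \<mu> \<subseteq> A" by (auto simp: set_pmf_iff pmf_extremal split: if_splits)
  show "0 < 1 / \<rho> \<and> 1 / \<rho> \<le> 1 / \<rho>" "1 / \<rho> < 1" using rho1 by auto
  fix b assume b: "b \<in> A"
  then have "fst b < n" by (simp add: letters_iff)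
  have "(\<Sum>a\<in>A - letters_at G (fst b). pmf \<mu> a * (1 - 1 / \<rho>)) = (\<Sum>a\<in>A - letters_at G (fst b). 1 / (\<rho> + k (fst a))) * (1 - 1 / \<rho>)"
    unfolding sum_distrib_right by (rule sum.cong) (auto simp: pmf_extremal)
  then show "pmf \<mu> (linv b) * (1 - 1 / \<rho>) \<le> 1 / \<rho> * (\<Sum>a\<in>A - letters_at G (fst b). pmf \<mu> a * (1 - 1 / \<rho>))"
    using linv_props(1)[OF b] rho1 by (simp add: sum_rho_diff[OF \<open>fst b < n\<close>] pmf_extremal)
qed

lemma walk_entropy_ge: "drift n G \<mu> * ln \<rho> \<le> walk_entropy n G \<mu>"
proof (rule LIMSEQ_le[OF tendsto_mult[OF drift_props(1) tendsto_const] walk_entropy_lim], intro exI[of _ 1] allI impI)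
  fix m :: nat
  have "mean_length m * ln \<rho> = expect (W m) (\<lambda>x. real (length x) * ln \<rho>)"
    by (simp add: mean_length_def)
  also have "\<dots> \<le> expect (W m) (\<lambda>x. - ln (pmf (W m) x))"
  proof (rule expect_mono)
    fix x assume x: "x \<in> set_pmf (W m)"
    then have "x \<in> L" by (auto dest: set_walk_law)
    have "pmf (W m) x = measure_pmf.prob (W m) {x}" by (simp add: measure_pmf_single)
    also have "\<dots> \<le> measure_pmf.prob (W m) {y. prefix x y}"
      by (intro measure_pmf.finite_measure_mono) auto
    also have "\<dots> \<le> (1 / \<rho>) ^ length x" by (rule prob_prefix_le[OF \<open>x \<in> L\<close>])
    finally have "ln (pmf (W m) x) \<le> ln ((1 / \<rho>) ^ length x)"
      using pmf_positive[OF x] by (intro ln_mono)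
    also have "\<dots> = - (real (length x) * ln \<rho>)" using rho_pos by (simp add: ln_realpow ln_div)
    finally show "real (length x) * ln \<rho> \<le> - ln (pmf (W m) x)" by simp
  qed simp
  also have "\<dots> = pmf_entropy (W m)" by (simp add: pmf_entropy_expect)
  finally show "mean_length m / real m * ln \<rho> \<le> pmf_entropy (W m) / real m"
    by (simp add: divide_right_mono)
qed

lemma walk_entropy_eq: "walk_entropy n G \<mu> = drift n G \<mu> * ln \<rho>"
  using walk_entropy_le walk_entropy_ge rho1 by (simp add: antisym)

text \<open>At a word ending in factor i the mean change of length is (\<rho> - 1) / (\<rho> + k i),
  and at the identity it is 1; \<delta> bounds all of these from below.\<close>

lemma drift_pos: "0 < drift n G \<mu>"
proof -
  define \<delta> where "\<delta> = (\<rho> - 1) / (\<rho> + K)"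
  have K: "0 \<le> K" by (intro sum_nonneg) simp
  have \<delta>: "0 < \<delta>" "\<delta> \<le> 1" using rho1 K by (auto simp: \<delta>_def divide_le_eq)
  have step: "real (length g) + \<delta> \<le> expect \<mu> (\<lambda>a. real (length (g \<cdot> [a])))" if g: "g \<in> L" for g
  proof (cases g rule: rev_cases)
    case Nil
    have "expect \<mu> (\<lambda>a. real (length ([] \<cdot> [a]))) = expect \<mu> (\<lambda>a. 1)" by simp
    then show ?thesis using Nil \<delta> by simp
  next
    case (snoc v b)
    then have vb: "v @ [b] \<in> L" and b: "b \<in> A" "fst b < n" using g by (auto simp: snoc_in_L letters_iff)
    let ?i = "fst b" and ?l = "real (length g)"
    have lb: "linv b \<in> letters_at G ?i" "pmf \<mu> (linv b) = 1 / (\<rho> + k ?i)"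
      using linv_props(1)[OF b(1)] by (simp_all add: letters_iff pmf_extremal)
    define S where "S = (\<Sum>a\<in>A - letters_at G ?i. pmf \<mu> a)"
    define R where "R = (\<Sum>a\<in>letters_at G ?i - {linv b}. pmf \<mu> a)"
    have S: "S = \<rho> / (\<rho> + k ?i)"
      unfolding S_def sum_rho_diff[OF b(2), symmetric] by (rule sum.cong) (auto simp: pmf_extremal)
    have "1 = S + (\<Sum>a\<in>letters_at G ?i. pmf \<mu> a)"
      unfolding S_def sum_mu[symmetric] by (rule sum.subset_diff) (simp_all add: b letters_at_subset)
    also have "(\<Sum>a\<in>letters_at G ?i. pmf \<mu> a) = pmf \<mu> (linv b) + R"
      unfolding R_def using lb b by (subst sum.remove[of _ "linv b"]) (auto simp: finite_letters_at)
    finally have R: "R = 1 - S - pmf \<mu> (linv b)" by simp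
    have "expect \<mu> (\<lambda>a. real (length (g \<cdot> [a]))) = S * (?l + 1) + pmf \<mu> (linv b) * (?l - 1) + R * ?l"
      unfolding expect_mu snoc sum_step[OF vb, of "pmf \<mu>" "\<lambda>x. real (length x)"] S_def R_def
      by (simp add: sum_distrib_right[symmetric])
    also have "\<dots> = ?l + (S - pmf \<mu> (linv b))" unfolding R by (simp add: algebra_simps)
    also have "S - pmf \<mu> (linv b) = (\<rho> - 1) / (\<rho> + k ?i)" unfolding S lb by (simp add: diff_divide_distrib)
    finally have eq: "expect \<mu> (\<lambda>a. real (length (g \<cdot> [a]))) = ?l + (\<rho> - 1) / (\<rho> + k ?i)" .
    have "\<delta> \<le> (\<rho> - 1) / (\<rho> + k ?i)"
      unfolding \<delta>_def using rho1 k_le_K[OF b(2)] rho_k_pos[of ?i] by (intro divide_left_mono) (auto intro!: mult_pos_pos)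
    with eq show ?thesis by simp
  qed
  have mean: "real m * \<delta> \<le> mean_length m" for m
  proof (induction m)
    case (Suc m)
    have "mean_length m + \<delta> = expect (W m) (\<lambda>g. real (length g) + \<delta>)" by (simp add: mean_length_def expect_add)
    also have "\<dots> \<le> mean_length (Suc m)"
      unfolding mean_length_def expect_walk_law_Suc using step by (intro expect_mono) (auto dest: set_walk_law)
    finally show ?case using Suc by (simp add: algebra_simps)
  qed (simp add: mean_length_nonneg)
  have "\<delta> \<le> drift n G \<mu>"
  proof (rule LIMSEQ_le_const[OF drift_props(1)], intro exI[of _ 1] allI impI)
    fix m :: nat assume "1 \<le> m"
    then show "\<delta> \<le> mean_length m / real m" using mean[of m] by (simp add: field_simps)
  qed
  with \<delta> show ?thesis by simp
qed

lemma quotient_eq_1: "walk_entropy n G \<mu> / (drift n G \<mu> * volume n G) = 1"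
  using drift_pos rho1 by (simp add: walk_entropy_eq volume_eq)

lemma generating_extremal: "generating n G \<mu>"
  unfolding generating_def carrier_free_product
proof (intro equalityI subsetI)
  fix u assume "u \<in> (\<Union>m\<in>{1..}. set_pmf (W m))"
  then show "u \<in> L" by (auto dest: set_walk_law)
next
  have set: "set_pmf \<mu> = A" using rho_k_pos by (auto simp: set_pmf_iff pmf_extremal less_imp_neq[symmetric] split: if_splits)
  have step: "g \<cdot> [a] \<in> set_pmf (W (Suc m))" if "g \<in> set_pmf (W m)" "a \<in> set_pmf \<mu>" for g a m
    using that by (auto simp: walk_law_Suc)
  have word: "u \<in> set_pmf (W (length u))" if "u \<in> L" for u
    using that
  proof (induction u rule: rev_induct)
    case (snoc a u)
    then have "u \<in> set_pmf (W (length u))" "a \<in> set_pmf \<mu>" "u @ [a] = u \<cdot> [a]"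
      by (simp_all add: snoc_in_L set mul_append)
    then have "u @ [a] \<in> set_pmf (W (Suc (length u)))" using step by metis
    then show ?case by simp
  qed simp
  fix u assume u: "u \<in> L"
  show "u \<in> (\<Union>m\<in>{1..}. set_pmf (W m))"
  proof (cases "u = []")
    case False
    then show ?thesis using word[OF u] by (intro UN_I[of "length u"]) (auto simp: Suc_le_eq)
  next
    case True
    \<comment> \<open>Time 0 is excluded from \<open>generating\<close>, so the identity has to be
      reached by a letter followed by its inverse.\<close>
    obtain a where a: "a \<in> A" using letters_nonempty by auto
    have "[a] \<in> set_pmf (W (length [a]))" using a by (intro word) (simp add: Cons_in_L)
    moreover have "linv a \<in> set_pmf \<mu>" using linv_props(1)[OF a] set by simp
    moreover have "[] = [a] \<cdot> [linv a]"
      using mul_letter_same[of "[]" a "linv a"] a linv_props(1)[OF a] by (simp add: Cons_in_L)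
    ultimately have "[] \<in> set_pmf (W (Suc (length [a])))" using step by metis
    then show ?thesis using True by (intro UN_I[of "Suc (length [a])"]) auto
  qed
qed

lemma extremal: "extremal n G"
  unfolding extremal_def extremality_quotient_def
proof (rule antisym)
  show "(SUP \<mu>\<in>{\<mu>. set_pmf \<mu> \<subseteq> A \<and> (\<forall>a\<in>A. pmf \<mu> a = pmf \<mu> (linv a)) \<and> generating n G \<mu>}.
    ereal (walk_entropy n G \<mu> / (drift n G \<mu> * volume n G))) \<le> 1"
  proof (rule SUP_least)
    fix \<nu> assume "\<nu> \<in> {\<mu>. set_pmf \<mu> \<subseteq> A \<and> (\<forall>a\<in>A. pmf \<mu> a = pmf \<mu> (linv a)) \<and> generating n G \<mu>}"
    then have \<nu>: "set_pmf \<nu> \<subseteq> A" "\<And>a. a \<in> A \<Longrightarrow> pmf \<nu> a = pmf \<nu> (linv a)" "generating n G \<nu>" by auto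
    interpret N: free_product_walk n G \<nu> by standard (rule \<nu>(1))
    obtain z \<zeta> where "transient_walk n G \<nu> z \<zeta>"
      using N.exists_superharmonic_weights[OF \<nu>(3,2) not_dihedral] by blast
    then interpret N: transient_walk n G \<nu> z \<zeta> .
    have h: "walk_entropy n G \<nu> \<le> drift n G \<nu> * ln \<rho>" "0 \<le> drift n G \<nu>"
      using N.walk_entropy_le N.drift_props(2) rho1 by auto
    have "walk_entropy n G \<nu> / (drift n G \<nu> * volume n G) \<le> 1"
    \<comment> \<open>Should the drift vanish, the quotient is a division by zero, which is
      0.\<close>
    proof (cases "drift n G \<nu> = 0")
      case False
      then have "0 < drift n G \<nu> * ln \<rho>" using h(2) rho1 by simp
      then show ?thesis using h(1) by (simp add: volume_eq divide_le_eq)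
    qed simp
    then show "ereal (walk_entropy n G \<nu> / (drift n G \<nu> * volume n G)) \<le> 1" by simp
  qed
  have "ereal (walk_entropy n G \<mu> / (drift n G \<mu> * volume n G)) = 1" by (simp add: quotient_eq_1)
  moreover have "\<mu> \<in> {\<mu>. set_pmf \<mu> \<subseteq> A \<and> (\<forall>a\<in>A. pmf \<mu> a = pmf \<mu> (linv a)) \<and> generating n G \<mu>}"
    using set_mu generating_extremal linv_props(1) by (auto simp: pmf_extremal)
  ultimately show "1 \<le> (SUP \<mu>\<in>{\<mu>. set_pmf \<mu> \<subseteq> A \<and> (\<forall>a\<in>A. pmf \<mu> a = pmf \<mu> (linv a)) \<and> generating n G \<mu>}.
    ereal (walk_entropy n G \<mu> / (drift n G \<mu> * volume n G)))"
    by (metis (no_types, lifting) SUP_upper)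
qed

end

section \<open>The harmonic measure\<close>

context finite_free_product
begin

abbreviation Linf :: "(nat \<times> 'a) stream set" where "Linf \<equiv> infinite_words n G"
abbreviation N :: "(nat \<times> 'a) stream measure" where "N \<equiv> infinite_words_space n G"
definition C :: "(nat \<times> 'a) list \<Rightarrow> (nat \<times> 'a) stream set" where "C u = cylinder A u \<inter> Linf"

lemma L_inf_subset: "Linf \<subseteq> streams A"
  by (auto simp: infinite_words_def)

lemma stake_in_L: "s \<in> Linf \<Longrightarrow> stake m s \<in> L"
  by (simp add: infinite_words_def)

lemma in_C_iff: "s \<in> C u \<longleftrightarrow> s \<in> Linf \<and> stake (length u) s = u"
  using L_inf_subset by (auto simp: C_def cylinder_def)

lemma C_empty: "u \<notin> L \<Longrightarrow> C u = {}"
  using stake_in_L[of _ "length u"] by (force simp: in_C_iff)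

lemma C_Nil: "C [] = Linf"
  by (auto simp: in_C_iff)

lemma sstart_eq_cylinder: "u \<in> lists A \<Longrightarrow> sstart A u = cylinder A u"
proof (induction u)
  case (Cons a u)
  show ?case
  proof (rule Set.set_eqI)
    fix s show "s \<in> sstart A (a # u) \<longleftrightarrow> s \<in> cylinder A (a # u)"
      using Cons by (cases s) (auto simp: cylinder_def streams_Stream)
  qed
qed (simp add: cylinder_def)

lemma sets_stream_space_letters:
  "sets (stream_space (count_space A)) = sigma_sets (streams A) (sstart A ` lists A \<union> {{}})"
proof -
  have "sstart A ` lists A \<union> {{}} \<subseteq> Pow (streams A)"
    by (simp add: image_subset_iff sstart_in_streams del: in_lists_conv_set)
  then show ?thesis
    unfolding sets_stream_space_sstart[OF countable_finite[OF finite_letters]] by (rule sets_measure_of)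
qed

lemma sstart_in_sets: "u \<in> lists A \<Longrightarrow> sstart A u \<in> sets (stream_space (count_space A))"
  unfolding sets_stream_space_letters by (rule sigma_sets.Basic) blast

lemma L_inf_sets: "Linf \<in> sets (stream_space (count_space A))"
proof -
  have "Linf = (\<Inter>m. \<Union>u\<in>{u\<in>L. length u = m}. sstart A u)"
  proof (intro equalityI subsetI)
    fix s assume s: "s \<in> Linf"
    have "s \<in> sstart A (stake m s)" for m
      using stake_in_L[OF s, of m] L_lists L_inf_subset s
      by (subst sstart_eq_cylinder) (blast, auto simp: cylinder_def)
    then show "s \<in> (\<Inter>m. \<Union>u\<in>{u\<in>L. length u = m}. sstart A u)"
      using stake_in_L[OF s] by (intro INT_I UN_I[of "stake _ s"]) auto
  next
    fix s assume s: "s \<in> (\<Inter>m. \<Union>u\<in>{u\<in>L. length u = m}. sstart A u)"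
    have *: "s \<in> streams A \<and> stake m s \<in> L" for m
    proof -
      obtain u where "u \<in> L" "length u = m" "s \<in> sstart A u" using s by blast
      moreover from this have "u \<in> lists A" using L_lists by blast
      ultimately show ?thesis by (auto simp: sstart_eq_cylinder cylinder_def)
    qed
    then show "s \<in> Linf" by (simp add: infinite_words_def)
  qed
  also have "\<dots> \<in> sets (stream_space (count_space A))"
  proof (intro sets.countable_INT')
    have "(\<Union>u\<in>{u\<in>L. length u = m}. sstart A u) \<in> sets (stream_space (count_space A))" for m
      by (rule sets.finite_UN[OF finite_L_length]) (use L_lists sstart_in_sets in blast)
    then show "range (\<lambda>m. \<Union>u\<in>{u\<in>L. length u = m}. sstart A u) \<subseteq> sets (stream_space (count_space A))"
      by blast
  qed auto
  finally show ?thesis .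
qed

lemma space_N [simp]: "space N = Linf"
  using L_inf_subset by (auto simp: infinite_words_space_def space_restrict_space space_stream_space)

lemma sets_N: "sets N = sigma_sets Linf (C ` L \<union> {{}})"
proof -
  let ?E = "sstart A ` lists A \<union> {{}}"
  have "sets N = (\<inter>) Linf ` sigma_sets (streams A) ?E"
    unfolding infinite_words_space_def sets_restrict_space sets_stream_space_letters ..
  also have "\<dots> = sigma_sets Linf ((\<inter>) Linf ` ?E)"
    by (rule sigma_sets_Int[OF _ L_inf_subset]) (use L_inf_sets in \<open>simp only: sets_stream_space_letters\<close>)
  also have "(\<inter>) Linf ` ?E = C ` L \<union> {{}}"
  proof -
    have "Linf \<inter> sstart A u = C u" if "u \<in> lists A" for u
      using that by (auto simp: sstart_eq_cylinder C_def)
    then have "(\<inter>) Linf ` ?E = C ` lists A \<union> {{}}"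
      by (auto simp: image_Un image_image simp del: in_lists_conv_set)
    also have "\<dots> = C ` L \<union> {{}}"
      using L_lists C_empty by (auto simp del: in_lists_conv_set)
    finally show ?thesis .
  qed
  finally show ?thesis .
qed

lemma C_sets: "C u \<in> sets N"
proof (cases "u \<in> L")
  case True
  then show ?thesis unfolding sets_N by (intro sigma_sets.Basic) simp
qed (simp add: C_empty)

text \<open>Two cylinders that meet are nested.\<close>

lemma C_Int: "C u \<inter> C v \<in> C ` L \<union> {{}}"
proof (cases "C u \<inter> C v = {}")
  case False
  then obtain s where s: "s \<in> C u" "s \<in> C v" by blast
  then have L: "u \<in> L" "v \<in> L" using C_empty by blast+
  have *: "C v \<subseteq> C u" if l: "length u \<le> length v" and s: "s \<in> C u" "s \<in> C v" for u v
  proof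
    fix t assume t: "t \<in> C v"
    have tk: "take (length u) (stake (length v) r) = stake (length u) r" for r :: "(nat \<times> 'a) stream"
      using l by (simp add: take_stake min_def)
    have "stake (length u) t = take (length u) v" using tk[of t] t by (simp add: in_C_iff)
    also have "\<dots> = stake (length u) s" using tk[of s] s(2) by (simp add: in_C_iff)
    also have "\<dots> = u" using s(1) by (simp add: in_C_iff)
    finally show "t \<in> C u" using t by (simp add: in_C_iff)
  qed
  have "C v \<subseteq> C u \<or> C u \<subseteq> C v"
    using *[of u v] *[of v u] s by (cases "length u \<le> length v") auto
  then have "C u \<inter> C v = C v \<or> C u \<inter> C v = C u" by blast
  then show ?thesis using L by auto
qed simp

lemma measure_eq_on_cylinders:
  assumes P: "prob_space P" "sets P = sets N" and Q: "prob_space Q" "sets Q = sets N"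
    and eq: "\<And>u. u \<in> L \<Longrightarrow> measure P (C u) = measure Q (C u)"
  shows "P = Q"
proof -
  interpret P: prob_space P by (rule P(1))
  interpret Q: prob_space Q by (rule Q(1))
  show ?thesis
  proof (rule measure_eqI_generator_eq[where E = "C ` L \<union> {{}}" and \<Omega> = "Linf" and A = "\<lambda>_. Linf"])
    show "Int_stable (C ` L \<union> {{}})" using C_Int by (auto simp: Int_stable_def)
    show "C ` L \<union> {{}} \<subseteq> Pow Linf" by (auto simp: in_C_iff)
    show "emeasure P X = emeasure Q X" if "X \<in> C ` L \<union> {{}}" for X
      using that eq by (auto simp: P.emeasure_eq_measure Q.emeasure_eq_measure)
    show "sets P = sigma_sets Linf (C ` L \<union> {{}})" "sets Q = sigma_sets Linf (C ` L \<union> {{}})"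
      using P(2) Q(2) sets_N by simp_all
    show "range (\<lambda>_::nat. Linf) \<subseteq> C ` L \<union> {{}}" using C_Nil by (auto intro: rev_image_eqI[of "[]"])
  qed auto
qed

text \<open>The last letter may be removed or replaced, hence the strict inequality.\<close>

lemma take_mul_letter:
  assumes "u \<in> L" "a \<in> A" "l < length u" shows "take l (u \<cdot> [a]) = take l u"
  using assms(1,2) by (cases rule: mul_letter_cases) (use assms(3) in auto)

lemma common_prefix_length_ge:
  "l \<le> common_prefix_length u s \<longleftrightarrow> l \<le> length u \<and> take l u = stake l s"
proof -
  let ?S = "{k. k \<le> length u \<and> take k u = stake k s}"
  have fin: "finite ?S" by (rule finite_subset[of _ "{..length u}"]) auto
  have ne: "?S \<noteq> {}" by (auto intro: exI[of _ 0])
  show ?thesis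
  proof
    assume "l \<le> common_prefix_length u s"
    then have l: "l \<le> Max ?S" by (simp add: common_prefix_length_def)
    have "Max ?S \<in> ?S" by (rule Max_in[OF fin ne])
    then have "Max ?S \<le> length u" "take (Max ?S) u = stake (Max ?S) s" by auto
    then have "take l (take (Max ?S) u) = take l (stake (Max ?S) s)" by simp
    then show "l \<le> length u \<and> take l u = stake l s"
      using l \<open>Max ?S \<le> length u\<close> by (simp add: take_stake min_def)
  next
    assume "l \<le> length u \<and> take l u = stake l s"
    then show "l \<le> common_prefix_length u s"
      unfolding common_prefix_length_def by (intro Max_ge[OF fin]) auto
  qed
qed

lemma stream_eq_stakeI:
  assumes "\<And>l. stake l s = stake l t" shows "s = t"
proof -
  have "s !! n = t !! n" for n using assms[of "Suc n"] by (metis stake_nth lessI)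
  then show ?thesis using smap_alt[of id s t] by (simp add: stream.map_id)
qed

end

lemma eventually_sequentially_ex: "\<forall>\<^sub>F m in sequentially. P m \<Longrightarrow> \<exists>m. P m"
  by (rule eventually_happens'[OF sequentially_bot])

context free_product_walk
begin

text \<open>Two limit maps almost surely agree with the walk at a common late time on a prefix of
  any given length, hence with each other.\<close>

lemma is_harmonic_measure_unique:
  assumes "is_harmonic_measure n G \<mu> \<nu>" "is_harmonic_measure n G \<mu> \<nu>'"
  shows "\<nu> = \<nu>'"
proof -
  obtain X where X: "X \<in> \<Omega> \<rightarrow>\<^sub>M N" "\<nu> = distr \<Omega> N X"
    "AE \<omega> in \<Omega>. filterlim (\<lambda>m. common_prefix_length (walk n G \<omega> m) (X \<omega>)) at_top sequentially"
    using assms(1) unfolding is_harmonic_measure_def by blast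
  obtain Y where Y: "Y \<in> \<Omega> \<rightarrow>\<^sub>M N" "\<nu>' = distr \<Omega> N Y"
    "AE \<omega> in \<Omega>. filterlim (\<lambda>m. common_prefix_length (walk n G \<omega> m) (Y \<omega>)) at_top sequentially"
    using assms(2) unfolding is_harmonic_measure_def by blast
  have "AE \<omega> in \<Omega>. X \<omega> = Y \<omega>"
    using X(3) Y(3)
  proof eventually_elim
    case (elim \<omega>)
    show ?case
    proof (rule stream_eq_stakeI)
      fix l
      have "\<forall>\<^sub>F m in sequentially. l \<le> common_prefix_length (walk n G \<omega> m) (X \<omega>)
        \<and> l \<le> common_prefix_length (walk n G \<omega> m) (Y \<omega>)"
        using elim unfolding filterlim_at_top by (intro eventually_conj) blast+
      then obtain m where "l \<le> common_prefix_length (walk n G \<omega> m) (X \<omega>)"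
        "l \<le> common_prefix_length (walk n G \<omega> m) (Y \<omega>)"
        using eventually_sequentially_ex by blast
      then have "take l (walk n G \<omega> m) = stake l (X \<omega>)" "take l (walk n G \<omega> m) = stake l (Y \<omega>)"
        by (simp_all only: common_prefix_length_ge)
      then show "stake l (X \<omega>) = stake l (Y \<omega>)" by simp
    qed
  qed
  then show ?thesis unfolding X(2) Y(2)
    by (rule distr_cong_AE[OF refl refl _ X(1) Y(1)])
qed

section \<open>The limit word of a path whose length tends to infinity\<close>

definition escaping :: "(nat \<times> 'a) stream \<Rightarrow> bool" where
  "escaping \<omega> \<longleftrightarrow> (\<forall>l. \<exists>M. \<forall>m\<ge>M. l < length (cwalk \<omega> m))"

text \<open>The prefix is read at the first time from which on the length stays strictly above
  \<open>l\<close>; at length exactly \<open>l\<close> the next step could still replace its last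
  letter.\<close>

definition stable_prefix :: "nat \<Rightarrow> (nat \<times> 'a) stream \<Rightarrow> (nat \<times> 'a) list" where
  "stable_prefix l \<omega> = take l (cwalk \<omega> (LEAST M. \<forall>m\<ge>M. l < length (cwalk \<omega> m)))"

lemma take_cwalk_stable:
  assumes "\<forall>m\<ge>M. l < length (cwalk \<omega> m)" "M \<le> m"
  shows "take l (cwalk \<omega> m) = take l (cwalk \<omega> M)"
  using assms(2)
proof (induction m rule: dec_induct)
  case (step m)
  then have "take l (cwalk \<omega> m \<cdot> [clip (\<omega> !! m)]) = take l (cwalk \<omega> m)"
    using assms(1) by (intro take_mul_letter) auto
  with step show ?case by simp
qed simp

lemma escaping_stable:
  assumes "escaping \<omega>"
  shows "\<forall>\<^sub>F m in sequentially. l < length (cwalk \<omega> m) \<and> take l (cwalk \<omega> m) = stable_prefix l \<omega>"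
proof -
  define M where "M = (LEAST M. \<forall>m\<ge>M. l < length (cwalk \<omega> m))"
  have M: "\<forall>m\<ge>M. l < length (cwalk \<omega> m)"
    unfolding M_def by (rule LeastI_ex) (use assms in \<open>auto simp: escaping_def\<close>)
  show ?thesis
    using eventually_ge_at_top[of M]
  proof eventually_elim
    case (elim m)
    have "stable_prefix l \<omega> = take l (cwalk \<omega> M)" by (simp only: stable_prefix_def M_def)
    then show ?case using M elim take_cwalk_stable[OF M elim] by metis
  qed
qed

text \<open>Paths that do not escape are sent to a fixed infinite word, so that
  \<open>limit_word\<close> maps into \<open>Linf\<close> everywhere, as measurability into
  \<open>N\<close> demands.\<close>

definition default_word :: "(nat \<times> 'a) stream" where
  "default_word = (SOME s. s \<in> Linf)"

definition limit_word :: "(nat \<times> 'a) stream \<Rightarrow> (nat \<times> 'a) stream" where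
  "limit_word \<omega> = (if escaping \<omega> then to_stream (\<lambda>l. stable_prefix (Suc l) \<omega> ! l) else default_word)"

lemma default_word_in: "default_word \<in> Linf"
proof -
  obtain a b where a: "a \<in> letters_at G 0" and b: "b \<in> letters_at G 1"
    using letters_at_nonempty[of 0] letters_at_nonempty[of 1] two_le by fastforce
  have ab: "a \<in> A" "b \<in> A" "fst a \<noteq> fst b"
    using a b two_le by (auto simp: letters_iff letters_at_iff)
  define s where "s = to_stream (\<lambda>i::nat. if even i then a else b)"
  have "s \<in> streams A" using ab by (auto simp: s_def to_stream_in_streams)
  moreover have "stake m s \<in> L" for m
  proof (induction m)
    case (Suc m)
    have "stake (Suc m) s = stake m s @ [s !! m]" by (rule stake_Suc)
    moreover have "last (stake m s) = s !! (m - 1)" if "m \<noteq> 0"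
      using that by (cases m) (simp_all add: stake_Suc del: stake.simps(2))
    ultimately show ?case using Suc ab
      by (cases m) (auto simp: append_in_L Cons_in_L s_def to_stream_def simp del: stake.simps(2))
  qed simp
  ultimately have "s \<in> Linf" by (simp add: infinite_words_def)
  then show ?thesis unfolding default_word_def by (rule someI)
qed

lemma stake_limit_word:
  assumes "escaping \<omega>" shows "stake l (limit_word \<omega>) = stable_prefix l \<omega>"
proof (rule nth_equalityI)
  obtain m where "l < length (cwalk \<omega> m)" "take l (cwalk \<omega> m) = stable_prefix l \<omega>"
    using eventually_sequentially_ex[OF escaping_stable[OF assms, of l]] by blast
  from arg_cong[OF this(2), of length] this(1)
  show len: "length (stake l (limit_word \<omega>)) = length (stable_prefix l \<omega>)" by simp
  fix i assume "i < length (stake l (limit_word \<omega>))"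
  then have i: "i < l" by simp
  have "\<forall>\<^sub>F m in sequentially. take l (cwalk \<omega> m) = stable_prefix l \<omega> \<and> take (Suc i) (cwalk \<omega> m) = stable_prefix (Suc i) \<omega>"
    using escaping_stable[OF assms, of l] escaping_stable[OF assms, of "Suc i"] by eventually_elim simp
  then obtain m where "take l (cwalk \<omega> m) = stable_prefix l \<omega>" "take (Suc i) (cwalk \<omega> m) = stable_prefix (Suc i) \<omega>"
    using eventually_sequentially_ex by blast
  then have "stable_prefix (Suc i) \<omega> ! i = stable_prefix l \<omega> ! i"
    using i by (metis lessI nth_take)
  then show "stake l (limit_word \<omega>) ! i = stable_prefix l \<omega> ! i"
    using i assms by (simp add: limit_word_def to_stream_def)
qed

lemma escaping_eventually:
  assumes "escaping \<omega>"
  shows "\<forall>\<^sub>F m in sequentially. l < length (cwalk \<omega> m) \<and> take l (cwalk \<omega> m) = stake l (limit_word \<omega>)"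
  using escaping_stable[OF assms] stake_limit_word[OF assms] by simp

lemma limit_word_in: "limit_word \<omega> \<in> Linf"
proof (cases "escaping \<omega>")
  case True
  have *: "stake l (limit_word \<omega>) \<in> L" for l
  proof -
    obtain m where "take l (cwalk \<omega> m) = stake l (limit_word \<omega>)"
      using eventually_sequentially_ex[OF escaping_eventually[OF True, of l]] by blast
    then show ?thesis using take_in_L[OF cwalk_in_L, of l \<omega> m] by simp
  qed
  have "limit_word \<omega> !! i \<in> A" for i
  proof -
    have "limit_word \<omega> !! i \<in> set (stake (Suc i) (limit_word \<omega>))"
      unfolding stake_Suc by simp
    then show ?thesis using *[of "Suc i"] L_letters by blast
  qed
  then have "limit_word \<omega> \<in> streams A" by (simp add: streams_iff_snth)
  with * show ?thesis by (simp add: infinite_words_def)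
next
  case False
  then show ?thesis by (simp add: limit_word_def default_word_in)
qed

lemma pred_cwalk [measurable]: "Measurable.pred \<Omega> (\<lambda>\<omega>. P (cwalk \<omega> m))"
  using sets_cwalk[of m "{x. P x}"] by (simp add: pred_def)

lemma pred_escaping [measurable]: "Measurable.pred \<Omega> escaping"
  unfolding escaping_def by measurable

lemma measurable_limit_word: "limit_word \<in> \<Omega> \<rightarrow>\<^sub>M N"
  unfolding infinite_words_space_def
proof (rule measurable_restrict_space2)
  show "limit_word \<in> space \<Omega> \<rightarrow> Linf" using limit_word_in by simp
  show "limit_word \<in> \<Omega> \<rightarrow>\<^sub>M stream_space (count_space A)"
  proof (rule measurable_stream_space2)
    fix l
    have in_A: "limit_word \<omega> !! l \<in> A" for \<omega>
      using limit_word_in[of \<omega>] L_inf_subset by (auto simp: streams_iff_snth)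
    have "{\<omega>. limit_word \<omega> !! l = a} \<in> sets \<Omega>" for a
    proof -
      \<comment> \<open>Escape and the eventual value of a letter are countable combinations of
        events about single positions of the walk, which makes them measurable.\<close>
      have "limit_word \<omega> !! l = a \<longleftrightarrow>
        (escaping \<omega> \<and> (\<exists>M. \<forall>m\<ge>M. l < length (cwalk \<omega> m) \<and> cwalk \<omega> m ! l = a)) \<or> (\<not> escaping \<omega> \<and> default_word !! l = a)" for \<omega>
      proof (cases "escaping \<omega>")
        case True
        have ev: "\<forall>\<^sub>F m in sequentially. l < length (cwalk \<omega> m) \<and> cwalk \<omega> m ! l = limit_word \<omega> !! l"
          using escaping_eventually[OF True, of "Suc l"]
        proof eventually_elim
          case (elim m)
          have "cwalk \<omega> m ! l = take (Suc l) (cwalk \<omega> m) ! l" by simp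
          also have "\<dots> = stake (Suc l) (limit_word \<omega>) ! l" using elim by simp
          also have "\<dots> = limit_word \<omega> !! l" by (rule stake_nth) simp
          finally show ?case using elim by simp
        qed
        have "(\<exists>M. \<forall>m\<ge>M. l < length (cwalk \<omega> m) \<and> cwalk \<omega> m ! l = a) \<longleftrightarrow>
          (\<forall>\<^sub>F m in sequentially. l < length (cwalk \<omega> m) \<and> cwalk \<omega> m ! l = a)"
          by (simp add: eventually_sequentially)
        also have "\<dots> \<longleftrightarrow> limit_word \<omega> !! l = a"
        proof
          assume "\<forall>\<^sub>F m in sequentially. l < length (cwalk \<omega> m) \<and> cwalk \<omega> m ! l = a"
          with ev have "\<forall>\<^sub>F m in sequentially. limit_word \<omega> !! l = a" by eventually_elim simp
          then show "limit_word \<omega> !! l = a" by simp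
        qed (use ev in simp)
        finally show ?thesis using True by simp
      qed (simp add: limit_word_def)
      then have "{\<omega>. limit_word \<omega> !! l = a} = {\<omega>\<in>space \<Omega>.
        (escaping \<omega> \<and> (\<exists>M. \<forall>m\<ge>M. l < length (cwalk \<omega> m) \<and> cwalk \<omega> m ! l = a)) \<or> (\<not> escaping \<omega> \<and> default_word !! l = a)}"
        by simp
      also have "\<dots> \<in> sets \<Omega>" by measurable
      finally show ?thesis .
    qed
    then show "(\<lambda>\<omega>. limit_word \<omega> !! l) \<in> \<Omega> \<rightarrow>\<^sub>M count_space A"
      using in_A by (subst measurable_count_space_eq2) (auto simp: vimage_def)
  qed
qed

lemma is_harmonic_limit_word:
  assumes "AE \<omega> in \<Omega>. escaping \<omega>"
  shows "is_harmonic_measure n G \<mu> (distr \<Omega> N limit_word)"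
  unfolding is_harmonic_measure_def
proof (intro bexI[of _ limit_word] conjI refl measurable_limit_word)
  show "AE \<omega> in \<Omega>. filterlim (\<lambda>m. common_prefix_length (walk n G \<omega> m) (limit_word \<omega>)) at_top sequentially"
    using assms AE_walk_eq_cwalk
  proof eventually_elim
    case (elim \<omega>)
    show ?case unfolding filterlim_at_top elim(2)
    proof
      fix l
      show "\<forall>\<^sub>F m in sequentially. l \<le> common_prefix_length (cwalk \<omega> m) (limit_word \<omega>)"
        using escaping_eventually[OF elim(1), of l] by eventually_elim (simp add: common_prefix_length_ge)
    qed
  qed
qed

end

section \<open>Hitting probabilities of the distinguished walk\<close>

context extremal_walk
begin

lemma AE_escaping: "AE \<omega> in \<Omega>. escaping \<omega>"
  using drift_props(3)
proof eventually_elim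
  case (elim \<omega>)
  let ?\<gamma> = "drift n G \<mu>"
  show ?case unfolding escaping_def
  proof
    fix l
    obtain M where "real l / (?\<gamma> / 2) < real M" using reals_Archimedean2 by blast
    have "\<forall>\<^sub>F m in sequentially. ?\<gamma> / 2 < real (length (cwalk \<omega> m)) / real m"
      using elim drift_pos by (intro order_tendstoD) auto
    moreover have "\<forall>\<^sub>F m in sequentially. real l / (?\<gamma> / 2) < real m"
      using eventually_ge_at_top[of M]
      by eventually_elim (rule less_le_trans[OF \<open>real l / (?\<gamma> / 2) < real M\<close> of_nat_mono])
    ultimately have "\<forall>\<^sub>F m in sequentially. l < length (cwalk \<omega> m)"
      using eventually_gt_at_top[of 0]
    proof eventually_elim
      case (elim m)
      then have "real l < ?\<gamma> / 2 * real m" using drift_pos by (simp add: field_simps)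
      also have "\<dots> < real (length (cwalk \<omega> m))" using elim by (simp add: field_simps)
      finally show ?case by simp
    qed
    then show "\<exists>M. \<forall>m\<ge>M. l < length (cwalk \<omega> m)" by (simp add: eventually_sequentially)
  qed
qed

text \<open>The probability that the walk from \<open>g\<close> ever visits the identity: it is 1
  there, harmonic elsewhere, and tends to 0 along escaping paths.\<close>

definition decay :: "(nat \<times> 'a) list \<Rightarrow> real" where "decay g = (1 / \<rho>) ^ length g"

lemma decay_harmonic:
  assumes "g \<in> L" "g \<noteq> []" shows "expect \<mu> (\<lambda>a. decay (g \<cdot> [a])) = decay g"
proof -
  obtain v b where g: "g = v @ [b]" using assms(2) by (metis rev_exhaust)
  have b: "b \<in> A" "fst b < n" using assms g by (auto simp: snoc_in_L letters_iff)
  have "(\<Sum>a\<in>A - letters_at G (fst b). pmf \<mu> a * (1 - 1 / \<rho>)) = (\<Sum>a\<in>A - letters_at G (fst b). 1 / (\<rho> + k (fst a))) * (1 - 1 / \<rho>)"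
    unfolding sum_distrib_right by (rule sum.cong) (auto simp: pmf_extremal)
  then show ?thesis
    using expect_weight[of v b "\<lambda>_. 1 / \<rho>"] assms(1) g linv_props(1)[OF b(1)] rho_pos
    by (simp add: decay_def weight_const sum_rho_diff[OF b(2)] pmf_extremal)
qed

text \<open>The probability that the walk started at \<open>g\<close> converges into the cylinder of \<open>u\<close>.\<close>

definition hit :: "(nat \<times> 'a) list \<Rightarrow> (nat \<times> 'a) list \<Rightarrow> real" where
  "hit u g = (let j = fst (last u) in
     if prefix u g then 1 - k j / (\<rho> + k j) * decay (winv u \<cdot> g) else \<rho> / (\<rho> + k j) * decay (winv u \<cdot> g))"

text \<open>Let j be the factor of the last letter of \<open>u\<close> and s = \<rho> / (\<rho> + k
  j), the chance of ending in the cone when starting at its apex \<open>u\<close>. The walk crosses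
  the border of the cone only through \<open>u\<close>. Outside, ending in the cone means visiting
  \<open>u\<close> and then succeeding; inside, failing means visiting \<open>u\<close> and then
  failing, with chance 1 - s. Away from \<open>u\<close> harmonicity is inherited from
  \<open>decay\<close>; the branches agree at \<open>u\<close>, where the average is computed by
  hand.\<close>

lemma hit_harmonic:
  assumes u: "u \<in> L" "u \<noteq> []" and g: "g \<in> L"
  shows "expect \<mu> (\<lambda>a. hit u (g \<cdot> [a])) = hit u g"
proof -
  let ?j = "fst (last u)"
  define c where "c = k ?j / (\<rho> + k ?j)"
  define s where "s = \<rho> / (\<rho> + k ?j)"
  have hit: "hit u x = (if prefix u x then 1 - c * decay (winv u \<cdot> x) else s * decay (winv u \<cdot> x))" for x
    by (simp add: hit_def Let_def c_def s_def)
  have cs: "1 - c = s" using rho_k_pos[of ?j] by (simp add: c_def s_def field_simps)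
  have j: "?j < n" using u by (metis L_letters last_in_set letters_iff)
  have wL: "winv u \<in> L" by (rule winv_in_L[OF u(1)])
  have assoc: "winv u \<cdot> (g \<cdot> [a]) = winv u \<cdot> g \<cdot> [a]" if "a \<in> set_pmf \<mu>" for a
    using that set_mu g wL by (subst mul_assoc) (auto simp: Cons_in_L simp del: foldr.simps)
  consider (eq) "g = u" | (pre) "prefix u g" "g \<noteq> u" | (npre) "\<not> prefix u g" by blast
  then show ?thesis
  proof cases
    case eq
    \<comment> \<open>A letter of the last factor removes or replaces the end of \<open>u\<close>;
      any other letter is appended.\<close>
    have pre_iff: "prefix u (u \<cdot> [a]) \<longleftrightarrow> a \<notin> letters_at G ?j" if a: "a \<in> A" for a
    proof -
      obtain v b where vb: "u = v @ [b]" using u(2) by (metis rev_exhaust)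
      have b: "b \<in> A" using u vb by (simp add: snoc_in_L)
      show ?thesis
      proof (cases "fst a = fst b")
        case True
        have "u \<cdot> [a] \<noteq> u"
        proof
          assume "u \<cdot> [a] = u"
          then have "winv u \<cdot> (u \<cdot> [a]) = winv u \<cdot> u" by simp
          then show False using winv_mul_mul[OF u(1), of "[a]"] winv_mul[OF u(1)] a by (simp add: Cons_in_L)
        qed
        moreover have "length (u \<cdot> [a]) \<le> length u"
          using mul_letter_same[of v b a] u vb a True by auto
        ultimately have "\<not> prefix u (u \<cdot> [a])"
          by (metis prefix_length_le prefix_length_prefix prefix_order.antisym prefix_order.refl)
        moreover have "a \<in> letters_at G ?j" using a True vb by (simp add: letters_iff)
        ultimately show ?thesis by simp
      next
        case False
        then have "u @ [a] \<in> L" using u a vb by (subst snoc_in_L) auto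
        then have "u \<cdot> [a] = u @ [a]" by (rule mul_append)
        then show ?thesis using False vb by (simp add: letters_at_iff)
      qed
    qed
    have "hit u (u \<cdot> [a]) = (if a \<in> letters_at G ?j then s / \<rho> else 1 - c / \<rho>)" if "a \<in> A" for a
      using pre_iff[OF that] winv_mul_mul[OF u(1), of "[a]"] that by (simp add: hit decay_def Cons_in_L)
    then have "expect \<mu> (\<lambda>a. hit u (u \<cdot> [a])) = (\<Sum>a\<in>A. pmf \<mu> a * (if a \<in> letters_at G ?j then s / \<rho> else 1 - c / \<rho>))"
      unfolding expect_mu by (intro sum.cong) auto
    also have "\<dots> = (\<Sum>a\<in>A - letters_at G ?j. pmf \<mu> a * (1 - c / \<rho>)) + (\<Sum>a\<in>letters_at G ?j. pmf \<mu> a * (s / \<rho>))"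
      by (subst sum.subset_diff[OF letters_at_subset[OF j]]) (auto intro!: arg_cong2[where f = "(+)"] sum.cong)
    also have "\<dots> = s * (1 - c / \<rho>) + c * (s / \<rho>)"
    proof -
      have 1: "(\<Sum>a\<in>A - letters_at G ?j. pmf \<mu> a) = s"
        unfolding s_def sum_rho_diff[OF j, symmetric] by (rule sum.cong) (auto simp: pmf_extremal)
      have "1 = (\<Sum>a\<in>A - letters_at G ?j. pmf \<mu> a) + (\<Sum>a\<in>letters_at G ?j. pmf \<mu> a)"
        unfolding sum_mu[symmetric] by (rule sum.subset_diff) (simp_all add: j letters_at_subset)
      then have 2: "(\<Sum>a\<in>letters_at G ?j. pmf \<mu> a) = c" using 1 cs by simp
      show ?thesis by (simp only: sum_distrib_right[symmetric] 1 2)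
    qed
    also have "\<dots> = s" by (simp add: algebra_simps)
    also have "s = hit u u" using cs by (simp add: hit decay_def winv_mul u)
    finally show ?thesis using eq by simp
  next
    case pre
    have p: "prefix u (g \<cdot> [a])" if "a \<in> A" for a
      using g that
    proof (cases rule: mul_letter_cases)
      case append
      then show ?thesis using pre by (simp add: prefix_prefix)
    next
      case (delete v)
      then show ?thesis using pre by simp
    next
      case (merge v b c)
      then show ?thesis using pre by (simp add: prefix_prefix)
    qed
    have ne: "winv u \<cdot> g \<noteq> []"
    proof
      assume "winv u \<cdot> g = []"
      then have "u \<cdot> (winv u \<cdot> g) = u" using u by simp
      then show False using mul_winv_mul[OF u(1) g] pre by simp
    qed
    have "expect \<mu> (\<lambda>a. hit u (g \<cdot> [a])) = expect \<mu> (\<lambda>a. 1 - c * decay (winv u \<cdot> g \<cdot> [a]))"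
      using p set_mu assoc by (intro expect_cong) (auto simp: hit)
    also have "\<dots> = 1 - c * expect \<mu> (\<lambda>a. decay (winv u \<cdot> g \<cdot> [a]))"
      by (simp add: expect_diff)
    also have "\<dots> = hit u g"
      using decay_harmonic[OF mul_in_L[OF wL g] ne] pre by (simp add: hit)
    finally show ?thesis .
  next
    case npre
    have ne: "winv u \<cdot> g \<noteq> []"
    proof
      assume "winv u \<cdot> g = []"
      then have "u \<cdot> (winv u \<cdot> g) = u" using u by simp
      then show False using mul_winv_mul[OF u(1) g] npre by simp
    qed
    have "hit u (g \<cdot> [a]) = s * decay (winv u \<cdot> g \<cdot> [a])" if "a \<in> set_pmf \<mu>" for a
    proof (cases "prefix u (g \<cdot> [a])")
      case True
      then have e: "g \<cdot> [a] = u" using prefix_entry[OF g _ npre True] that set_mu by auto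
      have "hit u u = s" using cs by (simp add: hit decay_def winv_mul u)
      then show ?thesis using assoc[OF that] by (simp add: e winv_mul u decay_def)
    next
      case False
      then show ?thesis using assoc[OF that] by (simp add: hit)
    qed
    then have "expect \<mu> (\<lambda>a. hit u (g \<cdot> [a])) = expect \<mu> (\<lambda>a. s * decay (winv u \<cdot> g \<cdot> [a]))"
      by (intro expect_cong)
    also have "\<dots> = s * expect \<mu> (\<lambda>a. decay (winv u \<cdot> g \<cdot> [a]))" by simp
    also have "\<dots> = hit u g"
      using decay_harmonic[OF mul_in_L[OF wL g] ne] npre by (simp add: hit)
    finally show ?thesis .
  qed
qed

lemma hit_bounds:
  assumes "u \<in> L" "u \<noteq> []" "x \<in> L"
  shows "\<bar>hit u x - (if prefix u x then 1 else 0)\<bar> \<le> decay (winv u \<cdot> x)" "decay (winv u \<cdot> x) \<le> 1"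
proof -
  let ?j = "fst (last u)"
  have F: "0 \<le> decay (winv u \<cdot> x)" using rho_pos by (simp add: decay_def)
  have c: "0 \<le> k ?j / (\<rho> + k ?j)" "k ?j / (\<rho> + k ?j) \<le> 1" and s: "0 \<le> \<rho> / (\<rho> + k ?j)" "\<rho> / (\<rho> + k ?j) \<le> 1"
    using rho_pos rho_k_pos[of ?j] by auto
  note bounds = mult_nonneg_nonneg[OF c(1) F] mult_left_le_one_le[OF F c] mult_nonneg_nonneg[OF s(1) F] mult_left_le_one_le[OF F s]
  show "\<bar>hit u x - (if prefix u x then 1 else 0)\<bar> \<le> decay (winv u \<cdot> x)"
  proof (cases "prefix u x")
    case True
    then show ?thesis using bounds unfolding hit_def Let_def if_P[OF True] by linarith
  next
    case False
    then show ?thesis using bounds unfolding hit_def Let_def if_not_P[OF False] by linarith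
  qed
  show "decay (winv u \<cdot> x) \<le> 1" using rho1 by (simp add: decay_def power_le_one)
qed

text \<open>Along an escaping path the distance to \<open>u\<close> tends to infinity, so
  \<open>decay\<close> vanishes and \<open>hit\<close> approaches the indicator of the cone, which
  is eventually constant.\<close>

lemma AE_hit_limit:
  assumes u: "u \<in> L" "u \<noteq> []"
  shows "AE \<omega> in \<Omega>. (\<lambda>m. hit u (cwalk \<omega> m)) \<longlonglongrightarrow> indicator {\<omega>. limit_word \<omega> \<in> C u} \<omega>"
  using AE_escaping
proof eventually_elim
  case (elim \<omega>)
  have ev: "\<forall>\<^sub>F m in sequentially. (if prefix u (cwalk \<omega> m) then 1 else 0) = indicator {\<omega>. limit_word \<omega> \<in> C u} \<omega>"
    using escaping_eventually[OF elim, of "length u"]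
  proof eventually_elim
    case (elim m)
    have "prefix u (cwalk \<omega> m) \<longleftrightarrow> take (length u) (cwalk \<omega> m) = u"
      by (metis append_eq_conv_conj prefix_def take_is_prefix)
    also have "\<dots> \<longleftrightarrow> limit_word \<omega> \<in> C u" using elim limit_word_in by (simp add: in_C_iff)
    finally show ?case by simp
  qed
  have "(\<lambda>m. decay (winv u \<cdot> cwalk \<omega> m)) \<longlonglongrightarrow> 0"
  proof (rule LIMSEQ_I)
    fix e :: real assume "0 < e"
    moreover have "(\<lambda>l. (1 / \<rho>) ^ l) \<longlonglongrightarrow> 0" using rho1 by (intro LIMSEQ_realpow_zero) auto
    ultimately obtain l where l: "(1 / \<rho>) ^ l < e" using rho_pos
      by (force dest!: LIMSEQ_D simp: abs_if split: if_splits)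
    from escaping_eventually[OF elim, of "length u + l"]
    have "\<forall>\<^sub>F m in sequentially. norm (decay (winv u \<cdot> cwalk \<omega> m) - 0) < e"
    proof eventually_elim
      case (elim m)
      have "length (u \<cdot> (winv u \<cdot> cwalk \<omega> m)) \<le> length u + length (winv u \<cdot> cwalk \<omega> m)"
        using u by (intro length_mul_le mul_in_L winv_in_L) auto
      then have "l \<le> length (winv u \<cdot> cwalk \<omega> m)" using elim u by (simp add: mul_winv_mul)
      then have "decay (winv u \<cdot> cwalk \<omega> m) \<le> (1 / \<rho>) ^ l"
        unfolding decay_def using rho1 by (intro power_decreasing) auto
      then show ?case using l rho_pos by (simp add: decay_def)
    qed
    then show "\<exists>no. \<forall>m\<ge>no. norm (decay (winv u \<cdot> cwalk \<omega> m) - 0) < e" by (simp add: eventually_sequentially)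
  qed
  then have "(\<lambda>m. hit u (cwalk \<omega> m) - (if prefix u (cwalk \<omega> m) then 1 else 0)) \<longlonglongrightarrow> 0"
    by (rule Lim_null_comparison[rotated]) (use hit_bounds(1)[OF u cwalk_in_L] in auto)
  then have "(\<lambda>m. hit u (cwalk \<omega> m) - indicator {\<omega>. limit_word \<omega> \<in> C u} \<omega>) \<longlonglongrightarrow> 0"
    by (rule Lim_transform_eventually) (use ev in \<open>auto elim!: eventually_mono\<close>)
  then show ?case by (simp add: LIM_zero_iff)
qed

text \<open>Along the walk \<open>hit u\<close> is a bounded martingale that converges to the
  indicator of the limit event, so the probability of that event is its value at the
  identity.\<close>

lemma prob_limit_word:
  assumes u: "u \<in> L" shows "measure (distr \<Omega> N limit_word) (C u) = harmonic_weight u"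
proof (cases "u = []")
  case True
  interpret D: prob_space "distr \<Omega> N limit_word" by (rule \<Omega>.prob_space_distr[OF measurable_limit_word])
  show ?thesis using True D.prob_space by (simp add: C_Nil harmonic_weight_def)
next
  case False
  let ?S = "{\<omega>. limit_word \<omega> \<in> C u}"
  have S: "?S = limit_word -` C u \<inter> space \<Omega>" by auto
  have Ssets: "?S \<in> sets \<Omega>" unfolding S by (rule measurable_sets[OF measurable_limit_word C_sets])
  have m: "measure (distr \<Omega> N limit_word) (C u) = measure \<Omega> ?S"
    unfolding S by (rule measure_distr[OF measurable_limit_word C_sets])
  have bd: "\<bar>hit u x\<bar> \<le> 2" if "x \<in> L" for x using hit_bounds[OF u False that] by (auto split: if_splits)
  have meas: "(\<lambda>\<omega>. hit u (cwalk \<omega> m)) \<in> borel_measurable \<Omega>" for m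
    by (rule measurable_compose[OF measurable_cwalk]) simp
  have "(\<lambda>m. integral\<^sup>L \<Omega> (\<lambda>\<omega>. hit u (cwalk \<omega> m))) \<longlonglongrightarrow> integral\<^sup>L \<Omega> (indicator ?S)"
    by (rule integral_dominated_convergence[where w = "\<lambda>_. 2"])
      (use AE_hit_limit[OF u False] bd Ssets meas in auto)
  moreover have "integral\<^sup>L \<Omega> (\<lambda>\<omega>. hit u (cwalk \<omega> m)) = hit u []" for m
  proof -
    \<comment> \<open>The bound 2 on \<open>hit\<close> makes this nonnegative, so that
      \<open>nn_integral_cwalk\<close> applies.\<close>
    let ?h = "\<lambda>x. hit u x + 2"
    have h0: "0 \<le> ?h x" if "x \<in> L" for x using bd[OF that] by linarith
    have pos: "AE \<omega> in \<Omega>. 0 \<le> ?h (cwalk \<omega> m)" by (rule AE_I2) (rule h0[OF cwalk_in_L])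
    have "integral\<^sup>L \<Omega> (\<lambda>\<omega>. ?h (cwalk \<omega> m)) = enn2real (\<integral>\<^sup>+\<omega>. ennreal (?h (cwalk \<omega> m)) \<partial>\<Omega>)"
      using meas pos by (intro integral_eq_nn_integral) auto
    also have "\<dots> = enn2real (\<integral>\<^sup>+x. ennreal (?h x) \<partial>measure_pmf (W m))"
      using nn_integral_cwalk[of "\<lambda>x. ennreal (?h x)"] by simp
    also have "\<dots> = expect (W m) ?h"
      using h0 set_walk_law by (intro integral_eq_nn_integral[symmetric]) (auto simp: AE_measure_pmf_iff)
    also have "\<dots> = expect (W m) (hit u) + 2" by (simp add: expect_add)
    also have "expect (W m) (hit u) = hit u []"
      using harmonic_eq[of "hit u" "[]" m] hit_harmonic[OF u False] by simp
    finally have "integral\<^sup>L \<Omega> (\<lambda>\<omega>. ?h (cwalk \<omega> m)) = hit u [] + 2" .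
    moreover have "integrable \<Omega> (\<lambda>\<omega>. hit u (cwalk \<omega> m))"
      by (rule \<Omega>.integrable_const_bound[where B = 2]) (use bd meas in auto)
    ultimately show ?thesis by (simp add: \<Omega>.prob_space[simplified])
  qed
  ultimately have "integral\<^sup>L \<Omega> (indicator ?S) = hit u []"
    by (simp add: LIMSEQ_const_iff)
  then have "measure \<Omega> ?S = hit u []" using Ssets by simp
  also have "hit u [] = harmonic_weight u"
    using False u rho_pos by (cases "length u") (auto simp: hit_def harmonic_weight_def decay_def Let_def winv_in_L power_one_over)
  finally show ?thesis using m by simp
qed

lemma harmonic_measure:
  shows "\<exists>!\<nu>. is_harmonic_measure n G \<mu> \<nu>"
    and "is_harmonic_measure n G \<mu> \<nu> \<Longrightarrow> u \<in> L \<Longrightarrow> measure \<nu> (C u) = harmonic_weight u"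
proof -
  have *: "is_harmonic_measure n G \<mu> (distr \<Omega> N limit_word)"
    by (rule is_harmonic_limit_word[OF AE_escaping])
  then show "\<exists>!\<nu>. is_harmonic_measure n G \<mu> \<nu>" using is_harmonic_measure_unique by blast
  show "measure \<nu> (C u) = harmonic_weight u" if "is_harmonic_measure n G \<mu> \<nu>" "u \<in> L"
    using is_harmonic_measure_unique[OF that(1) *] prob_limit_word[OF that(2)] by simp
qed

end

section \<open>Entropy of measure preserving maps\<close>

text \<open>Carries finite partitions over to pmfs, where the entropy inequalities are proved;
  \<open>measure_pmf_law\<close> shows that it is meaningful for simple functions on a probability
  space.\<close>

definition law :: "'x measure \<Rightarrow> ('x \<Rightarrow> 'y) \<Rightarrow> 'y pmf" where
  "law M F = Abs_pmf (distr M (count_space UNIV) F)"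

context prob_space
begin

lemma measure_pmf_law:
  assumes F: "simple_function M F"
  shows "measure_pmf (law M F) = distr M (count_space UNIV) F"
proof -
  let ?D = "distr M (count_space UNIV) F"
  have meas: "F \<in> M \<rightarrow>\<^sub>M count_space UNIV" by (rule measurable_simple_function[OF F])
  have "prob_space ?D" by (rule prob_space_distr[OF meas])
  moreover have "AE x in ?D. measure ?D {x} \<noteq> 0"
  proof -
    let ?Z = "{y \<in> F ` space M. measure ?D {y} = 0}"
    have "AE x in M. \<forall>y\<in>?Z. F x \<noteq> y"
    proof (rule AE_finite_allI)
      show "finite ?Z" using F by (simp add: simple_function_def)
      fix y assume "y \<in> ?Z"
      then have "prob (F -` {y} \<inter> space M) = 0" using meas by (simp add: measure_distr)
      then have "F -` {y} \<inter> space M \<in> null_sets M"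
        using measurable_sets[OF meas, of "{y}"] by (simp add: null_sets_def emeasure_eq_measure)
      then show "AE x in M. F x \<noteq> y" by (rule AE_I') auto
    qed
    moreover have "AE x in M. x \<in> space M" by (rule AE_space)
    ultimately have "AE x in M. measure ?D {F x} \<noteq> 0" by eventually_elim blast
    then show ?thesis by (subst AE_distr_iff[OF meas]) auto
  qed
  ultimately show ?thesis unfolding law_def by (intro Abs_pmf_inverse) simp
qed

lemma pmf_law: "simple_function M F \<Longrightarrow> pmf (law M F) y = prob {x \<in> space M. F x = y}"
  by (simp add: pmf.rep_eq measure_pmf_law measure_distr measurable_simple_function vimage_def Int_def conj_commute)

lemma set_law:
  assumes "simple_function M F" shows "set_pmf (law M F) \<subseteq> F ` space M" "finite (set_pmf (law M F))"
proof -
  show 1: "set_pmf (law M F) \<subseteq> F ` space M"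
  proof
    fix y assume "y \<in> set_pmf (law M F)"
    then have "prob {x \<in> space M. F x = y} \<noteq> 0" by (simp add: set_pmf_iff pmf_law[OF assms])
    then have "{x \<in> space M. F x = y} \<noteq> {}" by (metis measure_empty)
    then show "y \<in> F ` space M" by blast
  qed
  show "finite (set_pmf (law M F))"
    using finite_subset[OF 1] assms by (simp add: simple_function_def)
qed

lemma law_map:
  assumes F: "simple_function M F"
  shows "map_pmf g (law M F) = law M (\<lambda>x. g (F x))"
proof -
  have gF: "simple_function M (\<lambda>x. g (F x))" using F by (rule simple_function_compose1)
  have "measure_pmf (map_pmf g (law M F)) = measure_pmf (law M (\<lambda>x. g (F x)))"
    unfolding map_pmf_rep_eq measure_pmf_law[OF F] measure_pmf_law[OF gF]
    by (subst distr_distr) (auto simp: measurable_simple_function F comp_def)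
  then show ?thesis by (simp only: measure_pmf_inject)
qed

lemma expect_law:
  assumes F: "simple_function M F"
  shows "expect (law M F) u = (\<integral>x. u (F x) \<partial>M)"
  unfolding measure_pmf_law[OF F] by (rule integral_distr) (simp_all add: measurable_simple_function F)

text \<open>Blocks of measure zero lie outside the support, and their terms 0 * ln 0 are 0.\<close>

lemma partition_entropy_law:
  assumes F: "simple_function M F"
  shows "partition_entropy M F = pmf_entropy (law M F)"
  unfolding partition_entropy_def pmf_entropy_def pmf_law[OF F, symmetric]
  using F set_law[OF F]
  by (intro arg_cong[where f = uminus] sum.mono_neutral_right) (auto simp: simple_function_def set_pmf_iff)

lemma law_cong: "(\<And>x. x \<in> space M \<Longrightarrow> F x = F' x) \<Longrightarrow> law M F = law M F'"
  unfolding law_def by (intro arg_cong[where f = Abs_pmf] distr_cong) auto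

end

text \<open>A product of subprobabilities, one for each position, is a subprobability on words. The
  induction peels off the first letter and shifts the parameters, so \<open>z\<close> must
  vary.\<close>

lemma sum_prod_words_le:
  fixes r :: "'y \<Rightarrow> 'z \<Rightarrow> real"
  assumes fin: "finite V" and r: "\<And>y z. 0 \<le> r y z" "\<And>z. (\<Sum>y\<in>V. r y z) \<le> 1"
  shows "(\<Sum>ys\<in>{ys. set ys \<subseteq> V \<and> length ys = m}. \<Prod>i<m. r (ys ! i) (z i)) \<le> 1"
proof (induction m arbitrary: z)
  case 0
  have "{ys. set ys \<subseteq> V \<and> length ys = 0} = {[]}" by auto
  then show ?case by simp
next
  case (Suc m)
  let ?S = "{ys. set ys \<subseteq> V \<and> length ys = m}"
  have "(\<Sum>ys\<in>{ys. set ys \<subseteq> V \<and> length ys = Suc m}. \<Prod>i<Suc m. r (ys ! i) (z i))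
    = (\<Sum>p\<in>?S \<times> V. \<Prod>i<Suc m. r ((snd p # fst p) ! i) (z i))"
    unfolding lists_length_Suc_eq by (subst sum.reindex) (auto simp: inj_on_def case_prod_beta')
  also have "\<dots> = (\<Sum>p\<in>?S \<times> V. (\<Prod>i<m. r (fst p ! i) (z (Suc i))) * r (snd p) (z 0))"
    by (simp add: prod.lessThan_Suc_shift mult.commute del: prod.lessThan_Suc)
  also have "\<dots> = (\<Sum>ys\<in>?S. \<Prod>i<m. r (ys ! i) (z (Suc i))) * (\<Sum>y\<in>V. r y (z 0))"
    by (simp add: sum_product sum.cartesian_product case_prod_beta')
  also have "\<dots> \<le> 1 * 1"
    using r by (intro mult_mono Suc) (auto intro!: sum_nonneg)
  finally show ?case by simp
qed

locale measure_preserving = prob_space M for M :: "'x measure" +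
  fixes T :: "'x \<Rightarrow> 'x"
  assumes T_meas [measurable]: "T \<in> M \<rightarrow>\<^sub>M M" and T_distr: "distr M M T = M"
begin

lemma T_pow_meas: "T ^^ i \<in> M \<rightarrow>\<^sub>M M"
proof (induction i)
  case (Suc i)
  from measurable_comp[OF Suc T_meas] show ?case by simp
qed (simp add: id_def)

lemma T_pow_distr: "distr M M (T ^^ i) = M"
proof (induction i)
  case (Suc i)
  have "distr M M (T ^^ Suc i) = distr (distr M M (T ^^ i)) M T"
    by (subst distr_distr[OF T_meas T_pow_meas]) simp
  also have "\<dots> = M" by (simp only: Suc T_distr)
  finally show ?case .
qed (simp add: id_def distr_id)

lemma simple_function_T_pow: "simple_function M F \<Longrightarrow> simple_function M (\<lambda>x. F ((T ^^ i) x))"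
  by (rule simple_function_comp[OF T_pow_meas])

lemma law_T_pow:
  assumes F: "simple_function M F" shows "law M (\<lambda>x. F ((T ^^ i) x)) = law M F"
proof -
  have "distr M (count_space UNIV) (\<lambda>x. F ((T ^^ i) x)) = distr (distr M M (T ^^ i)) (count_space UNIV) F"
    by (subst distr_distr[OF measurable_simple_function[OF F] T_pow_meas]) (simp add: comp_def)
  then show ?thesis by (simp add: law_def T_pow_distr)
qed

definition itin :: "('x \<Rightarrow> 'y) \<Rightarrow> nat \<Rightarrow> 'x \<Rightarrow> 'y list" where
  "itin f m x = map (\<lambda>i. f ((T ^^ i) x)) [0..<m]"

lemma itin_add: "itin f (m + l) x = itin f m x @ itin f l ((T ^^ m) x)"
proof -
  have "[0..<m + l] = [0..<m] @ map (\<lambda>i. m + i) [0..<l]"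
    using map_add_upt[of m l] upt_add_eq_append[of 0 m l] by (simp add: add.commute)
  moreover have "(T ^^ (m + i)) x = (T ^^ i) ((T ^^ m) x)" for i
    using funpow_add[of i m T] by (simp add: add.commute)
  ultimately show ?thesis by (simp add: itin_def)
qed

lemma simple_function_itin: "simple_function M f \<Longrightarrow> simple_function M (itin f m)"
proof (induction m)
  case 0
  then show ?case by (simp add: itin_def[abs_def])
next
  case (Suc m)
  have "itin f (Suc m) = (\<lambda>x. (\<lambda>(ys, y). ys @ [y]) (itin f m x, f ((T ^^ m) x)))"
    by (simp add: itin_def[abs_def])
  then show ?case
    using simple_function_compose1[OF simple_function_Pair[OF Suc.IH[OF Suc.prems] simple_function_T_pow[OF Suc.prems, of m]],
        of "\<lambda>(ys, y). ys @ [y]"] by simp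
qed

lemma itin_entropy_add:
  assumes f: "simple_function M f"
  shows "pmf_entropy (law M (itin f (m + l))) \<le> pmf_entropy (law M (itin f m)) + pmf_entropy (law M (itin f l))"
proof -
  let ?P = "\<lambda>x. (itin f m x, itin f l ((T ^^ m) x))"
  have P: "simple_function M ?P"
    by (intro simple_function_Pair simple_function_itin simple_function_T_pow f)
  have "law M (itin f (m + l)) = map_pmf (\<lambda>(u, v). u @ v) (law M ?P)"
    unfolding law_map[OF P] by (intro law_cong) (simp add: itin_add)
  then have "pmf_entropy (law M (itin f (m + l))) \<le> pmf_entropy (law M ?P)"
    using pmf_entropy_map_le[OF set_law(2)[OF P]] by simp
  also have "\<dots> \<le> pmf_entropy (map_pmf fst (law M ?P)) + pmf_entropy (map_pmf snd (law M ?P))"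
    by (rule pmf_entropy_pair_le[OF set_law(2)[OF P]])
  also have "\<dots> = pmf_entropy (law M (itin f m)) + pmf_entropy (law M (itin f l))"
    unfolding law_map[OF P] by (simp add: law_T_pow simple_function_itin f)
  finally show ?thesis .
qed

lemma itin_entropy_lim:
  assumes f: "simple_function M f"
  obtains h where "(\<lambda>m. pmf_entropy (law M (itin f m)) / real m) \<longlonglongrightarrow> h"
  by (rule fekete[of "\<lambda>m. pmf_entropy (law M (itin f m))", OF itin_entropy_add[OF f] pmf_entropy_nonneg])
    (rule that)

text \<open>If \<open>g\<close> approximates \<open>f\<close> and the itinerary of \<open>g\<close> is read off from \<open>Z\<close>, then Gibbs' inequality for the
  channel that transmits each symbol of \<open>g\<close> correctly with probability \<open>1 - \<epsilon>\<close> bounds the entropy of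
  the itinerary of \<open>f\<close>. This replaces the usual estimate by conditional entropies.\<close>

lemma itin_entropy_le:
  fixes f g :: "'x \<Rightarrow> 'y"
  assumes f: "simple_function M f" and g: "simple_function M g" and Z: "simple_function M Z"
    and read: "\<And>i x. i < m \<Longrightarrow> x \<in> space M \<Longrightarrow> g ((T ^^ i) x) = \<gamma> i (Z x)"
    and \<epsilon>: "0 < \<epsilon>" "\<epsilon> < 1" and approx: "prob {x \<in> space M. f x \<noteq> g x} \<le> \<epsilon>"
  shows "pmf_entropy (law M (itin f m)) \<le> pmf_entropy (law M Z)
    + real m * (- ln (1 - \<epsilon>) + \<epsilon> * ln (real (card (f ` space M)) / \<epsilon>))"
proof -
  define V where "V = f ` space M"
  define K where "K = real (card V)"
  have V: "finite V" "V \<noteq> {}" using f not_empty by (auto simp: V_def simple_function_def)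
  then have K: "1 \<le> K" by (simp add: K_def Suc_le_eq card_gt_0_iff)
  \<comment> \<open>Spreading the error mass over all labels makes a correct symbol cost - ln (1 -
    \<epsilon>) and a wrong one ln (K / \<epsilon>).\<close>
  define r where "r y z = (if y = z then 1 - \<epsilon> else \<epsilon> / K)" for y z :: 'y
  have r0: "0 < r y z" for y z using \<epsilon> K by (simp add: r_def)
  have r1: "(\<Sum>y\<in>V. r y z) \<le> 1" for z
  proof -
    have "(\<Sum>y\<in>V. r y z) \<le> (\<Sum>y\<in>V. (if y = z then 1 - \<epsilon> else 0) + \<epsilon> / K)"
      using \<epsilon> K by (intro sum_mono) (auto simp: r_def)
    also have "\<dots> = (if z \<in> V then 1 - \<epsilon> else 0) + K * (\<epsilon> / K)"
      using V by (simp add: sum.distrib sum.delta' K_def)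
    also have "\<dots> \<le> 1" using K \<epsilon> by simp
    finally show ?thesis .
  qed
  let ?P = "\<lambda>x. (itin f m x, Z x)"
  have P: "simple_function M ?P" by (intro simple_function_Pair simple_function_itin f Z)
  define R where "R = law M ?P"
  have finR: "finite (set_pmf R)" unfolding R_def by (rule set_law(2)[OF P])
  define p where "p = law M Z"
  have p: "p = map_pmf snd R" unfolding p_def R_def law_map[OF P] by simp
  let ?q = "\<lambda>(y, w). pmf p w * (\<Prod>i<m. r (y ! i) (\<gamma> i w))"
  have R_sub: "set_pmf R \<subseteq> {ys. set ys \<subseteq> V \<and> length ys = m} \<times> set_pmf p"
  proof
    fix yw assume yw: "yw \<in> set_pmf R"
    then have "yw \<in> ?P ` space M" using set_law(1)[OF P] by (auto simp: R_def)
    then obtain x where x: "x \<in> space M" "yw = ?P x" by blast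
    have "(T ^^ i) x \<in> space M" for i by (rule measurable_space[OF T_pow_meas x(1)])
    then have "set (itin f m x) \<subseteq> V" by (auto simp: itin_def V_def)
    moreover have "snd yw \<in> set_pmf p" using yw by (simp add: p)
    ultimately show "yw \<in> {ys. set ys \<subseteq> V \<and> length ys = m} \<times> set_pmf p"
      using x by (simp add: itin_def)
  qed
  have finp: "finite (set_pmf p)" using finR by (simp add: p)
  have finL: "finite {ys. set ys \<subseteq> V \<and> length ys = m}" by (rule finite_lists_length_eq[OF V(1)])
  have "(\<Sum>yw\<in>set_pmf R. ?q yw) \<le> (\<Sum>yw\<in>{ys. set ys \<subseteq> V \<and> length ys = m} \<times> set_pmf p. ?q yw)"
    using R_sub finp finL less_imp_le[OF r0]
    by (intro sum_mono2) (auto intro!: mult_nonneg_nonneg prod_nonneg)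
  also have "\<dots> = (\<Sum>w\<in>set_pmf p. pmf p w * (\<Sum>y\<in>{ys. set ys \<subseteq> V \<and> length ys = m}. \<Prod>i<m. r (y ! i) (\<gamma> i w)))"
    by (subst sum.cartesian_product[symmetric], subst sum.swap) (simp add: sum_distrib_left)
  also have "\<dots> \<le> (\<Sum>w\<in>set_pmf p. pmf p w * 1)"
    using less_imp_le[OF r0] r1 V by (intro sum_mono mult_left_mono sum_prod_words_le) auto
  also have "\<dots> = 1" using sum_pmf_set_pmf[OF finp] by simp
  finally have q1: "(\<Sum>yw\<in>set_pmf R. ?q yw) \<le> 1" .
  have ppos: "0 < pmf p (snd yw)" if "yw \<in> set_pmf R" for yw
    using that by (intro pmf_positive) (simp add: p)
  have "pmf_entropy (law M (itin f m)) = pmf_entropy (map_pmf fst R)"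
    unfolding R_def law_map[OF P] by simp
  also have "\<dots> \<le> pmf_entropy R" by (rule pmf_entropy_map_le[OF finR])
  also have "\<dots> \<le> expect R (\<lambda>yw. - ln (?q yw))"
    by (rule gibbs_inequality(1)[OF finR _ q1])
      (use ppos r0 in \<open>auto intro!: mult_pos_pos prod_pos simp: case_prod_beta'\<close>)
  also have "\<dots> = expect R (\<lambda>yw. - ln (pmf p (snd yw)) + (\<Sum>i<m. - ln (r (fst yw ! i) (\<gamma> i (snd yw)))))"
  proof (rule expect_cong)
    fix yw assume "yw \<in> set_pmf R"
    have "ln (\<Prod>i<m. r (fst yw ! i) (\<gamma> i (snd yw))) = (\<Sum>i<m. ln (r (fst yw ! i) (\<gamma> i (snd yw))))"
      by (rule ln_prod) (auto simp: r0 less_imp_neq[OF r0, symmetric])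
    then show "- ln (?q yw) = - ln (pmf p (snd yw)) + (\<Sum>i<m. - ln (r (fst yw ! i) (\<gamma> i (snd yw))))"
      using ppos[OF \<open>yw \<in> set_pmf R\<close>] by (simp add: case_prod_beta' ln_mult_pos prod_pos r0 sum_negf)
  qed
  also have "\<dots> = pmf_entropy p + (\<Sum>i<m. expect R (\<lambda>yw. - ln (r (fst yw ! i) (\<gamma> i (snd yw)))))"
    using finR finp
    by (simp add: expect_add p pmf_entropy_expect Bochner_Integration.integral_sum integrable_measure_pmf_finite)
  also have "(\<Sum>i<m. expect R (\<lambda>yw. - ln (r (fst yw ! i) (\<gamma> i (snd yw))))) \<le> (\<Sum>i<m. - ln (1 - \<epsilon>) + \<epsilon> * ln (K / \<epsilon>))"
  proof (rule sum_mono)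
    fix i assume i: "i \<in> {..<m}"
    have fg: "simple_function M (\<lambda>x. (f x, g x))" by (rule simple_function_Pair[OF f g])
    let ?u = "\<lambda>yz. - ln (r (fst yz) (snd yz))"
    have "expect R (\<lambda>yw. - ln (r (fst yw ! i) (\<gamma> i (snd yw)))) = (\<integral>x. - ln (r (itin f m x ! i) (\<gamma> i (Z x))) \<partial>M)"
      unfolding R_def expect_law[OF P] by simp
    also have "\<dots> = (\<integral>x. ?u (f ((T ^^ i) x), g ((T ^^ i) x)) \<partial>M)"
      using i read by (intro Bochner_Integration.integral_cong) (auto simp: itin_def)
    also have "\<dots> = expect (law M (\<lambda>x. (f ((T ^^ i) x), g ((T ^^ i) x)))) ?u"
      by (rule expect_law[symmetric]) (intro simple_function_Pair simple_function_T_pow f g)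
    \<comment> \<open>By invariance every position has the same expected cost as position 0.\<close>
    also have "\<dots> = expect (law M (\<lambda>x. (f x, g x))) ?u"
      by (subst law_T_pow[OF fg]) simp
    also have "\<dots> \<le> expect (law M (\<lambda>x. (f x, g x))) (\<lambda>yz. - ln (1 - \<epsilon>) + ln (K / \<epsilon>) * (if fst yz \<noteq> snd yz then 1 else 0))"
    proof (rule expect_mono[OF set_law(2)[OF fg]])
      fix yz :: "'y \<times> 'y"
      have "0 \<le> - ln (1 - \<epsilon>)" using \<epsilon> by simp
      moreover have "- ln (\<epsilon> / K) = ln (K / \<epsilon>)" using \<epsilon> K by (simp add: ln_div)
      ultimately show "?u yz \<le> - ln (1 - \<epsilon>) + ln (K / \<epsilon>) * (if fst yz \<noteq> snd yz then 1 else 0)"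
        by (simp add: r_def)
    qed
    also have "\<dots> = - ln (1 - \<epsilon>) + ln (K / \<epsilon>) * measure_pmf.prob (law M (\<lambda>x. (f x, g x))) {yz. fst yz \<noteq> snd yz}"
      using set_law(2)[OF fg]
      by (subst expect_add) (simp_all add: expect_indicator[of _ "\<lambda>yz. fst yz \<noteq> snd yz", simplified])
    also have "measure_pmf.prob (law M (\<lambda>x. (f x, g x))) {yz. fst yz \<noteq> snd yz} = prob {x \<in> space M. f x \<noteq> g x}"
      unfolding measure_pmf_law[OF fg]
      by (subst measure_distr) (auto simp: measurable_simple_function[OF fg] intro!: arg_cong[where f = prob])
    also have "- ln (1 - \<epsilon>) + ln (K / \<epsilon>) * prob {x \<in> space M. f x \<noteq> g x} \<le> - ln (1 - \<epsilon>) + ln (K / \<epsilon>) * \<epsilon>"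
      using approx \<epsilon> K by (intro add_mono mult_left_mono) (auto intro!: ln_ge_zero simp: field_simps)
    finally show "expect R (\<lambda>yw. - ln (r (fst yw ! i) (\<gamma> i (snd yw)))) \<le> - ln (1 - \<epsilon>) + \<epsilon> * ln (K / \<epsilon>)"
      by (simp add: mult.commute)
  qed
  also have "\<dots> = real m * (- ln (1 - \<epsilon>) + \<epsilon> * ln (K / \<epsilon>))" by simp
  finally show ?thesis by (simp add: p_def K_def V_def)
qed

end

lemma channel_entropy_tendsto_0: "((\<lambda>\<epsilon>. - ln (1 - \<epsilon>) + \<epsilon> * ln (K / \<epsilon>)) \<longlongrightarrow> 0) (at_right (0::real))" if "0 < K"
  using that by real_asymp

section \<open>Entropy of the shift\<close>

lemma funpow_stl: "(stl ^^ m) s = sdrop m s"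
  by (induction m arbitrary: s) (simp_all add: funpow_swap1)

locale shift_measure = finite_free_product n G
  for n and G :: "nat \<Rightarrow> ('a, 'b) monoid_scheme" +
  fixes \<nu> :: "(nat \<times> 'a) stream measure"
  assumes invariant: "shift_invariant_prob n G \<nu>"
begin

lemma sets_nu: "sets \<nu> = sets N"
  using invariant by (simp add: shift_invariant_prob_def)

lemma space_nu [simp]: "space \<nu> = Linf"
  using sets_eq_imp_space_eq[OF sets_nu] by simp

sublocale measure_preserving \<nu> stl
  using invariant by (simp add: shift_invariant_prob_def measure_preserving_def measure_preserving_axioms_def)

lemma C_sets_nu: "C u \<in> sets \<nu>"
  unfolding sets_nu by (rule C_sets)

lemma simple_stake: "simple_function \<nu> (stake m)"
  unfolding simple_function_def
proof (intro conjI ballI)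
  show "finite (stake m ` space \<nu>)"
    by (rule finite_subset[OF _ finite_L_length[of m]]) (auto simp: stake_in_L)
  fix u assume "u \<in> stake m ` space \<nu>"
  then have "length u = m" by auto
  then have "stake m -` {u} \<inter> space \<nu> = C u" by (auto simp: in_C_iff)
  then show "stake m -` {u} \<inter> space \<nu> \<in> sets \<nu>" using C_sets_nu by simp
qed

lemma simple_stake_fun: "simple_function \<nu> (\<lambda>x. g (stake m x))"
  by (rule simple_function_compose1[OF simple_stake])

lemma simple_snth: "simple_function \<nu> (\<lambda>x. x !! m)"
  using simple_stake_fun[of last "Suc m"] by (simp add: stake_Suc del: stake.simps(2))

lemma simple_shd: "simple_function \<nu> shd"
  using simple_snth[of 0] by simp

section \<open>Approximation of measurable sets by finitely many coordinates\<close>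

definition stake_event :: "nat \<Rightarrow> (nat \<times> 'a) list set \<Rightarrow> (nat \<times> 'a) stream set" where
  "stake_event m D = {x \<in> Linf. stake m x \<in> D}"

lemma stake_event_sets: "stake_event m D \<in> sets \<nu>"
proof -
  have "stake m -` D \<inter> space \<nu> \<in> sets \<nu>"
    by (rule measurable_sets[OF measurable_simple_function[OF simple_stake]]) simp
  also have "stake m -` D \<inter> space \<nu> = stake_event m D" by (auto simp: stake_event_def)
  finally show ?thesis .
qed

lemma stake_event_lift: "m \<le> m' \<Longrightarrow> stake_event m D = stake_event m' {w. take m w \<in> D}"
  by (auto simp: stake_event_def take_stake min_def)

definition approximable :: "(nat \<times> 'a) stream set \<Rightarrow> bool" where
  "approximable B \<longleftrightarrow> B \<in> sets \<nu> \<and> (\<forall>e>0. \<exists>m D. prob ((B - stake_event m D) \<union> (stake_event m D - B)) < e)"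

lemma approximableD:
  assumes "approximable B" "0 < e" obtains m D where "prob ((B - stake_event m D) \<union> (stake_event m D - B)) < e"
  using assms unfolding approximable_def by blast

lemma approximable_Un:
  assumes "approximable B1" "approximable B2" shows "approximable (B1 \<union> B2)"
  unfolding approximable_def
proof (intro conjI allI impI)
  have sets: "B1 \<in> sets \<nu>" "B2 \<in> sets \<nu>" using assms by (auto simp: approximable_def)
  then show "B1 \<union> B2 \<in> sets \<nu>" by (rule sets.Un)
  fix e :: real assume "0 < e"
  then have "0 < e / 2" by simp
  obtain m1 D1 where 1: "prob ((B1 - stake_event m1 D1) \<union> (stake_event m1 D1 - B1)) < e / 2"
    by (rule approximableD[OF assms(1) \<open>0 < e / 2\<close>])
  obtain m2 D2 where 2: "prob ((B2 - stake_event m2 D2) \<union> (stake_event m2 D2 - B2)) < e / 2"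
    by (rule approximableD[OF assms(2) \<open>0 < e / 2\<close>])
  define m where "m = max m1 m2"
  define D where "D = {w. take m1 w \<in> D1} \<union> {w. take m2 w \<in> D2}"
  have "stake_event m D = stake_event m1 D1 \<union> stake_event m2 D2"
    using stake_event_lift[of m1 m D1] stake_event_lift[of m2 m D2] by (auto simp: m_def D_def stake_event_def)
  then have "prob ((B1 \<union> B2 - stake_event m D) \<union> (stake_event m D - (B1 \<union> B2)))
    \<le> prob (((B1 - stake_event m1 D1) \<union> (stake_event m1 D1 - B1)) \<union> ((B2 - stake_event m2 D2) \<union> (stake_event m2 D2 - B2)))"
    using sets stake_event_sets by (intro finite_measure_mono) auto
  also have "\<dots> \<le> prob ((B1 - stake_event m1 D1) \<union> (stake_event m1 D1 - B1)) + prob ((B2 - stake_event m2 D2) \<union> (stake_event m2 D2 - B2))"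
    using sets stake_event_sets by (intro measure_Un_le) auto
  also have "\<dots> < e" using 1 2 by simp
  finally show "\<exists>m D. prob ((B1 \<union> B2 - stake_event m D) \<union> (stake_event m D - (B1 \<union> B2))) < e" by blast
qed

lemma approximable_stake_event: "approximable (stake_event m D)"
  unfolding approximable_def
proof (intro conjI allI impI stake_event_sets)
  fix e :: real assume "0 < e"
  then show "\<exists>m' D'. prob ((stake_event m D - stake_event m' D') \<union> (stake_event m' D' - stake_event m D)) < e"
    by (intro exI[of _ m] exI[of _ D]) simp
qed

text \<open>Induction over the generated \<sigma>-algebra. Complements have the same symmetric
  differences, and a countable union is first cut down to a finite one of nearly full
  measure.\<close>

lemma approximable_sets: "B \<in> sets \<nu> \<Longrightarrow> approximable B"
  unfolding sets_nu sets_N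
proof (induction B rule: sigma_sets.induct)
  case (Basic B)
  then consider u where "B = C u" | "B = {}" by auto
  then show ?case
  proof cases
    case (1 u)
    then have "B = stake_event (length u) {u}" by (auto simp: stake_event_def in_C_iff)
    then show ?thesis using approximable_stake_event by simp
  next
    case 2
    then have "B = stake_event 0 {}" by (simp add: stake_event_def)
    then show ?thesis using approximable_stake_event by simp
  qed
next
  case Empty
  have "{} = stake_event 0 {}" by (simp add: stake_event_def)
  then show ?case using approximable_stake_event by metis
next
  case (Compl B)
  then have B: "B \<in> sets \<nu>" and ap: "\<And>e. 0 < e \<Longrightarrow> \<exists>m D. prob ((B - stake_event m D) \<union> (stake_event m D - B)) < e"
    by (auto simp: approximable_def)
  show ?case unfolding approximable_def
  proof (intro conjI allI impI)
    show "Linf - B \<in> sets \<nu>" using sets.compl_sets[OF B] by simp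
    fix e :: real assume "0 < e"
    from ap[OF this] obtain m D where "prob ((B - stake_event m D) \<union> (stake_event m D - B)) < e" by blast
    moreover have "(Linf - B - stake_event m (- D)) \<union> (stake_event m (- D) - (Linf - B)) = (B - stake_event m D) \<union> (stake_event m D - B)"
      using sets.sets_into_space[OF B] by (auto simp: stake_event_def)
    ultimately show "\<exists>m D. prob ((Linf - B - stake_event m D) \<union> (stake_event m D - (Linf - B))) < e"
      by (intro exI[of _ m] exI[of _ "- D"]) simp
  qed
next
  case (Union a)
  have sets: "a i \<in> sets \<nu>" for i using Union.IH[of i] by (simp add: approximable_def)
  have fin: "approximable (\<Union>i<j. a i)" for j
  proof (induction j)
    case 0
    have "(\<Union>i<0. a i) = stake_event 0 {}" by (simp add: stake_event_def)
    then show ?case using approximable_stake_event by metis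
  next
    case (Suc j)
    then show ?case using approximable_Un[OF Union.IH[of j] Suc] by (simp add: lessThan_Suc)
  qed
  show ?case unfolding approximable_def
  proof (intro conjI allI impI)
    show U: "(\<Union>i. a i) \<in> sets \<nu>" using sets by (intro sets.countable_UN) auto
    fix e :: real assume e: "0 < e"
    have "(\<lambda>j. prob (\<Union>i<j. a i)) \<longlonglongrightarrow> prob (\<Union>j. \<Union>i<j. a i)"
      using sets by (intro finite_Lim_measure_incseq) (auto simp: incseq_def intro: less_le_trans)
    moreover have "(\<Union>j. \<Union>i<j. a i) = (\<Union>i. a i)" by auto
    ultimately have "(\<lambda>j. prob (\<Union>i<j. a i)) \<longlonglongrightarrow> prob (\<Union>i. a i)" by simp
    then have "\<forall>\<^sub>F j in sequentially. prob (\<Union>i. a i) - e / 2 < prob (\<Union>i<j. a i)"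
      using e by (intro order_tendstoD(1)) auto
    then obtain j where j: "prob (\<Union>i. a i) - e / 2 < prob (\<Union>i<j. a i)"
      using eventually_sequentially_ex by blast
    have jU: "(\<Union>i<j. a i) \<in> sets \<nu>" using sets by (intro sets.finite_UN) auto
    have "prob ((\<Union>i. a i) - (\<Union>i<j. a i)) = prob (\<Union>i. a i) - prob (\<Union>i<j. a i)"
      by (rule finite_measure_Diff[OF U jU]) auto
    with j have small: "prob ((\<Union>i. a i) - (\<Union>i<j. a i)) < e / 2" by simp
    obtain m D where mD: "prob (((\<Union>i<j. a i) - stake_event m D) \<union> (stake_event m D - (\<Union>i<j. a i))) < e / 2"
      by (rule approximableD[OF fin[of j], of "e / 2"]) (use e in auto)
    have "prob (((\<Union>i. a i) - stake_event m D) \<union> (stake_event m D - (\<Union>i. a i)))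
      \<le> prob (((\<Union>i. a i) - (\<Union>i<j. a i)) \<union> (((\<Union>i<j. a i) - stake_event m D) \<union> (stake_event m D - (\<Union>i<j. a i))))"
      using U jU stake_event_sets by (intro finite_measure_mono) auto
    also have "\<dots> \<le> prob ((\<Union>i. a i) - (\<Union>i<j. a i)) + prob (((\<Union>i<j. a i) - stake_event m D) \<union> (stake_event m D - (\<Union>i<j. a i)))"
      using U jU stake_event_sets by (intro measure_Un_le) auto
    also have "\<dots> < e" using small mD by simp
    finally show "\<exists>m D. prob (((\<Union>i. a i) - stake_event m D) \<union> (stake_event m D - (\<Union>i. a i))) < e" by blast
  qed
qed

lemma approximate_simple_function:
  fixes f :: "(nat \<times> 'a) stream \<Rightarrow> nat"
  assumes f: "simple_function \<nu> f" and e: "0 < e"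
  obtains m g where "prob {x \<in> space \<nu>. f x \<noteq> g (stake m x)} \<le> e"
proof -
  define V where "V = f ` space \<nu>"
  have V: "finite V" "V \<noteq> {}" using f not_empty by (auto simp: V_def simple_function_def simp del: space_nu)
  have B: "{x \<in> space \<nu>. f x = v} \<in> sets \<nu>" for v
    using simple_functionD(2)[OF f, of "{v}"] by (simp add: vimage_def Int_def conj_commute)
  have "0 < e / real (card V)" using e V by (simp add: card_gt_0_iff)
  let ?Q = "\<lambda>v p. prob (({x \<in> space \<nu>. f x = v} - stake_event (fst p) (snd p)) \<union> (stake_event (fst p) (snd p) - {x \<in> space \<nu>. f x = v})) < e / real (card V)"
  have ex: "\<exists>p. ?Q v p" for v
  proof -
    obtain m D where "prob (({x \<in> space \<nu>. f x = v} - stake_event m D) \<union> (stake_event m D - {x \<in> space \<nu>. f x = v})) < e / real (card V)"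
      by (rule approximableD[OF approximable_sets[OF B] \<open>0 < e / real (card V)\<close>])
    then show ?thesis by (intro exI[of _ "(m, D)"]) simp
  qed
  define pp where "pp v = (SOME p. ?Q v p)" for v
  have pp: "?Q v (pp v)" for v unfolding pp_def by (rule someI_ex[OF ex])
  define mm where "mm v = fst (pp v)" for v
  define DD where "DD v = snd (pp v)" for v
  let ?\<Delta> = "\<lambda>v. ({x \<in> space \<nu>. f x = v} - stake_event (mm v) (DD v)) \<union> (stake_event (mm v) (DD v) - {x \<in> space \<nu>. f x = v})"
  have \<Delta>: "?\<Delta> v \<in> sets \<nu>" for v by (intro sets.Un sets.Diff B stake_event_sets)
  define m where "m = Max (mm ` V)"
  have m: "mm v \<le> m" if "v \<in> V" for v using that V by (simp add: m_def)
  \<comment> \<open>Outside the error sets exactly one label qualifies, namely the value of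
    \<open>f\<close>; inside them any value will do.\<close>
  define g where "g w = (SOME v. v \<in> V \<and> take (mm v) w \<in> DD v)" for w
  have sub: "{x \<in> space \<nu>. f x \<noteq> g (stake m x)} \<subseteq> (\<Union>v\<in>V. ?\<Delta> v)"
  proof (rule subsetI, rule ccontr)
    fix x assume x: "x \<in> {x \<in> space \<nu>. f x \<noteq> g (stake m x)}" and nx: "x \<notin> (\<Union>v\<in>V. ?\<Delta> v)"
    have iff: "f x = v \<longleftrightarrow> take (mm v) (stake m x) \<in> DD v" if "v \<in> V" for v
    proof -
      have "x \<in> stake_event (mm v) (DD v) \<longleftrightarrow> take (mm v) (stake m x) \<in> DD v"
        using x m[OF that] by (simp add: stake_event_def take_stake min_def)
      then show ?thesis using nx x that by blast
    qed
    have fx: "f x \<in> V" using x by (simp add: V_def)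
    have "g (stake m x) = f x"
      unfolding g_def by (rule some_equality) (use iff fx in auto)
    then show False using x by simp
  qed
  have "prob {x \<in> space \<nu>. f x \<noteq> g (stake m x)} \<le> prob (\<Union>v\<in>V. ?\<Delta> v)"
    by (rule finite_measure_mono[OF sub sets.finite_UN[OF V(1) \<Delta>]])
  also have "\<dots> \<le> (\<Sum>v\<in>V. prob (?\<Delta> v))"
    by (rule finite_measure_subadditive_finite[OF V(1)]) (use \<Delta> in blast)
  also have "\<dots> \<le> (\<Sum>v\<in>V. e / real (card V))"
    using pp by (intro sum_mono) (simp only: less_imp_le mm_def DD_def)
  also have "\<dots> = e" using V by simp
  finally show ?thesis by (rule that)
qed

lemma itin_shd: "itin shd m = stake m"
proof
  fix s show "itin shd m s = stake m s"
    by (rule nth_equalityI) (simp_all add: itin_def funpow_stl)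
qed

definition block_entropy :: "nat \<Rightarrow> real" where "block_entropy m = pmf_entropy (law \<nu> (stake m))"

lemma block_entropy_add: "block_entropy (m + l) \<le> block_entropy m + block_entropy l"
  using itin_entropy_add[OF simple_shd, of m l] by (simp add: block_entropy_def itin_shd)

definition entropy_rate :: real where "entropy_rate = lim (\<lambda>m. block_entropy m / real m)"

lemma entropy_rate_lim: "(\<lambda>m. block_entropy m / real m) \<longlonglongrightarrow> entropy_rate"
proof -
  obtain entropy_rate' where "(\<lambda>m. block_entropy m / real m) \<longlonglongrightarrow> entropy_rate'"
    using itin_entropy_lim[OF simple_shd] by (auto simp: block_entropy_def itin_shd)
  then show ?thesis by (simp add: entropy_rate_def limI)
qed

text \<open>The partition by the first letter is generating: \<open>f\<close> is close to a function
  of the first \<open>l\<close> letters, whose itinerary of length m is read off from m + l letters.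
  The block of \<open>l\<close> extra letters is negligible as m grows, and then \<epsilon> tends to
  0.\<close>

lemma itin_entropy_rate_le:
  fixes f :: "(nat \<times> 'a) stream \<Rightarrow> nat"
  assumes f: "simple_function \<nu> f"
    and hf: "(\<lambda>m. pmf_entropy (law \<nu> (itin f m)) / real m) \<longlonglongrightarrow> hf"
  shows "hf \<le> entropy_rate"
proof -
  define K where "K = real (card (f ` space \<nu>))"
  define \<delta> where "\<delta> \<epsilon> = - ln (1 - \<epsilon>) + \<epsilon> * ln (K / \<epsilon>)" for \<epsilon>
  have K: "0 < K" using f not_empty by (auto simp: K_def simple_function_def card_gt_0_iff simp del: space_nu)
  have le: "hf - entropy_rate \<le> \<delta> \<epsilon>" if \<epsilon>: "0 < \<epsilon>" "\<epsilon> < 1" for \<epsilon>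
  proof -
    obtain l g where g: "prob {x \<in> space \<nu>. f x \<noteq> g (stake l x)} \<le> \<epsilon>"
      using approximate_simple_function[OF f \<epsilon>(1)] by blast
    have bound: "pmf_entropy (law \<nu> (itin f m)) \<le> block_entropy m + block_entropy l + real m * \<delta> \<epsilon>" for m
    proof -
      have "pmf_entropy (law \<nu> (itin f m)) \<le> pmf_entropy (law \<nu> (stake (m + l))) + real m * \<delta> \<epsilon>"
        unfolding \<delta>_def K_def
      proof (rule itin_entropy_le[OF f simple_stake_fun simple_stake _ \<epsilon> g])
        fix i and x :: "(nat \<times> 'a) stream" assume "i < m"
        then have "stake l (sdrop i x) = take l (drop i (stake (m + l) x))"
          by (simp add: drop_stake take_stake min_def)
        then show "g (stake l ((stl ^^ i) x)) = (\<lambda>i w. g (take l (drop i w))) i (stake (m + l) x)"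
          by (simp add: funpow_stl)
      qed
      then show ?thesis using block_entropy_add[of m l] by (simp add: block_entropy_def)
    qed
    have "(\<lambda>m. block_entropy m / real m + block_entropy l / real m + \<delta> \<epsilon>) \<longlonglongrightarrow> entropy_rate + 0 + \<delta> \<epsilon>"
      by (intro tendsto_add entropy_rate_lim lim_const_over_n tendsto_const)
    then have lim: "(\<lambda>m. block_entropy m / real m + block_entropy l / real m + \<delta> \<epsilon>) \<longlonglongrightarrow> entropy_rate + \<delta> \<epsilon>" by simp
    have "hf \<le> entropy_rate + \<delta> \<epsilon>"
    proof (rule LIMSEQ_le[OF hf lim], intro exI[of _ 1] allI impI)
      fix m :: nat assume m: "1 \<le> m"
      have "pmf_entropy (law \<nu> (itin f m)) / real m \<le> (block_entropy m + block_entropy l + real m * \<delta> \<epsilon>) / real m"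
        by (rule divide_right_mono[OF bound]) simp
      then show "pmf_entropy (law \<nu> (itin f m)) / real m \<le> block_entropy m / real m + block_entropy l / real m + \<delta> \<epsilon>"
        using m by (simp add: add_divide_distrib)
    qed
    then show ?thesis by simp
  qed
  have ev: "\<forall>\<^sub>F \<epsilon> in at_right (0::real). hf - entropy_rate \<le> \<delta> \<epsilon>"
    using eventually_at_right_real[OF zero_less_one] by eventually_elim (rule le; simp)
  have lim: "(\<delta> \<longlongrightarrow> 0) (at_right 0)"
    unfolding \<delta>_def by (rule channel_entropy_tendsto_0[OF K])
  have "hf - entropy_rate \<le> 0" by (rule tendsto_lowerbound[OF lim ev]) simp
  then show ?thesis by simp
qed

lemma ks_entropy_eq: "ks_entropy \<nu> stl = ereal entropy_rate"
  unfolding ks_entropy_def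
proof (rule antisym)
  have part: "partition_entropy \<nu> (\<lambda>x. map (\<lambda>i. f ((stl ^^ i) x)) [0..<m]) = pmf_entropy (law \<nu> (itin f m))"
    if "simple_function \<nu> f" for f :: "(nat \<times> 'a) stream \<Rightarrow> nat" and m
    using partition_entropy_law[OF simple_function_itin[OF that, of m]] by (simp add: itin_def[abs_def])
  show "(SUP f\<in>{f :: _ \<Rightarrow> nat. simple_function \<nu> f}.
    ereal (lim (\<lambda>m. partition_entropy \<nu> (\<lambda>x. map (\<lambda>i. f ((stl ^^ i) x)) [0..<m]) / real m))) \<le> ereal entropy_rate"
  proof (rule SUP_least)
    fix f :: "(nat \<times> 'a) stream \<Rightarrow> nat" assume "f \<in> {f. simple_function \<nu> f}"
    then have f: "simple_function \<nu> f" by simp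
    obtain hf where hf: "(\<lambda>m. pmf_entropy (law \<nu> (itin f m)) / real m) \<longlonglongrightarrow> hf"
      using itin_entropy_lim[OF f] by blast
    then show "ereal (lim (\<lambda>m. partition_entropy \<nu> (\<lambda>x. map (\<lambda>i. f ((stl ^^ i) x)) [0..<m]) / real m)) \<le> ereal entropy_rate"
      using itin_entropy_rate_le[OF f hf] by (simp add: part[OF f] limI[OF hf])
  qed
  \<comment> \<open>The supremum is over partitions labelled by natural numbers, so the letters have
    to be numbered.\<close>
  define f where "f x = to_nat_on A (shd x)" for x
  have f: "simple_function \<nu> f" unfolding f_def by (rule simple_function_compose1[OF simple_shd])
  have inj: "inj_on (to_nat_on A) A" by (rule inj_on_to_nat_on) (simp add: countable_finite)
  have "pmf_entropy (law \<nu> (itin f m)) = block_entropy m" for m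
  proof -
    have "itin f m = (\<lambda>x. map (to_nat_on A) (stake m x))"
      by (rule ext) (simp add: itin_shd[symmetric] itin_def f_def)
    then have "law \<nu> (itin f m) = map_pmf (map (to_nat_on A)) (law \<nu> (stake m))"
      by (simp only: law_map[OF simple_stake])
    moreover have "inj_on (map (to_nat_on A)) (set_pmf (law \<nu> (stake m)))"
    proof (rule inj_on_subset[OF inj_on_mapI])
      show "inj_on (to_nat_on A) (\<Union> (set ` lists A))" by (rule inj_on_subset[OF inj]) auto
      show "set_pmf (law \<nu> (stake m)) \<subseteq> lists A"
      proof
        fix u assume "u \<in> set_pmf (law \<nu> (stake m))"
        then obtain x where "x \<in> Linf" "u = stake m x"
          using set_law(1)[OF simple_stake, of m] by auto
        then show "u \<in> lists A" using stake_in_L L_lists by blast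
      qed
    qed
    ultimately show ?thesis by (simp add: block_entropy_def pmf_entropy_map_inj set_law(2)[OF simple_stake])
  qed
  then have "lim (\<lambda>m. partition_entropy \<nu> (\<lambda>x. map (\<lambda>i. f ((stl ^^ i) x)) [0..<m]) / real m) = entropy_rate"
    by (simp add: part[OF f] entropy_rate_def)
  then show "ereal entropy_rate \<le> (SUP f\<in>{f :: _ \<Rightarrow> nat. simple_function \<nu> f}.
    ereal (lim (\<lambda>m. partition_entropy \<nu> (\<lambda>x. map (\<lambda>i. f ((stl ^^ i) x)) [0..<m]) / real m)))"
    using f by (intro SUP_upper2[of f]) auto
qed

end

section \<open>The measure of maximal entropy\<close>

context finite_free_product
begin

text \<open>The entry r b / (\<rho> * r a) of Parry's stochastic matrix for the eigenvector r = 1 /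
  (\<rho> + k); it is meant for letters that may be adjacent.\<close>

definition parry_transition :: "nat \<times> 'a \<Rightarrow> nat \<times> 'a \<Rightarrow> real" where
  "parry_transition a b = (\<rho> + k (fst a)) / (\<rho> * (\<rho> + k (fst b)))"

lemma parry_transition_pos: "0 < parry_transition a b"
  using rho_pos rho_k_pos by (simp add: parry_transition_def)

lemma sum_parry_transition:
  assumes "u \<in> L" "u \<noteq> []" shows "(\<Sum>a\<in>ext u. parry_transition (last u) a) = 1"
proof -
  obtain v b where u: "u = v @ [b]" using assms(2) by (metis rev_exhaust)
  have b: "b \<in> A" "fst b < n" using assms u by (auto simp: snoc_in_L letters_iff)
  have "(\<Sum>a\<in>ext u. parry_transition (last u) a) = (\<Sum>a\<in>A - letters_at G (fst b). (\<rho> + k (fst b)) / \<rho> * (1 / (\<rho> + k (fst a))))"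
    unfolding u ext_snoc[OF b(1)] by (simp add: parry_transition_def)
  also have "\<dots> = (\<rho> + k (fst b)) / \<rho> * (\<rho> / (\<rho> + k (fst b)))"
    unfolding sum_distrib_left[symmetric] sum_rho_diff[OF b(2)] ..
  also have "\<dots> = 1" using rho_pos rho_k_pos[of "fst b"] by simp
  finally show ?thesis .
qed

abbreviation Z :: real where "Z \<equiv> total_weight n G"

definition parry_weight :: "(nat \<times> 'a) list \<Rightarrow> real" where
  "parry_weight u = cylinder_weight n G (fst (hd u)) (length u) (fst (last u)) / Z"

lemma cylinder_weight_eq:
  "cylinder_weight n G i l j = \<rho>\<^sup>2 / (\<rho> ^ l * (\<rho> + k i) * (\<rho> + k j))"
proof -
  have "\<rho> powi (int l - 2) = \<rho> ^ l / \<rho>\<^sup>2"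
    using rho_pos by (simp add: power_int_diff)
  then show ?thesis by (simp add: cylinder_weight_def)
qed

lemma Z_eq: "Z = \<rho> * (\<Sum>a\<in>A. 1 / (\<rho> + k (fst a))\<^sup>2)"
  using rho_pos by (simp add: total_weight_def cylinder_weight_eq sum_distrib_left power2_eq_square)

lemma Z_pos: "0 < Z"
proof -
  have "letters_at G 0 \<subseteq> A" "letters_at G 0 \<noteq> {}" using two_le letters_at_subset letters_at_nonempty by auto
  then have "A \<noteq> {}" by auto
  then have "0 < (\<Sum>a\<in>A. 1 / (\<rho> + k (fst a))\<^sup>2)"
    using rho_k_pos by (intro sum_pos) (auto simp: less_imp_neq[symmetric])
  then show ?thesis using rho_pos by (simp add: Z_eq)
qed

lemma parry_weight_eq: "parry_weight u = \<rho>\<^sup>2 / (\<rho> ^ length u * (\<rho> + k (fst (hd u))) * (\<rho> + k (fst (last u)))) / Z"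
  by (simp add: parry_weight_def cylinder_weight_eq)

lemma parry_weight_pos: "0 < parry_weight u"
  using rho_pos rho_k_pos Z_pos by (simp add: parry_weight_eq)

lemma parry_weight_snoc: "u \<noteq> [] \<Longrightarrow> parry_weight (u @ [a]) = parry_weight u * parry_transition (last u) a"
  using rho_k_pos[of "fst (last u)"] rho_pos by (simp add: parry_weight_eq parry_transition_def)

text \<open>Adjacency is symmetric, so the identity behind extension to the right also governs
  extension to the left. This becomes shift invariance.\<close>

lemma parry_weight_Cons_sum:
  assumes "u \<in> L" "u \<noteq> []"
  shows "(\<Sum>a\<in>A - letters_at G (fst (hd u)). parry_weight (a # u)) = parry_weight u"
proof -
  have j: "fst (hd u) < n" using assms by (metis L_letters hd_in_set letters_iff)
  define c where "c = \<rho>\<^sup>2 / (\<rho> ^ Suc (length u) * (\<rho> + k (fst (last u)))) / Z"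
  have "parry_weight (a # u) = c * (1 / (\<rho> + k (fst a)))" for a
    using assms(2) by (simp add: parry_weight_eq c_def)
  then have "(\<Sum>a\<in>A - letters_at G (fst (hd u)). parry_weight (a # u)) = c * (\<rho> / (\<rho> + k (fst (hd u))))"
    by (simp only: sum_distrib_left[symmetric] sum_rho_diff[OF j])
  also have "\<dots> = parry_weight u" using rho_pos by (simp add: c_def parry_weight_eq)
  finally show ?thesis .
qed

lemma sum_parry_weight_letters: "(\<Sum>a\<in>A. parry_weight [a]) = 1"
proof -
  have "(\<Sum>a\<in>A. parry_weight [a]) = (\<Sum>a\<in>A. cylinder_weight n G (fst a) 1 (fst a)) / Z"
    by (simp add: parry_weight_def sum_divide_distrib)
  also have "\<dots> = 1" using Z_pos by (simp add: total_weight_def)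
  finally show ?thesis .
qed

lemma C_snoc_subset: "C (u @ [a]) \<subseteq> C u"
proof
  fix s assume "s \<in> C (u @ [a])"
  then have "s \<in> Linf" "stake (length u) s @ [s !! length u] = u @ [a]"
    unfolding in_C_iff length_append list.size add_0 add_Suc_right add_0_right stake_Suc by blast+
  then show "s \<in> C u" unfolding in_C_iff append1_eq_conv by blast
qed

text \<open>Being reduced is a condition on neighbouring letters, so the forbidden factors are the
  pairs from one factor group.\<close>

lemma subshift_of_finite_type_words: "subshift_of_finite_type A Linf"
  unfolding subshift_of_finite_type_def
proof (intro conjI exI[of _ "{w. \<exists>a b. w = [a, b] \<and> a \<in> A \<and> b \<in> A \<and> fst a = fst b}"])
  let ?F = "{w. \<exists>a b. w = [a, b] \<and> a \<in> A \<and> b \<in> A \<and> fst a = fst b}"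
  have "?F \<subseteq> (\<lambda>(a, b). [a, b]) ` (A \<times> A)" by auto
  then show "finite ?F" by (rule finite_subset) simp
  show "?F \<subseteq> lists A" by auto
  have words: "(\<forall>m. stake m s \<in> L) \<longleftrightarrow> (\<forall>m. fst (s !! m) \<noteq> fst (s !! Suc m))" if s: "s \<in> streams A" for s
  proof -
    have A: "s !! i \<in> A" for i using s by (simp add: streams_iff_snth)
    have step: "stake (Suc (Suc m)) s \<in> L \<longleftrightarrow> stake (Suc m) s \<in> L \<and> fst (s !! m) \<noteq> fst (s !! Suc m)" for m
      unfolding stake_Suc[of "Suc m"] snoc_in_L using A[of "Suc m"]
      by (simp add: stake_Suc del: stake.simps(2) snth.simps(2))
    have one: "stake (Suc 0) s \<in> L" using A[of 0] by (simp add: Cons_in_L)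
    show ?thesis
    proof
      assume "\<forall>m. stake m s \<in> L"
      then show "\<forall>m. fst (s !! m) \<noteq> fst (s !! Suc m)" using step by blast
    next
      assume *: "\<forall>m. fst (s !! m) \<noteq> fst (s !! Suc m)"
      have "stake (Suc m) s \<in> L" for m
      proof (induction m)
        case 0 show ?case by (rule one)
      next
        case (Suc m) then show ?case using step * by blast
      qed
      then show "\<forall>m. stake m s \<in> L" by (metis Nil_in_L not0_implies_Suc stake.simps(1))
    qed
  qed
  have forb: "(\<forall>w\<in>?F. stake (length w) (sdrop m s) \<noteq> w) \<longleftrightarrow> fst (s !! m) \<noteq> fst (s !! Suc m)"
    if s: "s \<in> streams A" for s m
  proof -
    have A: "s !! i \<in> A" for i using s by (simp add: streams_iff_snth)
    have two: "stake (length [a, b]) (sdrop m s) = [s !! m, s !! Suc m]" for a b :: "nat \<times> 'a"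
      by (simp add: sdrop_simps)
    show ?thesis
    proof
      assume *: "\<forall>w\<in>?F. stake (length w) (sdrop m s) \<noteq> w"
      show "fst (s !! m) \<noteq> fst (s !! Suc m)"
      proof
        assume "fst (s !! m) = fst (s !! Suc m)"
        then have "[s !! m, s !! Suc m] \<in> ?F" using A by blast
        with * two show False by blast
      qed
    next
      assume ne: "fst (s !! m) \<noteq> fst (s !! Suc m)"
      show "\<forall>w\<in>?F. stake (length w) (sdrop m s) \<noteq> w"
      proof
        fix w assume "w \<in> ?F"
        then obtain a b where w: "w = [a, b]" "fst a = fst b" by blast
        then show "stake (length w) (sdrop m s) \<noteq> w" using ne two[of a b] by (metis list.inject)
      qed
    qed
  qed
  show "Linf = {s \<in> streams A. \<forall>m. \<forall>w\<in>?F. stake (length w) (sdrop m s) \<noteq> w}"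
    unfolding infinite_words_def
  proof (rule Set.set_eqI)
    fix s show "s \<in> {s \<in> streams A. \<forall>m. stake m s \<in> L} \<longleftrightarrow>
      s \<in> {s \<in> streams A. \<forall>m. \<forall>w\<in>?F. stake (length w) (sdrop m s) \<noteq> w}"
    proof (cases "s \<in> streams A")
      case True
      show ?thesis unfolding mem_Collect_eq words[OF True] forb[OF True] by (rule refl)
    qed simp
  qed
qed simp

end

context shift_measure
begin

lemma pmf_stake: "length u = m \<Longrightarrow> pmf (law \<nu> (stake m)) u = prob (C u)"
proof -
  assume u: "length u = m"
  then have "{x \<in> space \<nu>. stake m x = u} = C u" by (auto simp: in_C_iff)
  then show ?thesis by (simp add: pmf_law[OF simple_stake])
qed

lemma set_stake: "u \<in> set_pmf (law \<nu> (stake m)) \<Longrightarrow> u \<in> L \<and> length u = m"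
  using set_law(1)[OF simple_stake, of m] by (auto simp: stake_in_L)

lemma sum_prob_C: "(\<Sum>u\<in>{u\<in>L. length u = m}. prob (C u)) = 1"
proof -
  have "(\<Sum>u\<in>{u\<in>L. length u = m}. prob (C u)) = (\<Sum>u\<in>{u\<in>L. length u = m}. pmf (law \<nu> (stake m)) u)"
    by (rule sum.cong) (auto simp: pmf_stake)
  also have "\<dots> = 1"
    by (rule sum_pmf_eq_1[OF finite_L_length]) (auto dest: set_stake)
  finally show ?thesis .
qed

text \<open>A block of length m + 2 is split into first letter, middle block and last letter. By
  invariance the middle block and the tail are distributed like initial blocks of the same
  lengths.\<close>

lemma block_entropy_submodular: "block_entropy (Suc (Suc m)) + block_entropy m \<le> block_entropy (Suc m) + block_entropy (Suc m)"
proof -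
  let ?F = "\<lambda>s. (shd s, stake m (stl s), stl s !! m)"
  have st: "simple_function \<nu> (\<lambda>s. stake j (stl s))" for j
    using simple_function_T_pow[OF simple_stake, of j 1] by simp
  have F: "simple_function \<nu> ?F"
    using simple_function_Pair[OF simple_shd simple_function_Pair[OF st[of m] simple_snth[of "Suc m"]]] by simp
  define R where "R = law \<nu> ?F"
  have fin: "finite (set_pmf R)" unfolding R_def by (rule set_law(2)[OF F])
  have shift: "law \<nu> (\<lambda>s. stake j (stl s)) = law \<nu> (stake j)" for j
    using law_T_pow[OF simple_stake, of j 1] by simp
  have y: "map_pmf (\<lambda>(x, y, z). y) R = law \<nu> (stake m)"
    unfolding R_def law_map[OF F] by (simp add: shift)
  have "law \<nu> (stake (Suc m)) = map_pmf (\<lambda>(x, y, z). x # y) R"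
    unfolding R_def law_map[OF F] by (intro law_cong) simp
  then have "law \<nu> (stake (Suc m)) = map_pmf (\<lambda>(x, y). x # y) (map_pmf (\<lambda>(x, y, z). (x, y)) R)"
    by (simp add: map_pmf_comp case_prod_beta')
  then have xy: "block_entropy (Suc m) = pmf_entropy (map_pmf (\<lambda>(x, y, z). (x, y)) R)"
    unfolding block_entropy_def using fin by (simp only:) (intro pmf_entropy_map_inj, auto simp: inj_on_def)
  have "law \<nu> (stake (Suc m)) = map_pmf (\<lambda>(x, y, z). y @ [z]) R"
    unfolding R_def law_map[OF F] shift[symmetric, of "Suc m"] stake_Suc by (intro law_cong) simp
  then have "law \<nu> (stake (Suc m)) = map_pmf (\<lambda>(y, z). y @ [z]) (map_pmf (\<lambda>(x, y, z). (y, z)) R)"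
    by (simp add: map_pmf_comp case_prod_beta')
  then have yz: "block_entropy (Suc m) = pmf_entropy (map_pmf (\<lambda>(x, y, z). (y, z)) R)"
    unfolding block_entropy_def using fin by (simp only:) (intro pmf_entropy_map_inj, auto simp: inj_on_def)
  have "stake (Suc (Suc m)) s = shd s # stake m (stl s) @ [stl s !! m]" for s :: "(nat \<times> 'a) stream"
    by (simp only: stake.simps(2)[of "Suc m" s] stake_Suc[of m "stl s"])
  then have "law \<nu> (stake (Suc (Suc m))) = map_pmf (\<lambda>(x, y, z). x # y @ [z]) R"
    unfolding R_def law_map[OF F] by (intro law_cong) simp
  then have xyz: "block_entropy (Suc (Suc m)) = pmf_entropy R"
    unfolding block_entropy_def using fin by (simp only:) (intro pmf_entropy_map_inj, auto simp: inj_on_def)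
  show ?thesis
    using pmf_entropy_submodular[OF fin] unfolding y xy[symmetric] yz[symmetric] xyz[symmetric] block_entropy_def[symmetric] .
qed

text \<open>The increments decrease, so each of them bounds the average of all later ones.\<close>

lemma entropy_rate_le_increment: "entropy_rate \<le> block_entropy (Suc m) - block_entropy m"
proof -
  define c where "c j = block_entropy (Suc j) - block_entropy j" for j
  have dec: "decseq c" using block_entropy_submodular by (intro decseq_SucI) (simp add: c_def algebra_simps)
  have bound: "block_entropy (m + j) \<le> block_entropy m + real j * c m" for j
  proof (induction j)
    case (Suc j)
    have "block_entropy (m + Suc j) = block_entropy (m + j) + c (m + j)" by (simp add: c_def)
    also have "c (m + j) \<le> c m" using dec by (simp add: decseq_def)
    finally show ?case using Suc by (simp add: algebra_simps)
  qed simp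
  have "(\<lambda>j. (block_entropy m - real m * c m) / real j + c m) \<longlonglongrightarrow> 0 + c m"
    by (intro tendsto_add lim_const_over_n tendsto_const)
  then have lim: "(\<lambda>j. (block_entropy m - real m * c m) / real j + c m) \<longlonglongrightarrow> c m" by simp
  have "entropy_rate \<le> c m"
  proof (rule LIMSEQ_le[OF entropy_rate_lim lim], intro exI[of _ "Suc m"] allI impI)
    fix j assume j: "Suc m \<le> j"
    then have "block_entropy j \<le> block_entropy m + (real j - real m) * c m" using bound[of "j - m"] by (simp add: of_nat_diff)
    then have "block_entropy j / real j \<le> (block_entropy m + (real j - real m) * c m) / real j" by (rule divide_right_mono) simp
    also have "\<dots> = (block_entropy m - real m * c m) / real j + c m" using j by (simp add: field_simps)
    finally show "block_entropy j / real j \<le> (block_entropy m - real m * c m) / real j + c m" .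
  qed
  then show ?thesis by (simp add: c_def)
qed

definition markov_weight :: "(nat \<times> 'a) list \<Rightarrow> real" where
  "markov_weight w = prob (C (butlast w)) * parry_transition (last (butlast w)) (last w)"

lemma markov_weight_snoc: "markov_weight (u @ [a]) = prob (C u) * parry_transition (last u) a"
  by (simp add: markov_weight_def)

lemma sum_markov_weight:
  assumes "1 \<le> m" shows "(\<Sum>w\<in>{w\<in>L. length w = Suc m}. markov_weight w) = 1"
proof -
  have "(\<Sum>w\<in>{w\<in>L. length w = Suc m}. markov_weight w) = (\<Sum>u\<in>{u\<in>L. length u = m}. prob (C u) * (\<Sum>a\<in>ext u. parry_transition (last u) a))"
    unfolding sum_words_Suc markov_weight_snoc sum_distrib_left ..
  also have "\<dots> = (\<Sum>u\<in>{u\<in>L. length u = m}. prob (C u))"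
  proof (rule sum.cong)
    fix u assume u: "u \<in> {u\<in>L. length u = m}"
    then have "u \<noteq> []" using assms by auto
    then show "prob (C u) * (\<Sum>a\<in>ext u. parry_transition (last u) a) = prob (C u)" using u by (simp add: sum_parry_transition)
  qed simp
  finally show ?thesis by (simp add: sum_prob_C)
qed

lemma markov_weight_pos: "w \<in> set_pmf (law \<nu> (stake (Suc m))) \<Longrightarrow> 0 < markov_weight w"
proof -
  assume w: "w \<in> set_pmf (law \<nu> (stake (Suc m)))"
  then obtain u a where ua: "w = u @ [a]" using set_stake[OF w] by (cases w rule: rev_cases) auto
  have "0 < prob (C w)" using pmf_positive[OF w] set_stake[OF w] by (simp add: pmf_stake)
  also have "\<dots> \<le> prob (C u)" unfolding ua by (rule finite_measure_mono[OF C_snoc_subset C_sets_nu])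
  finally show ?thesis using parry_transition_pos by (simp add: ua markov_weight_snoc)
qed

text \<open>The logarithm of a Parry transition is - ln \<rho> plus the difference of \<phi> at two
  successive letters. By invariance both letters have the same law, so the difference has mean
  zero.\<close>

lemma expect_markov_weight:
  assumes m: "1 \<le> m"
  shows "expect (law \<nu> (stake (Suc m))) (\<lambda>w. - ln (markov_weight w)) = block_entropy m + ln \<rho>"
proof -
  let ?P = "law \<nu> (stake (Suc m))" and ?\<phi> = "\<lambda>a. ln (\<rho> + k (fst a))"
  have fin: "finite (set_pmf (law \<nu> (stake j)))" for j by (rule set_law(2)[OF simple_stake])
  have "expect ?P (\<lambda>w. - ln (markov_weight w)) =
    expect ?P (\<lambda>w. - ln (prob (C (butlast w))) + (ln \<rho> + (?\<phi> (last w) - ?\<phi> (last (butlast w)))))"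
  proof (rule expect_cong)
    fix w assume "w \<in> set_pmf ?P"
    then have "0 < markov_weight w" by (rule markov_weight_pos)
    then have "0 < prob (C (butlast w))" using parry_transition_pos by (simp add: markov_weight_def zero_less_mult_iff)
    then show "- ln (markov_weight w) = - ln (prob (C (butlast w))) + (ln \<rho> + (?\<phi> (last w) - ?\<phi> (last (butlast w))))"
      using rho_pos rho_k_pos by (simp add: markov_weight_def parry_transition_def ln_mult_pos ln_div)
  qed
  also have "\<dots> = expect ?P (\<lambda>w. - ln (prob (C (butlast w)))) + (ln \<rho> + (expect ?P (\<lambda>w. ?\<phi> (last w)) - expect ?P (\<lambda>w. ?\<phi> (last (butlast w)))))"
    unfolding expect_add[OF fin] expect_diff[OF fin] by simp
  also have "expect ?P (\<lambda>w. - ln (prob (C (butlast w)))) = block_entropy m"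
  proof -
    have "map_pmf butlast ?P = law \<nu> (stake m)"
      unfolding law_map[OF simple_stake] stake_Suc by simp
    then have "expect ?P (\<lambda>w. - ln (prob (C (butlast w)))) = expect (law \<nu> (stake m)) (\<lambda>u. - ln (prob (C u)))"
      using integral_map_pmf[of butlast ?P "\<lambda>u. - ln (prob (C u))"] by simp
    also have "\<dots> = expect (law \<nu> (stake m)) (\<lambda>u. - ln (pmf (law \<nu> (stake m)) u))"
      by (rule expect_cong) (use set_stake pmf_stake in force)
    finally show ?thesis by (simp only: block_entropy_def pmf_entropy_expect[OF fin])
  qed
  also have "expect ?P (\<lambda>w. ?\<phi> (last w)) = expect ?P (\<lambda>w. ?\<phi> (last (butlast w)))"
  proof -
    have snth: "law \<nu> (\<lambda>s. s !! j) = law \<nu> shd" for j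
      using law_T_pow[OF simple_shd, of j] by (simp add: funpow_stl)
    have "map_pmf last ?P = law \<nu> (\<lambda>s. s !! m)"
      unfolding law_map[OF simple_stake] stake_Suc by simp
    moreover have "map_pmf (\<lambda>w. last (butlast w)) ?P = law \<nu> (\<lambda>s. s !! (m - 1))"
    proof -
      obtain j where j: "m = Suc j" using m by (cases m) auto
      have "last (butlast (stake (Suc m) s)) = s !! (m - 1)" for s :: "(nat \<times> 'a) stream"
        unfolding stake_Suc[of m] butlast_snoc unfolding j stake_Suc last_snoc by simp
      then show ?thesis unfolding law_map[OF simple_stake] by (intro law_cong)
    qed
    ultimately have "map_pmf last ?P = map_pmf (\<lambda>w. last (butlast w)) ?P" by (simp add: snth)
    then have "expect (map_pmf last ?P) ?\<phi> = expect (map_pmf (\<lambda>w. last (butlast w)) ?P) ?\<phi>" by simp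
    then show ?thesis by simp
  qed
  finally show ?thesis by (simp only: diff_self add_0_right)
qed

text \<open>Gibbs' inequality against the Markov extension of the block distribution. Equality for all block
  lengths forces the measure to be Markov with the Parry transitions.\<close>

lemma increment_le: "1 \<le> m \<Longrightarrow> block_entropy (Suc m) - block_entropy m \<le> ln \<rho>"
  and markov: "\<lbrakk>ln \<rho> \<le> entropy_rate; u \<in> L; u \<noteq> []; a \<in> ext u\<rbrakk> \<Longrightarrow> prob (C (u @ [a])) = prob (C u) * parry_transition (last u) a"
proof -
  let ?P = "\<lambda>m. law \<nu> (stake (Suc m))"
  have fin: "finite (set_pmf (?P m))" for m by (rule set_law(2)[OF simple_stake])
  have sub: "set_pmf (?P m) \<subseteq> {w\<in>L. length w = Suc m}" for m by (auto dest: set_stake)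
  have q0: "0 \<le> markov_weight w" for w using parry_transition_pos[of "last (butlast w)" "last w"] by (simp add: markov_weight_def)
  have sum_le: "(\<Sum>w\<in>set_pmf (?P m). markov_weight w) \<le> 1" if "1 \<le> m" for m
    unfolding sum_markov_weight[OF that, symmetric] by (rule sum_mono2[OF finite_L_length sub]) (rule q0)
  show le: "block_entropy (Suc m) - block_entropy m \<le> ln \<rho>" if m: "1 \<le> m" for m
    using gibbs_inequality(1)[where p = "?P m" and q = markov_weight, OF fin markov_weight_pos[of _ m] sum_le[OF m]] expect_markov_weight[OF m]
    by (simp add: block_entropy_def)
  assume entropy_rate: "ln \<rho> \<le> entropy_rate" and u: "u \<in> L" "u \<noteq> []" and a: "a \<in> ext u"
  define m where "m = length u"
  have m: "1 \<le> m" using u by (simp add: m_def Suc_le_eq)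
  let ?w = "u @ [a]"
  have wL: "?w \<in> L" using u a by (auto simp: snoc_in_L ext_def)
  have "block_entropy (Suc m) = block_entropy m + ln \<rho>" using le[OF m] entropy_rate_le_increment[of m] entropy_rate by simp
  then have eq: "pmf_entropy (?P m) = expect (?P m) (\<lambda>w. - ln (markov_weight w))"
    using expect_markov_weight[OF m] by (simp add: block_entropy_def)
  have pmf_eq: "markov_weight w = pmf (?P m) w" if "w \<in> set_pmf (?P m)" for w
    by (rule gibbs_inequality(2)[where p = "?P m" and q = markov_weight, OF fin markov_weight_pos[of _ m] sum_le[OF m] eq that])
  have "markov_weight ?w = pmf (?P m) ?w"
  proof (cases "?w \<in> set_pmf (?P m)")
    \<comment> \<open>The weights on the support already add up to 1, so an admissible word off the
      support has weight 0.\<close>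
    case False
    have "(\<Sum>w\<in>set_pmf (?P m). markov_weight w) = 1" using pmf_eq sum_pmf_set_pmf[OF fin[of m]] by simp
    then have "1 + markov_weight ?w = (\<Sum>w\<in>insert ?w (set_pmf (?P m)). markov_weight w)" using False fin by simp
    also have "\<dots> \<le> (\<Sum>w\<in>{w\<in>L. length w = Suc m}. markov_weight w)"
      using sub wL by (intro sum_mono2[OF finite_L_length] q0) (auto simp: m_def)
    also have "\<dots> = 1" by (rule sum_markov_weight[OF m])
    finally have "markov_weight ?w = 0" using q0[of ?w] by simp
    then show ?thesis using False by (simp add: set_pmf_iff)
  qed (rule pmf_eq)
  then show "prob (C ?w) = prob (C u) * parry_transition (last u) a"
    by (simp add: markov_weight_snoc pmf_stake m_def)
qed

lemma entropy_rate_le: "entropy_rate \<le> ln \<rho>"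
  using entropy_rate_le_increment[of 1] increment_le[of 1] by simp

text \<open>The transitions are known from \<open>markov\<close>; the law of the first letter
  remains. Stationarity makes \<rho> * (\<rho> + k j) * p b equal to T - t j, which depends only on
  the factor j of b. Summing over that factor expresses t j through T, so p b = T / (\<rho> + k
  j)^2, and normalisation yields T = \<rho> / Z.\<close>

lemma prob_C_max_entropy:
  assumes entropy_rate: "ln \<rho> \<le> entropy_rate" and u: "u \<in> L" "u \<noteq> []"
  shows "prob (C u) = parry_weight u"
proof -
  define p where "p a = prob (C [a])" for a
  define T where "T = (\<Sum>a\<in>A. p a * (\<rho> + k (fst a)))"
  define t where "t j = (\<Sum>a\<in>letters_at G j. p a * (\<rho> + k j))" for j
  have stat: "p b * (\<rho> * (\<rho> + k (fst b))) = T - t (fst b)" if b: "b \<in> A" for b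
  proof -
    let ?j = "fst b"
    have j: "?j < n" using b by (simp add: letters_iff)
    have "p b = pmf (law \<nu> shd) b"
    proof -
      have "{x \<in> space \<nu>. shd x = b} = C [b]" by (auto simp: in_C_iff)
      then show ?thesis by (simp add: p_def pmf_law[OF simple_shd])
    qed
    also have "\<dots> = pmf (law \<nu> (\<lambda>s. stl s !! 0)) b"
      using law_T_pow[OF simple_shd, of 1] by simp
    also have "\<dots> = prob {x \<in> space \<nu>. stl x !! 0 = b}"
      using simple_snth[of 1] by (subst pmf_law) simp_all
    also have "{x \<in> space \<nu>. stl x !! 0 = b} = (\<Union>a\<in>A. C [a, b])"
    proof (intro equalityI subsetI)
      fix x assume x: "x \<in> {x \<in> space \<nu>. stl x !! 0 = b}"
      then have "shd x \<in> A" using stake_in_L[of x 1] by (simp add: Cons_in_L)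
      then show "x \<in> (\<Union>a\<in>A. C [a, b])" using x by (intro UN_I[of "shd x"]) (auto simp: in_C_iff)
    qed (auto simp: in_C_iff)
    also have "prob \<dots> = (\<Sum>a\<in>A. prob (C [a, b]))"
      using C_sets_nu by (intro finite_measure_finite_Union) (auto simp: disjoint_family_on_def in_C_iff)
    also have "\<dots> = (\<Sum>a\<in>A - letters_at G ?j. prob (C [a, b]))"
    proof (rule sum.mono_neutral_right)
      have "[a, b] \<notin> L" if "a \<in> letters_at G ?j" for a using that by (simp add: Cons_in_L letters_at_iff)
      then show "\<forall>a\<in>A - (A - letters_at G ?j). prob (C [a, b]) = 0" using C_empty by auto
    qed auto
    also have "\<dots> = (\<Sum>a\<in>A - letters_at G ?j. p a * (\<rho> + k (fst a))) / (\<rho> * (\<rho> + k ?j))"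
      unfolding sum_divide_distrib
    proof (rule sum.cong)
      fix a assume a: "a \<in> A - letters_at G ?j"
      then have "b \<in> ext [a]" using b by (auto simp: ext_def letters_iff)
      then show "prob (C [a, b]) = p a * (\<rho> + k (fst a)) / (\<rho> * (\<rho> + k ?j))"
        using markov[OF entropy_rate, of "[a]" b] a by (simp add: Cons_in_L p_def parry_transition_def)
    qed simp
    finally have "p b * (\<rho> * (\<rho> + k ?j)) = (\<Sum>a\<in>A - letters_at G ?j. p a * (\<rho> + k (fst a)))"
      using rho_pos rho_k_pos[of ?j] by simp
    moreover have "T = (\<Sum>a\<in>A - letters_at G ?j. p a * (\<rho> + k (fst a))) + (\<Sum>a\<in>letters_at G ?j. p a * (\<rho> + k (fst a)))"
      unfolding T_def by (rule sum.subset_diff[OF letters_at_subset[OF j] finite_letters])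
    moreover have "(\<Sum>a\<in>letters_at G ?j. p a * (\<rho> + k (fst a))) = t ?j"
      unfolding t_def by (rule sum.cong) (auto simp: letters_at_iff)
    ultimately show ?thesis by simp
  qed
  have p: "p b = T / (\<rho> + k (fst b))\<^sup>2" if b: "b \<in> A" for b
  proof -
    let ?j = "fst b"
    have j: "?j < n" using b by (simp add: letters_iff)
    have "\<rho> * t ?j = (\<Sum>a\<in>letters_at G ?j. T - t ?j)"
      unfolding t_def[of ?j] sum_distrib_left
    proof (rule sum.cong)
      fix a assume a: "a \<in> letters_at G ?j"
      then have "a \<in> A" "fst a = ?j" using letters_at_subset[OF j] by (auto simp: letters_at_iff)
      then show "\<rho> * (p a * (\<rho> + k ?j)) = T - (\<Sum>a\<in>letters_at G ?j. p a * (\<rho> + k ?j))"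
        using stat[of a] by (simp add: t_def mult_ac)
    qed simp
    then have "\<rho> * t ?j = k ?j * (T - t ?j)" by simp
    then have "(T - t ?j) * (\<rho> + k ?j) = T * \<rho>" by (simp add: algebra_simps)
    then have "p b * (\<rho> * (\<rho> + k ?j)) * (\<rho> + k ?j) = T * \<rho>" by (simp add: stat[OF b])
    then have "\<rho> * (p b * (\<rho> + k ?j)\<^sup>2) = \<rho> * T" by (simp only: power2_eq_square mult_ac)
    then have "p b * (\<rho> + k ?j)\<^sup>2 = T" using rho_pos by simp
    then show ?thesis using rho_k_pos[of ?j] by (simp add: eq_divide_eq)
  qed
  have "1 = (\<Sum>a\<in>A. p a)"
  proof -
    have "{u\<in>L. length u = 1} = (\<lambda>a. [a]) ` A" by (auto simp: Cons_in_L length_Suc_conv)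
    then show ?thesis using sum_prob_C[of 1] by (simp add: sum.reindex inj_on_def p_def)
  qed
  also have "\<dots> = T * (\<Sum>a\<in>A. 1 / (\<rho> + k (fst a))\<^sup>2)" by (simp add: p sum_distrib_left)
  finally have TZ: "T * Z = \<rho>" by (simp add: Z_eq algebra_simps)
  have base: "prob (C [b]) = parry_weight [b]" if "b \<in> A" for b
  proof -
    have "T = \<rho> / Z" using TZ Z_pos by (simp add: field_simps)
    then show ?thesis using p[OF that] rho_pos by (simp add: p_def parry_weight_eq power2_eq_square)
  qed
  show ?thesis
    using u
  proof (induction u rule: rev_induct)
    case (snoc a u)
    show ?case
    proof (cases "u = []")
      case True
      then show ?thesis using snoc.prems base by (simp add: Cons_in_L)
    next
      case False
      then have "u \<in> L" "a \<in> ext u" using snoc.prems by (auto simp: snoc_in_L ext_def)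
      then show ?thesis using snoc.IH markov[OF entropy_rate] False by (simp add: parry_weight_snoc)
    qed
  qed simp
qed

end

section \<open>Existence and uniqueness of the measure of maximal entropy\<close>

context extremal_walk
begin

text \<open>The harmonic measure and the measure of maximal entropy have the same transitions, so that the
  latter is a density with respect to the former, depending on the first letter only.\<close>

definition parry :: "(nat \<times> 'a) stream measure" where
  "parry = density (distr \<Omega> N limit_word) (\<lambda>s. ennreal (\<rho> / (\<rho> + k (fst (shd s))) / Z))"

lemma sets_parry: "sets parry = sets N"
  by (simp add: parry_def)

lemma space_parry [simp]: "space parry = Linf"
  using sets_eq_imp_space_eq[OF sets_parry] by simp

lemma emeasure_parry:
  assumes "u \<in> L" "u \<noteq> []" shows "emeasure parry (C u) = ennreal (parry_weight u)"
proof -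
  let ?H = "distr \<Omega> N limit_word"
  interpret H: prob_space ?H by (rule \<Omega>.prob_space_distr[OF measurable_limit_word])
  let ?d = "\<lambda>a. ennreal (\<rho> / (\<rho> + k (fst a)) / Z)"
  have meas: "(\<lambda>s. ?d (shd s)) \<in> borel_measurable ?H"
    unfolding measurable_distr_eq1 infinite_words_space_def
    by (intro measurable_restrict_space1 measurable_compose[OF measurable_shd]) simp
  have "emeasure parry (C u) = (\<integral>\<^sup>+s. ?d (shd s) * indicator (C u) s \<partial>?H)"
    unfolding parry_def using meas C_sets by (subst emeasure_density) simp_all
  also have "\<dots> = (\<integral>\<^sup>+s. ?d (hd u) * indicator (C u) s \<partial>?H)"
  proof (rule nn_integral_cong)
    fix s
    show "?d (shd s) * indicator (C u) s = ?d (hd u) * indicator (C u) s"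
      using assms(2) by (cases u) (auto simp: indicator_def in_C_iff)
  qed
  also have "\<dots> = ?d (hd u) * emeasure ?H (C u)"
    by (rule nn_integral_cmult_indicator) (simp add: C_sets)
  also have "\<dots> = ennreal (\<rho> / (\<rho> + k (fst (hd u))) / Z * harmonic_weight u)"
    unfolding H.emeasure_eq_measure prob_limit_word[OF assms(1)]
    using rho_pos rho_k_pos Z_pos by (intro ennreal_mult[symmetric]) (auto simp: less_imp_le harmonic_weight_pos)
  also have "\<rho> / (\<rho> + k (fst (hd u))) / Z * harmonic_weight u = parry_weight u"
    using assms(2) rho_pos by (cases "length u") (auto simp: parry_weight_eq harmonic_weight_def power2_eq_square)
  finally show ?thesis .
qed

lemma letters_cylinders: "Linf = (\<Union>a\<in>A. C [a])"
proof (intro equalityI subsetI)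
  fix x assume x: "x \<in> Linf"
  then have "shd x \<in> A" using stake_in_L[of x 1] by (simp add: Cons_in_L)
  then show "x \<in> (\<Union>a\<in>A. C [a])" using x by (intro UN_I[of "shd x"]) (auto simp: in_C_iff)
qed (auto simp: in_C_iff)

lemma prob_space_parry: "prob_space parry"
proof (rule prob_spaceI)
  have "emeasure parry (space parry) = (\<Sum>a\<in>A. emeasure parry (C [a]))"
    unfolding space_parry letters_cylinders using C_sets
    by (intro sum_emeasure[symmetric]) (auto simp: disjoint_family_on_def in_C_iff sets_parry)
  also have "\<dots> = (\<Sum>a\<in>A. ennreal (parry_weight [a]))"
    by (intro sum.cong emeasure_parry) (auto simp: Cons_in_L)
  also have "\<dots> = 1" using sum_parry_weight_letters by (simp add: sum_ennreal less_imp_le[OF parry_weight_pos])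
  finally show "emeasure parry (space parry) = 1" .
qed

lemma measure_parry: "u \<in> L \<Longrightarrow> u \<noteq> [] \<Longrightarrow> measure parry (C u) = parry_weight u"
  using emeasure_parry[of u] less_imp_le[OF parry_weight_pos] by (simp add: measure_def)

lemma stl_measurable: "stl \<in> N \<rightarrow>\<^sub>M N"
  unfolding infinite_words_space_def
proof (rule measurable_restrict_space2)
  show "stl \<in> space (restrict_space (stream_space (count_space A)) Linf) \<rightarrow> Linf"
  proof
    fix s assume "s \<in> space (restrict_space (stream_space (count_space A)) Linf)"
    then have s: "s \<in> Linf" by (simp add: space_restrict_space)
    then have "stake m (stl s) \<in> L" for m using stake_in_L[OF s, of "Suc m"] by (simp add: Cons_in_L)
    moreover have "stl s \<in> streams A" using s L_inf_subset streams_stl by blast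
    ultimately show "stl s \<in> Linf" by (simp add: infinite_words_def)
  qed
  show "stl \<in> restrict_space (stream_space (count_space A)) Linf \<rightarrow>\<^sub>M stream_space (count_space A)"
    by (rule measurable_restrict_space1) (rule measurable_stl)
qed

lemma shift_invariant_parry: "shift_invariant_prob n G parry"
  unfolding shift_invariant_prob_def
proof (intro conjI)
  interpret P: prob_space parry by (rule prob_space_parry)
  show "prob_space parry" by (rule prob_space_parry)
  show "sets parry = sets N" by (rule sets_parry)
  show meas: "stl \<in> parry \<rightarrow>\<^sub>M parry"
    using stl_measurable measurable_cong_sets[OF sets_parry sets_parry] by simp
  show "distr parry parry stl = parry"
  proof (rule measure_eq_on_cylinders)
    show "prob_space (distr parry parry stl)" by (rule P.prob_space_distr[OF meas])
    show "sets (distr parry parry stl) = sets N" by (simp add: sets_parry)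
    fix u assume u: "u \<in> L"
    show "measure (distr parry parry stl) (C u) = measure parry (C u)"
    proof (cases "u = []")
      case True
      interpret Q: prob_space "distr parry parry stl" by (rule P.prob_space_distr[OF meas])
      show ?thesis using P.prob_space Q.prob_space True by (simp add: C_Nil)
    next
      case False
      let ?j = "fst (hd u)"
      have "measure (distr parry parry stl) (C u) = measure parry (stl -` C u \<inter> space parry)"
        by (rule measure_distr[OF meas]) (simp add: sets_parry C_sets)
      also have "stl -` C u \<inter> space parry = (\<Union>a\<in>A. C (a # u))"
      proof (intro equalityI subsetI)
        fix x assume x: "x \<in> stl -` C u \<inter> space parry"
        then have "shd x \<in> A" using stake_in_L[of x 1] by (simp add: Cons_in_L)
        then show "x \<in> (\<Union>a\<in>A. C (a # u))" using x by (intro UN_I[of "shd x"]) (auto simp: in_C_iff)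
      next
        fix x assume "x \<in> (\<Union>a\<in>A. C (a # u))"
        then have x: "x \<in> Linf" "stake (length u) (stl x) = u" by (auto simp: in_C_iff)
        have "stl x \<in> Linf" using measurable_space[OF meas, of x] x(1) by simp
        then show "x \<in> stl -` C u \<inter> space parry" using x by (simp add: in_C_iff)
      qed
      also have "measure parry \<dots> = (\<Sum>a\<in>A. measure parry (C (a # u)))"
        using C_sets by (intro P.finite_measure_finite_Union) (auto simp: disjoint_family_on_def in_C_iff sets_parry)
      also have "\<dots> = (\<Sum>a\<in>A - letters_at G ?j. measure parry (C (a # u)))"
      proof (rule sum.mono_neutral_right)
        have "a # u \<notin> L" if "a \<in> letters_at G ?j" for a using that False by (simp add: Cons_in_L letters_at_iff)
        then show "\<forall>a\<in>A - (A - letters_at G ?j). measure parry (C (a # u)) = 0" using C_empty by auto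
      qed auto
      also have "\<dots> = (\<Sum>a\<in>A - letters_at G ?j. parry_weight (a # u))"
        using u by (intro sum.cong measure_parry) (auto simp: Cons_in_L letters_iff)
      also have "\<dots> = measure parry (C u)" using u False by (simp add: parry_weight_Cons_sum measure_parry)
      finally show ?thesis .
    qed
  qed (use prob_space_parry sets_parry in auto)
qed

sublocale parry: shift_measure n G parry
  by standard (rule shift_invariant_parry)

text \<open>A cylinder of length m has measure at most \<rho>^(-m) / Z, so every block, and hence
  the average, has information at least m * ln \<rho> + ln Z.\<close>

lemma parry_entropy: "ln \<rho> \<le> parry.entropy_rate"
proof -
  have "(\<lambda>m. ln \<rho> + ln Z / real m) \<longlonglongrightarrow> ln \<rho> + 0"
    by (intro tendsto_add lim_const_over_n tendsto_const)
  then have lim: "(\<lambda>m. ln \<rho> + ln Z / real m) \<longlonglongrightarrow> ln \<rho>" by simp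
  show ?thesis
  proof (rule LIMSEQ_le[OF lim parry.entropy_rate_lim], intro exI[of _ 1] allI impI)
    fix m :: nat assume m: "1 \<le> m"
    let ?P = "law parry (stake m)"
    have fin: "finite (set_pmf ?P)" by (rule parry.set_law(2)[OF parry.simple_stake])
    have "real m * ln \<rho> + ln Z = expect ?P (\<lambda>w. real m * ln \<rho> + ln Z)" by simp
    also have "\<dots> \<le> expect ?P (\<lambda>w. - ln (pmf ?P w))"
    proof (rule expect_mono[OF fin])
      fix w assume "w \<in> set_pmf ?P"
      from parry.set_stake[OF this] have w: "w \<in> L" "length w = m" by auto
      then have "w \<noteq> []" using m by auto
      then have "pmf ?P w = parry_weight w" using w by (simp add: parry.pmf_stake[OF w(2)] measure_parry)
      also have "\<dots> \<le> \<rho>\<^sup>2 / (\<rho> ^ m * \<rho> * \<rho>) / Z"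
        unfolding parry_weight_eq w(2) using rho_pos Z_pos
        by (intro divide_right_mono divide_left_mono mult_mono mult_pos_pos add_pos_nonneg) auto
      also have "\<dots> = 1 / (\<rho> ^ m * Z)" using rho_pos by (simp add: power2_eq_square)
      finally have "ln (pmf ?P w) \<le> ln (1 / (\<rho> ^ m * Z))"
        using pmf_positive[OF \<open>w \<in> set_pmf ?P\<close>] by (intro ln_mono)
      also have "\<dots> = - (real m * ln \<rho> + ln Z)" using rho_pos Z_pos by (simp add: ln_div ln_mult_pos ln_realpow)
      finally show "real m * ln \<rho> + ln Z \<le> - ln (pmf ?P w)" by simp
    qed
    also have "\<dots> = parry.block_entropy m" by (simp add: parry.block_entropy_def pmf_entropy_expect[OF fin])
    finally have "(real m * ln \<rho> + ln Z) / real m \<le> parry.block_entropy m / real m" by (rule divide_right_mono) simp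
    then show "ln \<rho> + ln Z / real m \<le> parry.block_entropy m / real m" using m by (simp add: add_divide_distrib)
  qed
qed

text \<open>\<open>parry\<close> attains the upper bound ln \<rho>. Any other maximiser has at least
  this rate, which fixes its values on cylinders and thereby the measure.\<close>

lemma max_entropy_measure:
  shows "\<exists>!\<nu>. is_max_entropy_measure n G \<nu>"
    and "is_max_entropy_measure n G \<nu> \<Longrightarrow> u \<in> L \<Longrightarrow> u \<noteq> [] \<Longrightarrow> measure \<nu> (C u) = parry_weight u"
proof -
  have le: "ks_entropy \<nu> stl \<le> ks_entropy parry stl" if "shift_invariant_prob n G \<nu>" for \<nu>
  proof -
    interpret V: shift_measure n G \<nu> by standard (rule that)
    show ?thesis using V.entropy_rate_le parry_entropy by (simp add: V.ks_entropy_eq parry.ks_entropy_eq)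
  qed
  have weights: "measure \<nu> (C u) = parry_weight u" if max: "is_max_entropy_measure n G \<nu>" and u: "u \<in> L" "u \<noteq> []" for \<nu> u
  proof -
    have inv: "shift_invariant_prob n G \<nu>" using max by (simp add: is_max_entropy_measure_def)
    interpret V: shift_measure n G \<nu> by standard (rule inv)
    have "ks_entropy parry stl \<le> ks_entropy \<nu> stl"
      using max shift_invariant_parry by (simp add: is_max_entropy_measure_def)
    then have "ln \<rho> \<le> V.entropy_rate" using parry_entropy by (simp add: V.ks_entropy_eq parry.ks_entropy_eq)
    then show ?thesis using u by (rule V.prob_C_max_entropy)
  qed
  then show "is_max_entropy_measure n G \<nu> \<Longrightarrow> u \<in> L \<Longrightarrow> u \<noteq> [] \<Longrightarrow> measure \<nu> (C u) = parry_weight u" .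
  have parry: "is_max_entropy_measure n G parry"
    using shift_invariant_parry le by (simp add: is_max_entropy_measure_def)
  show "\<exists>!\<nu>. is_max_entropy_measure n G \<nu>"
  proof (rule ex1I[of _ parry])
    fix \<nu> assume max: "is_max_entropy_measure n G \<nu>"
    then have inv: "shift_invariant_prob n G \<nu>" by (simp add: is_max_entropy_measure_def)
    interpret V: shift_measure n G \<nu> by standard (rule inv)
    show "\<nu> = parry"
    proof (rule measure_eq_on_cylinders)
      fix u assume u: "u \<in> L"
      show "measure \<nu> (C u) = measure parry (C u)"
      proof (cases "u = []")
        case True
        then show ?thesis using V.prob_space parry.prob_space by (simp add: C_Nil)
      next
        case False
        then show ?thesis using weights[OF max u] weights[OF parry u] by simp
      qed
    qed (use V.prob_space_axioms V.sets_nu prob_space_parry sets_parry in auto)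
  qed (rule parry)
qed

end

theorem proposition5p2:
  fixes n :: nat and G :: "nat \<Rightarrow> ('a, 'b) monoid_scheme"
  assumes "n \<ge> 2"
    and "\<And>i. i < n \<Longrightarrow> group (G i)"
    and "\<And>i. i < n \<Longrightarrow> finite (carrier (G i))"
    and "\<And>i. i < n \<Longrightarrow> carrier (G i) \<noteq> {\<one>\<^bsub>G i\<^esub>}"
    and "\<not> free_product n G \<cong> free_product 2 (\<lambda>_. integer_mod_group 2)"
  defines "k \<equiv> \<lambda>i. real (card (letters_at G i))"
    and "\<rho> \<equiv> rho n G"
    and "\<mu> \<equiv> extremal_pmf n G"
    and "C \<equiv> \<lambda>u. cylinder (letters n G) u \<inter> infinite_words n G"
  shows
    "(walk_entropy n G \<mu> / (drift n G \<mu> * volume n G) = 1 \<and> extremal n G)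
     \<and>
     ((\<exists>!\<nu>. is_harmonic_measure n G \<mu> \<nu>) \<and>
      (\<forall>\<nu>. is_harmonic_measure n G \<mu> \<nu> \<longrightarrow>
        (\<forall>u\<in>reduced_words n G. \<forall>j<n. u \<noteq> [] \<and> last u \<in> letters_at G j \<longrightarrow>
           measure \<nu> (C u) = 1 / \<rho> ^ (length u - 1) * (1 / (\<rho> + k j)))))
     \<and>
     (subshift_of_finite_type (letters n G) (infinite_words n G) \<and>
      (\<exists>!\<nu>. is_max_entropy_measure n G \<nu>) \<and>
      (\<forall>\<nu>. is_max_entropy_measure n G \<nu> \<longrightarrow>
        (\<forall>u\<in>reduced_words n G. \<forall>i<n. \<forall>j<n.
           u \<noteq> [] \<and> hd u \<in> letters_at G i \<and> last u \<in> letters_at G j \<longrightarrow>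
           measure \<nu> (C u) = cylinder_weight n G i (length u) j / total_weight n G)))"
proof -
  interpret F: finite_free_product n G
    by (rule finite_free_product.intro) (use assms(1-4) in auto)
  have "\<not> (n = 2 \<and> (\<forall>i<2. card (letters_at G i) = 1))"
    using F.iso_infinite_dihedral assms(5) by blast
  then interpret E: extremal_walk n G
    by (intro extremal_walk.intro extremal_walk_axioms.intro F.finite_free_product_axioms)
  have C: "C u = F.C u" for u by (simp add: C_def F.C_def)
  have harm: "measure \<nu> (C u) = 1 / \<rho> ^ (length u - 1) * (1 / (\<rho> + k j))"
    if "is_harmonic_measure n G \<mu> \<nu>" "u \<in> reduced_words n G" "u \<noteq> []" "last u \<in> letters_at G j" for \<nu> u j
    using E.harmonic_measure(2)[of \<nu> u] that
    by (simp add: C F.harmonic_weight_def \<rho>_def k_def \<mu>_def F.letters_at_iff)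
  have max: "measure \<nu> (C u) = cylinder_weight n G i (length u) j / total_weight n G"
    if "is_max_entropy_measure n G \<nu>" "u \<in> reduced_words n G" "u \<noteq> []" "hd u \<in> letters_at G i" "last u \<in> letters_at G j"
    for \<nu> u i j
    using E.max_entropy_measure(2)[of \<nu> u] that by (simp add: C F.parry_weight_def F.letters_at_iff)
  show ?thesis
    using E.quotient_eq_1 E.extremal E.harmonic_measure(1) harm F.subshift_of_finite_type_words
      E.max_entropy_measure(1) max
    unfolding \<mu>_def by blast
qed

end
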